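(* Let $J\in\mathbb{C}\mathbb{A}_5\otimes\mathbb{C}\mathbb{A}_5$ be the non-trivial twist of $\mathbb{C}\mathbb{A}_5$ supported on a Klein four-subgroup (Nikshych's twist), and let $(\mathbb{C}\mathbb{A}_5)^J$ be the corresponding twisted Hopf algebra. Let $H$ be a finite-dimensional complex Hopf algebra whose coradical is a Hopf subalgebra isomorphic to $(\mathbb{C}\mathbb{A}_5)^J$ as a Hopf algebra. Then $H\simeq(\mathbb{C}\mathbb{A}_5)^J$.
   Context: A twist for a Hopf algebra $A$ is an invertible $J\in A\otimes A$ with $(1\otimes J)(\mathrm{id}\otimes\Delta)(J)=(J\otimes1)(\Delta\otimes\mathrm{id})(J)$ and $(\varepsilon\otimes\mathrm{id})(J)=1=(\mathrm{id}\otimes\varepsilon)(J)$; the twisted Hopf algebra $A^J$ is the algebra $A$ with comultiplication $\Delta^J(a)=J\Delta(a)J^{-1}$. Nikshych's twist: let $P\subset\mathbb{A}_5$ be a subgroup isomorphic to $\mathbb{Z}_2\times\mathbb{Z}_2$, with character group $\widehat P$ and primitive idempotents $e_\chi=\frac14\sum_{g\in P}\chi(g^{-1})g\in\mathbb{C}P$, $\chi\in\widehat P$. Let $\beta:\widehat P\times\widehat P\to\mathbb{C}^\times$ be a normalized $2$-cocycle that is not a coboundary. Then $J=\sum_{\chi,\psi\in\widehat P}\beta(\chi,\psi)\,e_\chi\otimes e_\psi$. The coradical of a Hopf algebra is the sum of its simple subcoalgebras. *)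

theory Defs
  imports
    Complex_Main
    "HOL-Library.Poly_Mapping"
    "HOL-Algebra.Sym_Groups"
    "HOL-Algebra.Elementary_Groups"
begin

section \<open>Complex vector spaces and algebras\<close>

class complex_vector = ab_group_add +
  fixes scaleC :: "complex \<Rightarrow> 'a \<Rightarrow> 'a"  (infixr \<open>*\<^sub>C\<close> 75)
  assumes scaleC_add_right: "a *\<^sub>C (x + y) = a *\<^sub>C x + a *\<^sub>C y"
    and scaleC_add_left: "(a + b) *\<^sub>C x = a *\<^sub>C x + b *\<^sub>C x"
    and scaleC_scaleC: "a *\<^sub>C b *\<^sub>C x = (a * b) *\<^sub>C x"
    and scaleC_one: "1 *\<^sub>C x = x"

class complex_algebra_1 = complex_vector + ring_1 +
  assumes mult_scaleC_left: "(a *\<^sub>C x) * y = a *\<^sub>C (x * y)"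
    and mult_scaleC_right: "x * (a *\<^sub>C y) = a *\<^sub>C (x * y)"

global_interpretation cvec: vector_space "scaleC :: complex \<Rightarrow> 'a \<Rightarrow> 'a::complex_vector"
  by unfold_locales (simp_all add: scaleC_add_right scaleC_add_left scaleC_scaleC scaleC_one)

global_interpretation cvec_pair: vector_space_pair
  "scaleC :: complex \<Rightarrow> 'a \<Rightarrow> 'a::complex_vector"
  "scaleC :: complex \<Rightarrow> 'b \<Rightarrow> 'b::complex_vector"
  by unfold_locales

abbreviation clinear :: "('a::complex_vector \<Rightarrow> 'b::complex_vector) \<Rightarrow> bool" where
  "clinear \<equiv> Vector_Spaces.linear scaleC scaleC"

lemma clinear_iff:
  "clinear f \<longleftrightarrow> (\<forall>x y. f (x + y) = f x + f y) \<and> (\<forall>c x. f (c *\<^sub>C x) = c *\<^sub>C f x)"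
  by (simp add: linear_iff_module_hom module_hom_iff cvec.module_axioms)

lemmas clinear_add = cvec_pair.linear_add
  and clinear_scale = cvec_pair.linear_scale
  and clinear_zero = cvec_pair.linear_0
  and clinear_diff = cvec_pair.linear_diff
  and clinear_sum = cvec_pair.linear_sum

instantiation complex :: complex_algebra_1
begin
definition scaleC_complex :: "complex \<Rightarrow> complex \<Rightarrow> complex" where
  [simp]: "scaleC_complex a b = a * b"
instance by standard (simp_all add: algebra_simps)
end

instantiation poly_mapping :: (type, complex_vector) complex_vector
begin
definition scaleC_poly_mapping :: "complex \<Rightarrow> ('a \<Rightarrow>\<^sub>0 'b) \<Rightarrow> 'a \<Rightarrow>\<^sub>0 'b" where
  "scaleC_poly_mapping c p = Poly_Mapping.map (scaleC c) p"

lemma lookup_scaleC [simp]: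
  "Poly_Mapping.lookup (c *\<^sub>C p) k = c *\<^sub>C Poly_Mapping.lookup p k"
  for p :: "'a \<Rightarrow>\<^sub>0 'b"
  by (simp add: scaleC_poly_mapping_def Poly_Mapping.map.rep_eq when_def)

instance
  by standard (rule poly_mapping_eqI,
    simp add: lookup_add scaleC_add_right scaleC_add_left scaleC_scaleC scaleC_one)+
end

lemma scaleC_single: "c *\<^sub>C Poly_Mapping.single k x = Poly_Mapping.single k (c *\<^sub>C x)"
  by (rule poly_mapping_eqI) (simp add: lookup_single when_def)

lemma poly_mapping_sum_single:
  "(\<Sum>k\<in>Poly_Mapping.keys p. Poly_Mapping.single k (Poly_Mapping.lookup p k)) = p"
  by (rule poly_mapping_eqI)
    (auto simp: lookup_sum lookup_single when_def in_keys_iff)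

instance poly_mapping :: (monoid_add, complex_algebra_1) complex_algebra_1
proof
  fix c :: complex and p q :: "'a \<Rightarrow>\<^sub>0 'b"
  let ?P = "\<lambda>p. \<Sum>k\<in>Poly_Mapping.keys p. Poly_Mapping.single k (Poly_Mapping.lookup p k)"
  have "c *\<^sub>C ?P p * ?P q = c *\<^sub>C (?P p * ?P q)"
    by (simp add: cvec.scale_sum_right sum_product mult_single scaleC_single mult_scaleC_left)
  then show "c *\<^sub>C p * q = c *\<^sub>C (p * q)" by (simp add: poly_mapping_sum_single)
  have "?P p * (c *\<^sub>C ?P q) = c *\<^sub>C (?P p * ?P q)"
    by (simp add: cvec.scale_sum_right sum_product mult_single scaleC_single mult_scaleC_right)
  then show "p * c *\<^sub>C q = c *\<^sub>C (p * q)" by (simp add: poly_mapping_sum_single)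
qed

definition finite_dimensional :: "'a::complex_vector itself \<Rightarrow> bool" where
  "finite_dimensional _ \<longleftrightarrow> (\<exists>B::'a set. finite B \<and> cvec.span B = UNIV)"


section \<open>Tensor products\<close>

text \<open>
  \<open>('a, 'b) tensor\<close> is the quotient of the complex vector space with basis \<open>'a \<times> 'b\<close> by the
  subspace generated by the bilinearity relations; \<open>tlift\<close> is its universal property.
\<close>

definition tensor_relators :: "('a::complex_vector \<times> 'b::complex_vector \<Rightarrow>\<^sub>0 complex) set" where
  "tensor_relators =
     {Poly_Mapping.single (a + a', b) 1 - Poly_Mapping.single (a, b) 1 - Poly_Mapping.single (a', b) 1
        | a a' b. True} \<union>
     {Poly_Mapping.single (a, b + b') 1 - Poly_Mapping.single (a, b) 1 - Poly_Mapping.single (a, b') 1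
        | a b b'. True} \<union>
     {Poly_Mapping.single (c *\<^sub>C a, b) 1 - c *\<^sub>C Poly_Mapping.single (a, b) 1 | c a b. True} \<union>
     {Poly_Mapping.single (a, c *\<^sub>C b) 1 - c *\<^sub>C Poly_Mapping.single (a, b) 1 | c a b. True}"

definition tensor_rel ::
  "('a::complex_vector \<times> 'b::complex_vector \<Rightarrow>\<^sub>0 complex) \<Rightarrow> ('a \<times> 'b \<Rightarrow>\<^sub>0 complex) \<Rightarrow> bool" where
  "tensor_rel x y \<longleftrightarrow> x - y \<in> cvec.span tensor_relators"

quotient_type (overloaded) ('a, 'b) tensor =
  "'a::complex_vector \<times> 'b::complex_vector \<Rightarrow>\<^sub>0 complex" / tensor_rel
proof (rule equivpI)
  show "reflp (tensor_rel :: ('a \<times> 'b \<Rightarrow>\<^sub>0 complex) \<Rightarrow> _)"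
    by (rule reflpI) (simp add: tensor_rel_def cvec.span_zero)
  show "symp (tensor_rel :: ('a \<times> 'b \<Rightarrow>\<^sub>0 complex) \<Rightarrow> _)"
    by (rule sympI) (metis tensor_rel_def cvec.span_neg minus_diff_eq)
  show "transp (tensor_rel :: ('a \<times> 'b \<Rightarrow>\<^sub>0 complex) \<Rightarrow> _)"
  proof (rule transpI)
    fix x y z :: "'a \<times> 'b \<Rightarrow>\<^sub>0 complex"
    assume "tensor_rel x y" "tensor_rel y z"
    then have "(x - y) + (y - z) \<in> cvec.span tensor_relators"
      unfolding tensor_rel_def by (rule cvec.span_add)
    then show "tensor_rel x z" by (simp add: tensor_rel_def)
  qed
qed

instantiation tensor :: (complex_vector, complex_vector) complex_vector
begin

lift_definition zero_tensor :: "('a, 'b) tensor" is 0 .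

lift_definition plus_tensor :: "('a, 'b) tensor \<Rightarrow> ('a, 'b) tensor \<Rightarrow> ('a, 'b) tensor" is "(+)"
  unfolding tensor_rel_def using cvec.span_add by (metis add_diff_add)

lift_definition uminus_tensor :: "('a, 'b) tensor \<Rightarrow> ('a, 'b) tensor" is uminus
  unfolding tensor_rel_def by (metis cvec.span_neg minus_diff_minus)

lift_definition minus_tensor :: "('a, 'b) tensor \<Rightarrow> ('a, 'b) tensor \<Rightarrow> ('a, 'b) tensor" is "(-)"
  unfolding tensor_rel_def
proof -
  fix x y x' y' :: "'a \<times> 'b \<Rightarrow>\<^sub>0 complex"
  assume "x - y \<in> cvec.span tensor_relators" "x' - y' \<in> cvec.span tensor_relators"
  then have "(x - y) - (x' - y') \<in> cvec.span tensor_relators" by (rule cvec.span_diff)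
  then show "x - x' - (y - y') \<in> cvec.span tensor_relators" by (simp add: algebra_simps)
qed

lift_definition scaleC_tensor :: "complex \<Rightarrow> ('a, 'b) tensor \<Rightarrow> ('a, 'b) tensor" is scaleC
  unfolding tensor_rel_def by (metis cvec.span_scale cvec.scale_right_diff_distrib)

instance
  by standard (transfer, simp add: tensor_rel_def cvec.span_zero algebra_simps
      cvec.scale_right_distrib cvec.scale_left_distrib)+
end

lift_definition tens :: "'a::complex_vector \<Rightarrow> 'b::complex_vector \<Rightarrow> ('a, 'b) tensor"
  (infixr \<open>\<boxtimes>\<close> 72) is "\<lambda>a b. Poly_Mapping.single (a, b) 1" .

definition bilin :: "('a::complex_vector \<Rightarrow> 'b::complex_vector \<Rightarrow> 'c::complex_vector) \<Rightarrow> bool" where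
  "bilin f \<longleftrightarrow> (\<forall>y. clinear (\<lambda>x. f x y)) \<and> (\<forall>x. clinear (f x))"

definition free_ext ::
  "('a \<Rightarrow> 'b \<Rightarrow> 'c::complex_vector) \<Rightarrow> ('a \<times> 'b \<Rightarrow>\<^sub>0 complex) \<Rightarrow> 'c" where
  "free_ext f x = (\<Sum>k\<in>Poly_Mapping.keys x. Poly_Mapping.lookup x k *\<^sub>C f (fst k) (snd k))"

text \<open>\<open>tlift f\<close> is the linear map with \<open>tlift f (a \<boxtimes> b) = f a b\<close>; it is only meaningful for
  bilinear \<open>f\<close>.\<close>

definition tlift ::
  "('a::complex_vector \<Rightarrow> 'b::complex_vector \<Rightarrow> 'c::complex_vector) \<Rightarrow> ('a, 'b) tensor \<Rightarrow> 'c" where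
  "tlift f t = free_ext f (rep_tensor t)"

lemma bilin_iff:
  "bilin f \<longleftrightarrow> (\<forall>x x' y. f (x + x') y = f x y + f x' y) \<and> (\<forall>c x y. f (c *\<^sub>C x) y = c *\<^sub>C f x y) \<and>
     (\<forall>x y y'. f x (y + y') = f x y + f x y') \<and> (\<forall>c x y. f x (c *\<^sub>C y) = c *\<^sub>C f x y)"
  unfolding bilin_def clinear_iff by blast

lemma free_ext_superset:
  assumes "finite S" "Poly_Mapping.keys x \<subseteq> S"
  shows "free_ext f x = (\<Sum>k\<in>S. Poly_Mapping.lookup x k *\<^sub>C f (fst k) (snd k))"
  unfolding free_ext_def
  by (rule sum.mono_neutral_left) (use assms in \<open>auto simp: in_keys_iff\<close>)

lemma clinear_free_ext: "clinear (free_ext f)"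
  unfolding clinear_iff
proof safe
  fix x y :: "'a \<times> 'b \<Rightarrow>\<^sub>0 complex" and c :: complex
  let ?S = "Poly_Mapping.keys x \<union> Poly_Mapping.keys y"
  show "free_ext f (x + y) = free_ext f x + free_ext f y"
    using Poly_Mapping.keys_add[of x y]
    by (simp add: free_ext_superset[where S = ?S] lookup_add scaleC_add_left sum.distrib)
  have "Poly_Mapping.keys (c *\<^sub>C x) \<subseteq> Poly_Mapping.keys x" by (auto simp: in_keys_iff)
  then show "free_ext f (c *\<^sub>C x) = c *\<^sub>C free_ext f x"
    by (simp add: free_ext_superset[where S = "Poly_Mapping.keys x"] cvec.scale_sum_right)
qed

lemma free_ext_single: "free_ext f (Poly_Mapping.single (a, b) c) = c *\<^sub>C f a b"
  by (simp add: free_ext_superset[where S = "{(a, b)}"])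

lemma free_ext_cong:
  assumes f: "bilin f" and r: "tensor_rel x y"
  shows "free_ext f x = free_ext f y"
proof -
  have *: "free_ext f z = 0" if "z \<in> tensor_relators" for z
    using that f unfolding tensor_relators_def bilin_iff
    by (auto simp: clinear_diff[OF clinear_free_ext] clinear_scale[OF clinear_free_ext]
        free_ext_single scaleC_one)
  have "free_ext f (x - y) = 0"
    by (rule cvec_pair.linear_eq_0_on_span[OF clinear_free_ext *])
      (use r in \<open>auto simp: tensor_rel_def\<close>)
  then show ?thesis by (simp add: clinear_diff[OF clinear_free_ext])
qed

lemma rep_tensor_rel: "tensor_rel (rep_tensor (abs_tensor x)) x"
  by (metis Quotient_rep_abs Quotient_tensor tensor.abs_eq_iff)

lemma tlift_abs: "bilin f \<Longrightarrow> tlift f (abs_tensor x) = free_ext f x"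
  unfolding tlift_def by (rule free_ext_cong[OF _ rep_tensor_rel])

lemma tlift_tens [simp]: "bilin f \<Longrightarrow> tlift f (a \<boxtimes> b) = f a b"
  by (simp add: tens.abs_eq tlift_abs free_ext_single scaleC_one)

lemma clinear_tlift: "bilin f \<Longrightarrow> clinear (tlift f)"
  unfolding clinear_iff
proof safe
  fix x y :: "('a, 'b) tensor" and c :: complex
  assume f: "bilin f"
  obtain u v where uv: "x = abs_tensor u" "y = abs_tensor v"
    by (metis Quotient_abs_rep Quotient_tensor)
  show "tlift f (x + y) = tlift f x + tlift f y"
    unfolding uv plus_tensor.abs_eq
    by (simp add: tlift_abs f clinear_add[OF clinear_free_ext])
  show "tlift f (c *\<^sub>C x) = c *\<^sub>C tlift f x"
    unfolding uv scaleC_tensor.abs_eq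
    by (simp add: tlift_abs f clinear_scale[OF clinear_free_ext])
qed

lemma tens_add_left: "(a + a') \<boxtimes> b = a \<boxtimes> b + a' \<boxtimes> b"
  by transfer (unfold tensor_rel_def diff_diff_add[symmetric],
    rule cvec.span_base, unfold tensor_relators_def, blast)

lemma tens_add_right: "a \<boxtimes> (b + b') = a \<boxtimes> b + a \<boxtimes> b'"
  by transfer (unfold tensor_rel_def diff_diff_add[symmetric],
    rule cvec.span_base, unfold tensor_relators_def, blast)

lemma tens_scale_left: "(c *\<^sub>C a) \<boxtimes> b = c *\<^sub>C (a \<boxtimes> b)"
  by transfer (unfold tensor_rel_def, rule cvec.span_base, unfold tensor_relators_def, blast)

lemma tens_scale_right: "a \<boxtimes> (c *\<^sub>C b) = c *\<^sub>C (a \<boxtimes> b)"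
  by transfer (unfold tensor_rel_def, rule cvec.span_base, unfold tensor_relators_def, blast)

lemma bilin_tens: "bilin (\<boxtimes>)"
  by (simp add: bilin_iff tens_add_left tens_add_right tens_scale_left tens_scale_right)

lemma tensor_induct [case_names tens add]:
  assumes "\<And>a b. P (a \<boxtimes> b)" and "\<And>s t. P s \<Longrightarrow> P t \<Longrightarrow> P (s + t)"
  shows "P t"
proof -
  obtain u where u: "t = abs_tensor u" by (metis Quotient_abs_rep Quotient_tensor)
  define T where "T c k = abs_tensor (Poly_Mapping.single k c)" for c and k :: "'a \<times> 'b"
  have T: "T c k = (c *\<^sub>C fst k) \<boxtimes> snd k" for c k
    unfolding T_def tens_scale_left unfolding tens.abs_eq scaleC_tensor.abs_eq scaleC_single
    by simp
  have P: "P (abs_tensor (\<Sum>k\<in>S. Poly_Mapping.single k (c k)))" if "finite S" for S c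
    using that
  proof (induction S rule: finite_induct)
    case empty
    have "abs_tensor 0 = T 0 (0, 0)" by (simp add: T_def)
    then show ?case using assms(1) T by simp
  next
    case (insert k S)
    have "P (T (c k) k)" using assms(1) T by simp
    with insert show ?case
      using assms(2) by (simp add: plus_tensor.abs_eq[symmetric] T_def)
  qed
  show ?thesis
    unfolding u using P[of "Poly_Mapping.keys u" "Poly_Mapping.lookup u"]
    by (simp add: poly_mapping_sum_single)
qed

lemma clinear_eq_on_tens:
  assumes "clinear f" "clinear g" "\<And>a b. f (a \<boxtimes> b) = g (a \<boxtimes> b)"
  shows "f t = g t"
  by (induction t rule: tensor_induct)
    (simp_all add: assms clinear_add[OF assms(1)] clinear_add[OF assms(2)])

lemma tlift_fun_add: "tlift (\<lambda>x y. f x y + g x y) t = tlift f t + tlift g t"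
  by (simp add: tlift_def free_ext_def scaleC_add_right sum.distrib)

lemma tlift_fun_scale: "tlift (\<lambda>x y. c *\<^sub>C f x y) t = c *\<^sub>C tlift f t"
  by (simp add: tlift_def free_ext_def cvec.scale_sum_right scaleC_scaleC mult.commute)

definition tmap ::
  "('a::complex_vector \<Rightarrow> 'c::complex_vector) \<Rightarrow> ('b::complex_vector \<Rightarrow> 'd::complex_vector) \<Rightarrow>
   ('a, 'b) tensor \<Rightarrow> ('c, 'd) tensor" where
  "tmap f g = tlift (\<lambda>a b. f a \<boxtimes> g b)"

definition tassoc ::
  "(('a::complex_vector, 'b::complex_vector) tensor, 'c::complex_vector) tensor \<Rightarrow>
   ('a, ('b, 'c) tensor) tensor" where
  "tassoc = tlift (\<lambda>s c. tlift (\<lambda>a b. a \<boxtimes> b \<boxtimes> c) s)"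

text \<open>The image of \<open>X \<otimes> Y\<close> in the tensor product of the ambient spaces.\<close>

definition tensor_sub ::
  "'a::complex_vector set \<Rightarrow> 'b::complex_vector set \<Rightarrow> ('a, 'b) tensor set" where
  "tensor_sub X Y = cvec.span {x \<boxtimes> y | x y. x \<in> X \<and> y \<in> Y}"

lemma bilin_tmap: "clinear f \<Longrightarrow> clinear g \<Longrightarrow> bilin (\<lambda>a b. f a \<boxtimes> g b)"
  by (simp add: bilin_iff clinear_iff tens_add_left tens_add_right tens_scale_left tens_scale_right)

lemma tmap_tens: "clinear f \<Longrightarrow> clinear g \<Longrightarrow> tmap f g (a \<boxtimes> b) = f a \<boxtimes> g b"
  by (simp add: tmap_def bilin_tmap)

lemma clinear_tmap: "clinear f \<Longrightarrow> clinear g \<Longrightarrow> clinear (tmap f g)"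
  by (simp add: tmap_def bilin_tmap clinear_tlift)

lemma bilin_tassoc_aux: "bilin (\<lambda>a b. a \<boxtimes> b \<boxtimes> c)"
  by (simp add: bilin_iff tens_add_left tens_add_right tens_scale_left tens_scale_right)

lemma bilin_tassoc: "bilin (\<lambda>s c. tlift (\<lambda>a b. a \<boxtimes> b \<boxtimes> c) s)"
  unfolding bilin_iff
  by (simp add: tlift_fun_add tlift_fun_scale clinear_add[OF clinear_tlift[OF bilin_tassoc_aux]]
      clinear_scale[OF clinear_tlift[OF bilin_tassoc_aux]] tens_add_right tens_scale_right)

lemma clinear_tassoc: "clinear tassoc"
  by (simp add: tassoc_def bilin_tassoc clinear_tlift)

lemma tassoc_tens: "tassoc ((a \<boxtimes> b) \<boxtimes> c) = a \<boxtimes> b \<boxtimes> c"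
  by (simp add: tassoc_def bilin_tassoc bilin_tassoc_aux)

lemma tens_one_one_nonzero: "(1::'a::complex_algebra_1) \<boxtimes> (1::'b::complex_algebra_1) \<noteq> 0"
proof
  assume z: "(1::'a) \<boxtimes> (1::'b) = 0"
  obtain f :: "'a \<Rightarrow> complex" where f: "clinear f" "f 1 = 1"
    using cvec_pair.linear_independent_extend[of "{1::'a}" "\<lambda>_. 1::complex"] by auto
  obtain g :: "'b \<Rightarrow> complex" where g: "clinear g" "g 1 = 1"
    using cvec_pair.linear_independent_extend[of "{1::'b}" "\<lambda>_. 1::complex"] by auto
  have b: "bilin (\<lambda>x y. f x * g y)"
    using f(1) g(1) by (simp add: bilin_iff clinear_iff algebra_simps)
  have "1 = tlift (\<lambda>x y. f x * g y) (1 \<boxtimes> 1)" by (simp add: b f g)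
  also have "\<dots> = 0" by (simp add: z clinear_zero[OF clinear_tlift[OF b]])
  finally show False by simp
qed

instantiation tensor :: (complex_algebra_1, complex_algebra_1) complex_algebra_1
begin

definition one_tensor :: "('a, 'b) tensor" where "one_tensor = 1 \<boxtimes> 1"

text \<open>Multiplication is determined by \<open>(a \<boxtimes> b) * (c \<boxtimes> d) = (a * c) \<boxtimes> (b * d)\<close>.\<close>

definition times_tensor :: "('a, 'b) tensor \<Rightarrow> ('a, 'b) tensor \<Rightarrow> ('a, 'b) tensor" where
  "times_tensor s t = tlift (\<lambda>a b. tlift (\<lambda>c d. (a * c) \<boxtimes> (b * d)) t) s"

lemma bilin_times_aux: "bilin (\<lambda>c d. (a * c) \<boxtimes> (b * d))" for a :: 'a and b :: 'b
  by (simp add: bilin_iff distrib_left mult_scaleC_right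
      tens_add_left tens_add_right tens_scale_left tens_scale_right)

lemma bilin_times_aux2: "bilin (\<lambda>a b. tlift (\<lambda>c d. (a * c) \<boxtimes> (b * d)) t)"
  for t :: "('a, 'b) tensor"
  by (simp add: bilin_iff distrib_right mult_scaleC_left tlift_fun_add tlift_fun_scale
      tens_add_left tens_add_right tens_scale_left tens_scale_right)

lemma tens_times: "(a \<boxtimes> b) * (c \<boxtimes> d) = (a * c) \<boxtimes> (b * d)"
  for a c :: 'a and b d :: 'b
  unfolding times_tensor_def
  by (subst tlift_tens[OF bilin_times_aux2]) (rule tlift_tens[OF bilin_times_aux])

lemma clinear_times_left: "clinear (\<lambda>s. s * t)" for t :: "('a, 'b) tensor"
  by (simp add: times_tensor_def clinear_tlift bilin_times_aux2)

lemma clinear_times_right: "clinear (\<lambda>t. s * t)" for s :: "('a, 'b) tensor"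
proof (induction s rule: tensor_induct)
  case (tens a b)
  then show ?case by (simp add: times_tensor_def clinear_tlift bilin_times_aux bilin_times_aux2)
next
  case (add s t)
  then show ?case
    by (simp add: clinear_iff clinear_add[OF clinear_times_left] scaleC_add_right)
qed

instance
proof
  fix r s t :: "('a, 'b) tensor" and c :: complex
  note lin = clinear_add[OF clinear_times_left] clinear_add[OF clinear_times_right]
  show "c *\<^sub>C s * t = c *\<^sub>C (s * t)" by (rule clinear_scale[OF clinear_times_left])
  show "s * c *\<^sub>C t = c *\<^sub>C (s * t)" by (rule clinear_scale[OF clinear_times_right])
  show "(r + s) * t = r * t + s * t" "r * (s + t) = r * s + r * t" by (rule lin)+
  show "1 * s = s" "s * 1 = s"
    by (induction s rule: tensor_induct) (simp_all add: lin one_tensor_def tens_times)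
  show "r * s * t = r * (s * t)"
  proof (induction r rule: tensor_induct)
    case r: (tens a b)
    show ?case
    proof (induction s rule: tensor_induct)
      case s: (tens a' b')
      show ?case
        by (induction t rule: tensor_induct) (simp_all add: lin tens_times mult.assoc)
    qed (simp add: lin)
  qed (simp add: lin)
  show "(0::('a, 'b) tensor) \<noteq> 1"
    unfolding one_tensor_def by (rule tens_one_one_nonzero[symmetric])
qed

end


section \<open>Hopf algebras\<close>

text \<open>
  The algebra structure is that of the type class; a value of type \<open>'a coalg\<close> supplies the
  coalgebra structure.  Hence a Hopf algebra and its twists live on one and the same type.
\<close>

record (overloaded) 'a coalg =
  comult :: "'a \<Rightarrow> ('a, 'a) tensor"
  counit :: "'a \<Rightarrow> complex"

definition coalgebra :: "'a::complex_vector coalg \<Rightarrow> bool" where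
  "coalgebra A \<longleftrightarrow> clinear (comult A) \<and> clinear (counit A) \<and>
     (\<forall>a. tassoc (tmap (comult A) id (comult A a)) = tmap id (comult A) (comult A a)) \<and>
     (\<forall>a. tlift (\<lambda>x y. counit A x *\<^sub>C y) (comult A a) = a) \<and>
     (\<forall>a. tlift (\<lambda>x y. counit A y *\<^sub>C x) (comult A a) = a)"

definition bialgebra :: "'a::complex_algebra_1 coalg \<Rightarrow> bool" where
  "bialgebra A \<longleftrightarrow> coalgebra A \<and>
     comult A 1 = 1 \<and> (\<forall>a b. comult A (a * b) = comult A a * comult A b) \<and>
     counit A 1 = 1 \<and> (\<forall>a b. counit A (a * b) = counit A a * counit A b)"

definition is_antipode :: "'a::complex_algebra_1 coalg \<Rightarrow> ('a \<Rightarrow> 'a) \<Rightarrow> bool" where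
  "is_antipode A S \<longleftrightarrow> clinear S \<and>
     (\<forall>a. tlift (\<lambda>x y. S x * y) (comult A a) = counit A a *\<^sub>C 1) \<and>
     (\<forall>a. tlift (\<lambda>x y. x * S y) (comult A a) = counit A a *\<^sub>C 1)"

text \<open>An antipode is unique if it exists, so it is not part of the data.\<close>

definition hopf_algebra :: "'a::complex_algebra_1 coalg \<Rightarrow> bool" where
  "hopf_algebra A \<longleftrightarrow> bialgebra A \<and> (\<exists>S. is_antipode A S)"

definition subcoalgebra :: "'a::complex_vector coalg \<Rightarrow> 'a set \<Rightarrow> bool" where
  "subcoalgebra A C \<longleftrightarrow> cvec.subspace C \<and> comult A ` C \<subseteq> tensor_sub C C"

definition simple_subcoalgebra :: "'a::complex_vector coalg \<Rightarrow> 'a set \<Rightarrow> bool" where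
  "simple_subcoalgebra A C \<longleftrightarrow> subcoalgebra A C \<and> C \<noteq> {0} \<and>
     (\<forall>D. subcoalgebra A D \<and> D \<subseteq> C \<longrightarrow> D = {0} \<or> D = C)"

definition coradical :: "'a::complex_vector coalg \<Rightarrow> 'a set" where
  "coradical A = cvec.span (\<Union>{C. simple_subcoalgebra A C})"

definition hopf_subalgebra :: "'a::complex_algebra_1 coalg \<Rightarrow> 'a set \<Rightarrow> bool" where
  "hopf_subalgebra A X \<longleftrightarrow> subcoalgebra A X \<and> 1 \<in> X \<and> (\<forall>x\<in>X. \<forall>y\<in>X. x * y \<in> X) \<and>
     (\<exists>S. is_antipode A S \<and> S ` X \<subseteq> X)"

text \<open>
  An isomorphism from \<open>A\<close> onto the Hopf subalgebra \<open>X\<close> of \<open>B\<close>.  Morphisms of Hopf algebras are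
  morphisms of bialgebras; these commute with the antipodes automatically.
\<close>

definition hopf_iso_onto ::
  "'a::complex_algebra_1 coalg \<Rightarrow> 'b::complex_algebra_1 coalg \<Rightarrow> 'b set \<Rightarrow> ('a \<Rightarrow> 'b) \<Rightarrow> bool" where
  "hopf_iso_onto A B X f \<longleftrightarrow> clinear f \<and> bij_betw f UNIV X \<and>
     f 1 = 1 \<and> (\<forall>a b. f (a * b) = f a * f b) \<and>
     (\<forall>a. comult B (f a) = tmap f f (comult A a)) \<and> (\<forall>a. counit B (f a) = counit A a)"

definition hopf_isomorphic_to_sub ::
  "'a::complex_algebra_1 coalg \<Rightarrow> 'b::complex_algebra_1 coalg \<Rightarrow> 'b set \<Rightarrow> bool" where
  "hopf_isomorphic_to_sub A B X \<longleftrightarrow> (\<exists>f. hopf_iso_onto A B X f)"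

definition hopf_isomorphic ::
  "'a::complex_algebra_1 coalg \<Rightarrow> 'b::complex_algebra_1 coalg \<Rightarrow> bool" where
  "hopf_isomorphic A B \<longleftrightarrow> hopf_isomorphic_to_sub A B UNIV"

definition ring_inv :: "'a::ring_1 \<Rightarrow> 'a" where
  "ring_inv x = (THE y. x * y = 1 \<and> y * x = 1)"

definition is_twist :: "'a::complex_algebra_1 coalg \<Rightarrow> ('a, 'a) tensor \<Rightarrow> bool" where
  "is_twist A J \<longleftrightarrow> (\<exists>K. J * K = 1 \<and> K * J = 1) \<and>
     (1 \<boxtimes> J) * tmap id (comult A) J = tassoc ((J \<boxtimes> 1) * tmap (comult A) id J) \<and>
     tlift (\<lambda>x y. counit A x *\<^sub>C y) J = 1 \<and>
     tlift (\<lambda>x y. counit A y *\<^sub>C x) J = 1"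

text \<open>The multiplication, being that of the type class, and the counit do not change.\<close>

definition twisted :: "'a::complex_algebra_1 coalg \<Rightarrow> ('a, 'a) tensor \<Rightarrow> 'a coalg" where
  "twisted A J = \<lparr>comult = (\<lambda>a. J * comult A a * ring_inv J), counit = counit A\<rparr>"


section \<open>The Hopf algebra $\mathbb{C}\mathbb{A}_5$\<close>

text \<open>
  The group algebra of a group \<open>'g\<close> is \<open>'g \<Rightarrow>\<^sub>0 complex\<close> with the convolution product of
  \<^theory>\<open>HOL-Library.Poly_Mapping\<close>.  That product is taken with respect to an additively written
  (not necessarily commutative) monoid, so the group law of \<open>alt5\<close> is written \<open>+\<close>.
\<close>

definition group_coalg :: "('g \<Rightarrow>\<^sub>0 complex) coalg" where
  "group_coalg =
     \<lparr>comult = (\<lambda>a. \<Sum>g\<in>Poly_Mapping.keys a.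
         Poly_Mapping.lookup a g *\<^sub>C (Poly_Mapping.single g 1 \<boxtimes> Poly_Mapping.single g 1)),
      counit = (\<lambda>a. \<Sum>g\<in>Poly_Mapping.keys a. Poly_Mapping.lookup a g)\<rparr>"

typedef alt5 = "carrier (alt_group 5)"
  using group.is_monoid[OF alt_group_is_group, THEN monoid.one_closed] by blast

setup_lifting type_definition_alt5

instantiation alt5 :: group_add
begin

lift_definition zero_alt5 :: alt5 is "\<one>\<^bsub>alt_group 5\<^esub>"
  by (simp add: alt_group_is_group group.is_monoid monoid.one_closed)

lift_definition plus_alt5 :: "alt5 \<Rightarrow> alt5 \<Rightarrow> alt5" is "(\<otimes>\<^bsub>alt_group 5\<^esub>)"
  by (simp add: alt_group_is_group group.is_monoid monoid.m_closed)

lift_definition uminus_alt5 :: "alt5 \<Rightarrow> alt5" is "\<lambda>p. inv\<^bsub>alt_group 5\<^esub> p"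
  by (simp add: alt_group_is_group group.inv_closed)

definition minus_alt5 :: "alt5 \<Rightarrow> alt5 \<Rightarrow> alt5" where "minus_alt5 a b = a + - b"

instance
proof
  interpret group "alt_group 5" by (rule alt_group_is_group)
  fix a b c :: alt5
  show "a + b + c = a + (b + c)" by transfer (rule m_assoc)
  show "0 + a = a" by transfer (rule l_one)
  show "a + 0 = a" by transfer (rule r_one)
  show "- a + a = 0" by transfer (rule l_inv)
  show "a + - b = a - b" by (simp only: minus_alt5_def)
qed

end

type_synonym CA5 = "alt5 \<Rightarrow>\<^sub>0 complex"

definition of_perm :: "(nat \<Rightarrow> nat) \<Rightarrow> CA5" where
  "of_perm g = Poly_Mapping.single (Abs_alt5 g) 1"


section \<open>Nikshych's twist\<close>

text \<open>Characters are extensional functions, so that distinct elements of the carrier are distinct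
  homomorphisms.\<close>

definition character_group :: "('g, 'm) monoid_scheme \<Rightarrow> ('g \<Rightarrow> complex) monoid" where
  "character_group G =
     \<lparr>carrier = {\<chi> \<in> extensional (carrier G). (\<forall>g\<in>carrier G. \<chi> g \<noteq> 0) \<and>
                  (\<forall>g\<in>carrier G. \<forall>h\<in>carrier G. \<chi> (g \<otimes>\<^bsub>G\<^esub> h) = \<chi> g * \<chi> h)},
      mult = (\<lambda>\<chi> \<psi>. \<lambda>g\<in>carrier G. \<chi> g * \<psi> g),
      one = (\<lambda>g\<in>carrier G. 1)\<rparr>"

text \<open>Two-cocycles and coboundaries with values in the nonzero complex numbers, with trivial
  action.\<close>

definition normalized_2cocycle :: "('g, 'm) monoid_scheme \<Rightarrow> ('g \<Rightarrow> 'g \<Rightarrow> complex) \<Rightarrow> bool" where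
  "normalized_2cocycle K \<beta> \<longleftrightarrow>
     (\<forall>x\<in>carrier K. \<forall>y\<in>carrier K. \<beta> x y \<noteq> 0) \<and>
     (\<forall>x\<in>carrier K. \<forall>y\<in>carrier K. \<forall>z\<in>carrier K.
        \<beta> x y * \<beta> (x \<otimes>\<^bsub>K\<^esub> y) z = \<beta> y z * \<beta> x (y \<otimes>\<^bsub>K\<^esub> z)) \<and>
     (\<forall>x\<in>carrier K. \<beta> \<one>\<^bsub>K\<^esub> x = 1 \<and> \<beta> x \<one>\<^bsub>K\<^esub> = 1)"

definition is_2coboundary :: "('g, 'm) monoid_scheme \<Rightarrow> ('g \<Rightarrow> 'g \<Rightarrow> complex) \<Rightarrow> bool" where
  "is_2coboundary K \<beta> \<longleftrightarrow>
     (\<exists>\<mu>. (\<forall>x\<in>carrier K. \<mu> x \<noteq> 0) \<and>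
        (\<forall>x\<in>carrier K. \<forall>y\<in>carrier K. \<beta> x y = \<mu> x * \<mu> y / \<mu> (x \<otimes>\<^bsub>K\<^esub> y)))"

abbreviation dual_group :: "(nat \<Rightarrow> nat) set \<Rightarrow> ((nat \<Rightarrow> nat) \<Rightarrow> complex) monoid" where
  "dual_group P \<equiv> character_group ((alt_group 5)\<lparr>carrier := P\<rparr>)"

definition char_idem :: "(nat \<Rightarrow> nat) set \<Rightarrow> ((nat \<Rightarrow> nat) \<Rightarrow> complex) \<Rightarrow> CA5" where
  "char_idem P \<chi> = (1/4) *\<^sub>C (\<Sum>g\<in>P. \<chi> (inv\<^bsub>alt_group 5\<^esub> g) *\<^sub>C of_perm g)"

definition nikshych_twist ::
  "(nat \<Rightarrow> nat) set \<Rightarrow> (((nat \<Rightarrow> nat) \<Rightarrow> complex) \<Rightarrow> ((nat \<Rightarrow> nat) \<Rightarrow> complex) \<Rightarrow> complex) \<Rightarrow>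
   (CA5, CA5) tensor" where
  "nikshych_twist P \<beta> =
     (\<Sum>\<chi>\<in>carrier (dual_group P). \<Sum>\<psi>\<in>carrier (dual_group P).
        \<beta> \<chi> \<psi> *\<^sub>C (char_idem P \<chi> \<boxtimes> char_idem P \<psi>))"


section \<open>The group algebra is a Hopf algebra and the twist is a twist\<close>

lemma cvec_1 [simp]: "1 *\<^sub>C x = x" by (rule scaleC_one)

lemma group_coalg_superset:
  assumes "finite S" "Poly_Mapping.keys a \<subseteq> S"
  shows "comult group_coalg a = (\<Sum>g\<in>S. Poly_Mapping.lookup a g *\<^sub>C
           (Poly_Mapping.single g 1 \<boxtimes> Poly_Mapping.single g 1))"
    and "counit group_coalg a = (\<Sum>g\<in>S. Poly_Mapping.lookup a g)"
  unfolding group_coalg_def coalg.simps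
  by (rule sum.mono_neutral_left; use assms in \<open>auto simp: in_keys_iff\<close>)+

lemma clinear_group_coalg:
  "clinear (comult (group_coalg :: ('g \<Rightarrow>\<^sub>0 complex) coalg))"
  "clinear (counit (group_coalg :: ('g \<Rightarrow>\<^sub>0 complex) coalg))"
  unfolding clinear_iff
proof safe
  fix x y :: "'g \<Rightarrow>\<^sub>0 complex" and c :: complex
  let ?S = "Poly_Mapping.keys x \<union> Poly_Mapping.keys y"
  have k: "Poly_Mapping.keys (x + y) \<subseteq> ?S" by (rule Poly_Mapping.keys_add)
  have k': "Poly_Mapping.keys (c *\<^sub>C x) \<subseteq> Poly_Mapping.keys x" by (auto simp: in_keys_iff)
  show "comult group_coalg (x + y) = comult group_coalg x + comult group_coalg y"
    "counit group_coalg (x + y) = counit group_coalg x + counit group_coalg y"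
    using k by (simp_all add: group_coalg_superset[where S = ?S] lookup_add
        scaleC_add_left sum.distrib)
  show "comult group_coalg (c *\<^sub>C x) = c *\<^sub>C comult group_coalg x"
    "counit group_coalg (c *\<^sub>C x) = c *\<^sub>C counit group_coalg x"
    using k' by (simp_all add: group_coalg_superset[where S = "Poly_Mapping.keys x"]
        cvec.scale_sum_right scaleC_scaleC sum_distrib_left)
qed

lemma group_coalg_single:
  "comult group_coalg (Poly_Mapping.single g 1) = Poly_Mapping.single g 1 \<boxtimes> Poly_Mapping.single g 1"
  "counit group_coalg (Poly_Mapping.single g 1) = 1"
  by (simp_all add: group_coalg_def)

lemma clinear_eq_on_single:
  fixes f h :: "('g \<Rightarrow>\<^sub>0 complex) \<Rightarrow> 'b::complex_vector"
  assumes f: "clinear f" and h: "clinear h"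
    and eq: "\<And>g. f (Poly_Mapping.single g 1) = h (Poly_Mapping.single g 1)"
  shows "f a = h a"
proof -
  have *: "f (Poly_Mapping.single g c) = h (Poly_Mapping.single g c)" for g c
  proof -
    have "Poly_Mapping.single g c = c *\<^sub>C Poly_Mapping.single g 1" by (simp add: scaleC_single)
    then show ?thesis by (simp only: clinear_scale[OF f] clinear_scale[OF h] eq)
  qed
  have "f (\<Sum>k\<in>Poly_Mapping.keys a. Poly_Mapping.single k (Poly_Mapping.lookup a k)) =
        h (\<Sum>k\<in>Poly_Mapping.keys a. Poly_Mapping.single k (Poly_Mapping.lookup a k))"
    by (simp only: clinear_sum[OF f] clinear_sum[OF h] *)
  then show ?thesis by (simp only: poly_mapping_sum_single)
qed

lemma clinear_id': "clinear (id :: 'a::complex_vector \<Rightarrow> 'a)" "clinear (\<lambda>x::'a. x)"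
  by (simp_all add: clinear_iff)

lemma clinear_comp: "clinear f \<Longrightarrow> clinear g \<Longrightarrow> clinear (\<lambda>x. f (g x))"
  by (simp add: clinear_iff)

lemma clinear_mult: "clinear (\<lambda>x. x * y)" "clinear (\<lambda>x. y * x)" for y :: "'a::complex_algebra_1"
  by (simp_all add: clinear_iff distrib_left distrib_right mult_scaleC_left mult_scaleC_right)

lemma bilin_counit1: "clinear e \<Longrightarrow> bilin (\<lambda>x y. e x *\<^sub>C (y::'a::complex_vector))"
  for e :: "'b::complex_vector \<Rightarrow> complex"
  by (simp add: bilin_iff clinear_iff scaleC_add_left scaleC_add_right scaleC_scaleC mult.commute)

lemma bilin_counit2: "clinear e \<Longrightarrow> bilin (\<lambda>x y. e y *\<^sub>C (x::'a::complex_vector))"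
  for e :: "'b::complex_vector \<Rightarrow> complex"
  by (simp add: bilin_iff clinear_iff scaleC_add_left scaleC_add_right scaleC_scaleC mult.commute)

lemma hopf_algebra_group_coalg:
  "hopf_algebra (group_coalg :: ('g::group_add \<Rightarrow>\<^sub>0 complex) coalg)"
proof -
  let ?A = "group_coalg :: ('g \<Rightarrow>\<^sub>0 complex) coalg"
  let ?D = "comult ?A" and ?E = "counit ?A"
  note lin = clinear_group_coalg clinear_id' clinear_comp clinear_tmap clinear_tassoc
  have "tassoc (tmap ?D id (?D a)) = tmap id ?D (?D a)" for a
    by (rule clinear_eq_on_single[where f = "\<lambda>a. tassoc (tmap ?D id (?D a))"])
      (simp_all add: clinear_comp[OF clinear_tassoc clinear_comp[OF clinear_tmap]] clinear_comp[OF clinear_tmap] clinear_group_coalg clinear_id' group_coalg_single tmap_tens tassoc_tens)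
  moreover have "tlift (\<lambda>x y. ?E x *\<^sub>C y) (?D a) = a" for a
    by (rule clinear_eq_on_single[where f = "\<lambda>a. tlift (\<lambda>x y. ?E x *\<^sub>C y) (?D a)"])
      (simp_all add: clinear_comp[OF clinear_tlift] clinear_group_coalg clinear_id' group_coalg_single bilin_counit1)
  moreover have "tlift (\<lambda>x y. ?E y *\<^sub>C x) (?D a) = a" for a
    by (rule clinear_eq_on_single[where f = "\<lambda>a. tlift (\<lambda>x y. ?E y *\<^sub>C x) (?D a)"])
      (simp_all add: clinear_comp[OF clinear_tlift] clinear_group_coalg clinear_id' group_coalg_single bilin_counit2)
  ultimately have "coalgebra ?A" by (simp add: coalgebra_def clinear_group_coalg)
  moreover have "?D 1 = 1" "?E 1 = 1"
    using group_coalg_single[of "0::'g"] by (simp_all add: one_tensor_def)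
  moreover have "?D (a * b) = ?D a * ?D b" for a b
  proof (rule clinear_eq_on_single[where f = "\<lambda>a. ?D (a * b)"])
    show "clinear (\<lambda>a. ?D (a * b))" "clinear (\<lambda>a. ?D a * ?D b)"
      by (rule clinear_comp[OF clinear_group_coalg(1) clinear_mult(1)],
          rule clinear_comp[OF clinear_mult(1) clinear_group_coalg(1)])
    fix g
    show "?D (Poly_Mapping.single g 1 * b) = ?D (Poly_Mapping.single g 1) * ?D b"
      by (rule clinear_eq_on_single[where f = "\<lambda>b. ?D (Poly_Mapping.single g 1 * b)"],
          rule clinear_comp[OF clinear_group_coalg(1) clinear_mult(2)],
          rule clinear_comp[OF clinear_mult(2) clinear_group_coalg(1)])
        (simp add: group_coalg_single mult_single tens_times)
  qed
  moreover have "?E (a * b) = ?E a * ?E b" for a b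
  proof (rule clinear_eq_on_single[where f = "\<lambda>a. ?E (a * b)"])
    show "clinear (\<lambda>a. ?E (a * b))" "clinear (\<lambda>a. ?E a * ?E b)"
      by (rule clinear_comp[OF clinear_group_coalg(2) clinear_mult(1)],
          rule clinear_comp[OF clinear_mult(1) clinear_group_coalg(2)])
    fix g
    show "?E (Poly_Mapping.single g 1 * b) = ?E (Poly_Mapping.single g 1) * ?E b"
      by (rule clinear_eq_on_single[where f = "\<lambda>b. ?E (Poly_Mapping.single g 1 * b)"],
          rule clinear_comp[OF clinear_group_coalg(2) clinear_mult(2)],
          rule clinear_comp[OF clinear_mult(2) clinear_group_coalg(2)])
        (simp add: group_coalg_single mult_single)
  qed
  ultimately have "bialgebra ?A" by (simp add: bialgebra_def)
  moreover have "is_antipode ?A S"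
    if S_def: "S = (\<lambda>a. \<Sum>g\<in>Poly_Mapping.keys a.
        Poly_Mapping.lookup a g *\<^sub>C Poly_Mapping.single (- g) 1)" for S
  proof -
    have sup: "S a = (\<Sum>g\<in>T. Poly_Mapping.lookup a g *\<^sub>C Poly_Mapping.single (- g) 1)"
      if "finite T" "Poly_Mapping.keys a \<subseteq> T" for a T
      unfolding S_def by (rule sum.mono_neutral_left) (use that in \<open>auto simp: in_keys_iff\<close>)
    have S: "clinear S"
      unfolding clinear_iff
    proof safe
      fix x y :: "'g \<Rightarrow>\<^sub>0 complex" and c :: complex
      let ?T = "Poly_Mapping.keys x \<union> Poly_Mapping.keys y"
      show "S (x + y) = S x + S y"
        using Poly_Mapping.keys_add[of x y]
        by (simp add: sup[where T = ?T] lookup_add scaleC_add_left sum.distrib)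
      have "Poly_Mapping.keys (c *\<^sub>C x) \<subseteq> Poly_Mapping.keys x" by (auto simp: in_keys_iff)
      then show "S (c *\<^sub>C x) = c *\<^sub>C S x"
        by (simp add: sup[where T = "Poly_Mapping.keys x"] cvec.scale_sum_right scaleC_scaleC)
    qed
    have S1: "S (Poly_Mapping.single g 1) = Poly_Mapping.single (- g) 1" for g
      by (simp add: S_def)
    have b: "bilin (\<lambda>x y. S x * y)" "bilin (\<lambda>x y. x * S y)"
      using S by (simp_all add: bilin_iff clinear_iff distrib_left distrib_right
          mult_scaleC_left mult_scaleC_right)
    have c: "clinear (\<lambda>a. ?E a *\<^sub>C (1 :: 'g \<Rightarrow>\<^sub>0 complex))"
      using clinear_group_coalg(2)[where 'g = 'g]
      by (simp add: clinear_iff scaleC_add_left scaleC_scaleC)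
    have "tlift (\<lambda>x y. S x * y) (?D a) = ?E a *\<^sub>C 1" for a
      by (rule clinear_eq_on_single[where f = "\<lambda>a. tlift (\<lambda>x y. S x * y) (?D a)", OF
            clinear_comp[OF clinear_tlift[OF b(1)] clinear_group_coalg(1)] c])
        (simp add: group_coalg_single S1 mult_single b(1))
    moreover have "tlift (\<lambda>x y. x * S y) (?D a) = ?E a *\<^sub>C 1" for a
      by (rule clinear_eq_on_single[where f = "\<lambda>a. tlift (\<lambda>x y. x * S y) (?D a)", OF
            clinear_comp[OF clinear_tlift[OF b(2)] clinear_group_coalg(1)] c])
        (simp add: group_coalg_single S1 mult_single b(2))
    ultimately show ?thesis by (simp add: is_antipode_def S)
  qed
  ultimately show ?thesis by (auto simp: hopf_algebra_def)
qed

lemma idem_family_mult: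
  fixes u :: "'i \<Rightarrow> 'a::complex_algebra_1"
  assumes "finite I" and "\<And>i j. i \<in> I \<Longrightarrow> j \<in> I \<Longrightarrow> u i * u j = (if i = j then u i else 0)"
  shows "(\<Sum>i\<in>I. f i *\<^sub>C u i) * (\<Sum>i\<in>I. g i *\<^sub>C u i) = (\<Sum>i\<in>I. (f i * g i) *\<^sub>C u i)"
proof -
  have "(\<Sum>i\<in>I. f i *\<^sub>C u i) * (\<Sum>i\<in>I. g i *\<^sub>C u i) =
        (\<Sum>i\<in>I. \<Sum>j\<in>I. (f i * g j) *\<^sub>C (u i * u j))"
    by (simp add: sum_product mult_scaleC_left mult_scaleC_right scaleC_scaleC mult.commute)
  also have "\<dots> = (\<Sum>i\<in>I. \<Sum>j\<in>I. if i = j then (f i * g i) *\<^sub>C u i else 0)"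
    by (intro sum.cong refl) (auto simp: assms(2))
  also have "\<dots> = (\<Sum>i\<in>I. (f i * g i) *\<^sub>C u i)" by (simp add: assms(1))
  finally show ?thesis .
qed

lemmas bilin_tens_lin = clinear_iff tens_add_left tens_add_right tens_scale_left tens_scale_right

lemma clinear_tens: "clinear (\<lambda>x. x \<boxtimes> y)" "clinear (\<lambda>y. x \<boxtimes> y)"
  by (simp_all add: bilin_tens_lin)

lemmas tens_sum_left = clinear_sum[OF clinear_tens(1)]
  and tens_sum_right = clinear_sum[OF clinear_tens(2)]

lemma tens_zero [simp]: "0 \<boxtimes> y = 0" "x \<boxtimes> 0 = 0"
  by (simp_all add: clinear_zero[OF clinear_tens(1)] clinear_zero[OF clinear_tens(2)])

lemma is_twist_idempotents:
  fixes A :: "'a::complex_algebra_1 coalg" and e :: "'x \<Rightarrow> 'a"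
  assumes D: "clinear (comult A)" and E: "clinear (counit A)"
    and fin: "finite X"
    and idem: "\<And>x y. x \<in> X \<Longrightarrow> y \<in> X \<Longrightarrow> e x * e y = (if x = y then e x else 0)"
    and one: "(\<Sum>x\<in>X. e x) = 1"
    and De: "\<And>d. d \<in> X \<Longrightarrow> comult A (e d) =
               (\<Sum>x\<in>X. \<Sum>y\<in>X. if m x y = d then e x \<boxtimes> e y else 0)"
    and Ee: "\<And>d. d \<in> X \<Longrightarrow> counit A (e d) = (if d = u then 1 else 0)"
    and m: "\<And>x y. x \<in> X \<Longrightarrow> y \<in> X \<Longrightarrow> m x y \<in> X" and u: "u \<in> X"
    and nz: "\<And>x y. x \<in> X \<Longrightarrow> y \<in> X \<Longrightarrow> \<beta> x y \<noteq> 0"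
    and coc: "\<And>x y z. x \<in> X \<Longrightarrow> y \<in> X \<Longrightarrow> z \<in> X \<Longrightarrow>
               \<beta> x y * \<beta> (m x y) z = \<beta> y z * \<beta> x (m y z)"
    and norm: "\<And>x. x \<in> X \<Longrightarrow> \<beta> u x = 1 \<and> \<beta> x u = 1"
  shows "is_twist A (\<Sum>x\<in>X. \<Sum>y\<in>X. \<beta> x y *\<^sub>C (e x \<boxtimes> e y))"
proof -
  define E2 where "E2 f = (\<Sum>x\<in>X. \<Sum>y\<in>X. f x y *\<^sub>C (e x \<boxtimes> e y))" for f
  define E3 where "E3 f = (\<Sum>x\<in>X. \<Sum>y\<in>X. \<Sum>z\<in>X. f x y z *\<^sub>C (e x \<boxtimes> e y \<boxtimes> e z))" for f
  define E3' where "E3' f = (\<Sum>x\<in>X. \<Sum>y\<in>X. \<Sum>z\<in>X. f x y z *\<^sub>C ((e x \<boxtimes> e y) \<boxtimes> e z))" for f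
  note sc = tens_sum_left tens_sum_right tens_scale_left tens_scale_right cvec.scale_sum_right
    scaleC_scaleC
  have cong3: "E3 f = E3 g" if "\<And>x y z. x \<in> X \<Longrightarrow> y \<in> X \<Longrightarrow> z \<in> X \<Longrightarrow> f x y z = g x y z" for f g
    unfolding E3_def by (intro sum.cong refl) (simp add: that)
  have E2_mult: "E2 f * E2 g = E2 (\<lambda>x y. f x y * g x y)" for f g
    using idem_family_mult[of "X \<times> X" "\<lambda>p. e (fst p) \<boxtimes> e (snd p)"
        "\<lambda>p. f (fst p) (snd p)" "\<lambda>p. g (fst p) (snd p)"]
    by (auto simp: E2_def sum.cartesian_product split_def fin tens_times idem prod_eq_iff)
  have E3_mult: "E3 f * E3 g = E3 (\<lambda>x y z. f x y z * g x y z)" for f g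
    using idem_family_mult[of "X \<times> X \<times> X" "\<lambda>p. e (fst p) \<boxtimes> e (fst (snd p)) \<boxtimes> e (snd (snd p))"
        "\<lambda>p. f (fst p) (fst (snd p)) (snd (snd p))" "\<lambda>p. g (fst p) (fst (snd p)) (snd (snd p))"]
    by (auto simp: E3_def sum.cartesian_product split_def fin tens_times idem prod_eq_iff)
  have E3'_mult: "E3' f * E3' g = E3' (\<lambda>x y z. f x y z * g x y z)" for f g
    using idem_family_mult[of "X \<times> X \<times> X" "\<lambda>p. (e (fst p) \<boxtimes> e (fst (snd p))) \<boxtimes> e (snd (snd p))"
        "\<lambda>p. f (fst p) (fst (snd p)) (snd (snd p))" "\<lambda>p. g (fst p) (fst (snd p)) (snd (snd p))"]
    by (auto simp: E3'_def sum.cartesian_product split_def fin tens_times idem prod_eq_iff)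
  have assoc: "tassoc (E3' f) = E3 f" for f
    by (simp add: E3_def E3'_def clinear_sum[OF clinear_tassoc] clinear_scale[OF clinear_tassoc]
        tassoc_tens)
  have E2_1: "E2 (\<lambda>_ _. 1) = 1"
  proof -
    have "E2 (\<lambda>_ _. 1) = (\<Sum>x\<in>X. e x) \<boxtimes> (\<Sum>x\<in>X. e x)"
      by (simp only: E2_def sc cvec_1) (rule sum.swap)
    then show ?thesis by (simp add: one one_tensor_def)
  qed
  have left: "1 \<boxtimes> E2 f = E3 (\<lambda>x y z. f y z)" for f
    unfolding one[symmetric] E2_def E3_def
    by (simp add: sc) (rule sym, rule trans[OF sum.swap], rule sum.cong[OF refl], rule sum.swap)
  have right: "E2 f \<boxtimes> 1 = E3' (\<lambda>x y z. f x y)" for f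
    unfolding one[symmetric] E2_def E3'_def
    by (simp add: sc) (rule trans[OF sum.swap], rule sum.cong[OF refl], rule sum.swap)
  have D1: "tmap id (comult A) (E2 f) = E3 (\<lambda>x y z. f x (m y z))" for f
  proof -
    have "tmap id (comult A) (E2 f) = (\<Sum>x\<in>X. \<Sum>d\<in>X. f x d *\<^sub>C (e x \<boxtimes> comult A (e d)))"
      by (simp add: E2_def clinear_sum[OF clinear_tmap[OF clinear_id'(1) D]]
          clinear_scale[OF clinear_tmap[OF clinear_id'(1) D]] tmap_tens[OF clinear_id'(1) D])
    also have "\<dots> = (\<Sum>x\<in>X. \<Sum>d\<in>X. \<Sum>y\<in>X. \<Sum>z\<in>X.
        if m y z = d then f x d *\<^sub>C (e x \<boxtimes> e y \<boxtimes> e z) else 0)"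
      by (intro sum.cong refl) (simp add: De sc if_distrib cong: if_cong)
    also have "\<dots> = (\<Sum>x\<in>X. \<Sum>y\<in>X. \<Sum>z\<in>X. \<Sum>d\<in>X.
        if m y z = d then f x d *\<^sub>C (e x \<boxtimes> e y \<boxtimes> e z) else 0)"
      by (rule sum.cong[OF refl], rule trans[OF sum.swap], rule sum.cong[OF refl], rule sum.swap)
    also have "\<dots> = E3 (\<lambda>x y z. f x (m y z))"
      unfolding E3_def by (intro sum.cong refl) (simp add: fin m)
    finally show ?thesis .
  qed
  have D2: "tmap (comult A) id (E2 f) = E3' (\<lambda>x y z. f (m x y) z)" for f
  proof -
    have "tmap (comult A) id (E2 f) = (\<Sum>d\<in>X. \<Sum>z\<in>X. f d z *\<^sub>C (comult A (e d) \<boxtimes> e z))"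
      by (simp add: E2_def clinear_sum[OF clinear_tmap[OF D clinear_id'(1)]]
          clinear_scale[OF clinear_tmap[OF D clinear_id'(1)]] tmap_tens[OF D clinear_id'(1)])
    also have "\<dots> = (\<Sum>d\<in>X. \<Sum>z\<in>X. \<Sum>x\<in>X. \<Sum>y\<in>X.
        if m x y = d then f d z *\<^sub>C ((e x \<boxtimes> e y) \<boxtimes> e z) else 0)"
      by (intro sum.cong refl)
        (simp add: De sc if_distrib[where f = "\<lambda>t. t \<boxtimes> _"] if_distrib[where f = "scaleC _"]
          cong: if_cong)
    also have "\<dots> = (\<Sum>z\<in>X. \<Sum>x\<in>X. \<Sum>y\<in>X. \<Sum>d\<in>X.
        if m x y = d then f d z *\<^sub>C ((e x \<boxtimes> e y) \<boxtimes> e z) else 0)"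
      by (rule trans[OF sum.swap], rule sum.cong[OF refl], rule trans[OF sum.swap],
          rule sum.cong[OF refl], rule sum.swap)
    also have "\<dots> = (\<Sum>z\<in>X. \<Sum>x\<in>X. \<Sum>y\<in>X. f (m x y) z *\<^sub>C ((e x \<boxtimes> e y) \<boxtimes> e z))"
      by (intro sum.cong refl) (simp add: fin m)
    also have "\<dots> = E3' (\<lambda>x y z. f (m x y) z)"
      unfolding E3'_def
      by (rule trans[OF sum.swap], rule sum.cong[OF refl], rule sum.swap)
    finally show ?thesis .
  qed
  have "(\<exists>K. E2 \<beta> * K = 1 \<and> K * E2 \<beta> = 1)"
  proof -
    have "E2 (\<lambda>x y. \<beta> x y * inverse (\<beta> x y)) = E2 (\<lambda>_ _. 1)"
      "E2 (\<lambda>x y. inverse (\<beta> x y) * \<beta> x y) = E2 (\<lambda>_ _. 1)"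
      unfolding E2_def by (intro sum.cong refl; simp add: nz)+
    then show ?thesis using E2_mult E2_1 by metis
  qed
  moreover have "(1 \<boxtimes> E2 \<beta>) * tmap id (comult A) (E2 \<beta>) =
      tassoc ((E2 \<beta> \<boxtimes> 1) * tmap (comult A) id (E2 \<beta>))"
    unfolding left right D1 D2 E3_mult E3'_mult assoc by (rule cong3) (simp add: coc)
  moreover have "tlift (\<lambda>x y. counit A x *\<^sub>C y) (E2 \<beta>) = 1"
  proof -
    note t = bilin_counit1[OF E, where ?'a = 'a]
    have "tlift (\<lambda>x y. counit A x *\<^sub>C y) (E2 \<beta>) = (\<Sum>x\<in>X. \<Sum>y\<in>X. if x = u then e y else 0)"
      unfolding E2_def clinear_sum[OF clinear_tlift[OF t]] clinear_scale[OF clinear_tlift[OF t]]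
        tlift_tens[OF t]
      by (intro sum.cong refl) (simp add: Ee norm)
    also have "\<dots> = (\<Sum>y\<in>X. \<Sum>x\<in>X. if x = u then e y else 0)" by (rule sum.swap)
    also have "\<dots> = 1" by (simp add: fin u one)
    finally show ?thesis .
  qed
  moreover have "tlift (\<lambda>x y. counit A y *\<^sub>C x) (E2 \<beta>) = 1"
  proof -
    note t = bilin_counit2[OF E, where ?'a = 'a]
    have "tlift (\<lambda>x y. counit A y *\<^sub>C x) (E2 \<beta>) = (\<Sum>x\<in>X. \<Sum>y\<in>X. if y = u then e x else 0)"
      unfolding E2_def clinear_sum[OF clinear_tlift[OF t]] clinear_scale[OF clinear_tlift[OF t]]
        tlift_tens[OF t]
      by (intro sum.cong refl) (simp add: Ee norm)
    also have "\<dots> = 1" by (simp add: fin u one)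
    finally show ?thesis .
  qed
  ultimately show ?thesis by (simp add: is_twist_def E2_def)
qed

lemma is_twist_nikshych_twist:
  assumes P: "subgroup P (alt_group 5)"
    and iso: "(alt_group 5)\<lparr>carrier := P\<rparr> \<cong> integer_mod_group 2 \<times>\<times> integer_mod_group 2"
    and \<beta>: "normalized_2cocycle (dual_group P) \<beta>"
  shows "is_twist group_coalg (nikshych_twist P \<beta>)"
proof -
  let ?G = "alt_group 5" and ?X = "carrier (dual_group P)" and ?one = "\<one>\<^bsub>alt_group 5\<^esub>"
  interpret G: group ?G by (rule alt_group_is_group)
  interpret Q: group "?G\<lparr>carrier := P\<rparr>" using P by (rule G.subgroup_imp_group)
  have PG: "g \<in> carrier ?G" if "g \<in> P" for g using subgroup.mem_carrier[OF P that] .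
  note Pc = subgroup.m_closed[OF P] subgroup.m_inv_closed[OF P] subgroup.one_closed[OF P]
  define e where "e = char_idem P"
  obtain \<phi> where \<phi>: "\<phi> \<in> hom (?G\<lparr>carrier := P\<rparr>) (integer_mod_group 2 \<times>\<times> integer_mod_group 2)"
    "bij_betw \<phi> P ({0..<2} \<times> {0..<2})"
    using iso unfolding is_iso_def iso_def by (auto simp: carrier_integer_mod_group)
  have card: "card P = 4" and finP: "finite P"
    using bij_betw_same_card[OF \<phi>(2)] bij_betw_finite[OF \<phi>(2)] by simp_all
  have \<phi>_range: "fst (\<phi> g) \<in> {0, 1}" "snd (\<phi> g) \<in> {0, 1}" if "g \<in> P" for g
    using bij_betwE[OF \<phi>(2)] that by (auto simp: mem_Times_iff)
  have \<phi>_mult: "\<phi> (g \<otimes>\<^bsub>?G\<^esub> h) = ((fst (\<phi> g) + fst (\<phi> h)) mod 2, (snd (\<phi> g) + snd (\<phi> h)) mod 2)"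
    if "g \<in> P" "h \<in> P" for g h
    using \<phi>(1) that by (auto simp: hom_def DirProd_def split_def mult_integer_mod_group)
  have \<phi>_one: "\<phi> ?one = (0, 0)"
    using \<phi>_mult[of ?one ?one] \<phi>_range[of ?one] Pc by (auto simp: prod_eq_iff)
  define s where "s i = (if i = (0::int) then 1 else - 1 :: complex)" for i
  have s_mult: "s ((i + j) mod 2) = s i * s j" if "i \<in> {0, 1}" "j \<in> {0, 1}" for i j
    using that by (auto simp: s_def)
  have X: "\<chi> \<in> ?X \<longleftrightarrow> \<chi> \<in> extensional P \<and> (\<forall>g\<in>P. \<chi> g \<noteq> 0) \<and>
      (\<forall>g\<in>P. \<forall>h\<in>P. \<chi> (g \<otimes>\<^bsub>?G\<^esub> h) = \<chi> g * \<chi> h)" for \<chi>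
    by (simp add: character_group_def)
  have X_eqI: "\<chi> = \<psi>" if "\<chi> \<in> ?X" "\<psi> \<in> ?X" "\<And>g. g \<in> P \<Longrightarrow> \<chi> g = \<psi> g" for \<chi> \<psi>
    using that X by (intro extensionalityI[of \<chi> P \<psi>]) auto
  have X_mult: "\<chi> (g \<otimes>\<^bsub>?G\<^esub> h) = \<chi> g * \<chi> h" and X_nz: "\<chi> g \<noteq> 0"
    if "\<chi> \<in> ?X" "g \<in> P" "h \<in> P" for \<chi> g h using that X by auto
  have X_one: "\<chi> ?one = 1" if "\<chi> \<in> ?X" for \<chi>
    using X_mult[OF that, of ?one ?one] X_nz[OF that, of ?one] Pc by simp
  have X_inv: "\<chi> (inv\<^bsub>?G\<^esub> g) * \<chi> g = 1" if "\<chi> \<in> ?X" "g \<in> P" for \<chi> g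
    using X_mult[OF that(1), of "inv\<^bsub>?G\<^esub> g" g] X_one[OF that(1)] Pc that PG by simp
  have sq: "g \<otimes>\<^bsub>?G\<^esub> g = ?one" if g: "g \<in> P" for g
  proof -
    have "\<phi> (g \<otimes>\<^bsub>?G\<^esub> g) = \<phi> ?one"
      using \<phi>_mult[OF g g] \<phi>_range[OF g] \<phi>_one by auto
    then show ?thesis
      using bij_betw_imp_inj_on[OF \<phi>(2)] g Pc by (auto dest: inj_onD)
  qed
  have X_sq: "\<chi> g * \<chi> g = 1" if "\<chi> \<in> ?X" "g \<in> P" for \<chi> g
    using X_mult[OF that that(2)] sq[OF that(2)] X_one[OF that(1)] by simp
  have X_val: "\<chi> g \<in> {1, -1}" if "\<chi> \<in> ?X" "g \<in> P" for \<chi> g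
    using X_sq[OF that] by (metis insertCI square_eq_1_iff)
  have finX: "finite ?X"
  proof (rule finite_subset)
    show "?X \<subseteq> P \<rightarrow>\<^sub>E {1, -1}"
    proof
      fix \<chi> assume "\<chi> \<in> ?X"
      then show "\<chi> \<in> P \<rightarrow>\<^sub>E {1, -1}"
        unfolding PiE_def Pi_def using X_val X by blast
    qed
    show "finite (P \<rightarrow>\<^sub>E {1, -1 :: complex})" using finP by (intro finite_PiE) auto
  qed
  have sep: "\<exists>\<chi>\<in>?X. \<chi> g \<noteq> 1" if g: "g \<in> P" "g \<noteq> ?one" for g
  proof -
    have "\<phi> g \<noteq> \<phi> ?one"
      using bij_betw_imp_inj_on[OF \<phi>(2)] g Pc by (auto dest: inj_onD)
    then have *: "fst (\<phi> g) \<noteq> 0 \<or> snd (\<phi> g) \<noteq> 0" by (simp add: \<phi>_one prod_eq_iff)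
    have s_in: "(\<lambda>g\<in>P. s (p (\<phi> g))) \<in> ?X" if "\<And>g. g \<in> P \<Longrightarrow> p (\<phi> g) \<in> {0, 1}"
      and "\<And>g h. g \<in> P \<Longrightarrow> h \<in> P \<Longrightarrow> p (\<phi> (g \<otimes>\<^bsub>?G\<^esub> h)) = (p (\<phi> g) + p (\<phi> h)) mod 2" for p
    proof -
      have "s i \<noteq> 0" for i by (simp add: s_def)
      then show ?thesis
        unfolding X using Pc(1) by (simp add: that(2) s_mult[OF that(1) that(1)])
    qed
    have 1: "(\<lambda>g\<in>P. s (fst (\<phi> g))) \<in> ?X" and 2: "(\<lambda>g\<in>P. s (snd (\<phi> g))) \<in> ?X"
      by (rule s_in; use \<phi>_range \<phi>_mult in simp)+
    from * show ?thesis
    proof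
      assume "fst (\<phi> g) \<noteq> 0"
      then show ?thesis by (intro bexI[OF _ 1]) (use g in \<open>simp add: s_def\<close>)
    next
      assume "snd (\<phi> g) \<noteq> 0"
      then show ?thesis by (intro bexI[OF _ 2]) (use g in \<open>simp add: s_def\<close>)
    qed
  qed
  let ?m = "\<lambda>\<chi> \<psi>. \<lambda>g\<in>P. \<chi> g * \<psi> g" and ?u = "\<lambda>g\<in>P. 1 :: complex"
  have m: "?m \<chi> \<psi> \<in> ?X" if "\<chi> \<in> ?X" "\<psi> \<in> ?X" for \<chi> \<psi>
    using that Pc unfolding X by (simp add: algebra_simps)
  have u: "?u \<in> ?X" unfolding X using Pc by simp
  have orth_g: "(\<Sum>g\<in>P. \<chi> g) = (if \<chi> = ?u then 4 else 0)" if \<chi>: "\<chi> \<in> ?X" for \<chi>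
  proof (cases "\<chi> = ?u")
    case True
    then have "(\<Sum>g\<in>P. \<chi> g) = (\<Sum>g\<in>P. 1)" by (intro sum.cong) auto
    then show ?thesis using True card by simp
  next
    case False
    then obtain h where h: "h \<in> P" "\<chi> h \<noteq> 1"
      using X_eqI[OF \<chi> u] by auto
    have bij: "bij_betw (\<lambda>g. h \<otimes>\<^bsub>?G\<^esub> g) P P"
      using h Pc PG
      by (intro bij_betwI[where g = "\<lambda>g. inv\<^bsub>?G\<^esub> h \<otimes>\<^bsub>?G\<^esub> g"])
        (auto simp: G.m_assoc[symmetric])
    have "(\<Sum>g\<in>P. \<chi> g) = (\<Sum>g\<in>P. \<chi> (h \<otimes>\<^bsub>?G\<^esub> g))"
      by (rule sum.reindex_bij_betw[OF bij, symmetric])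
    also have "\<dots> = \<chi> h * (\<Sum>g\<in>P. \<chi> g)"
      by (simp add: X_mult[OF \<chi> h(1)] sum_distrib_left)
    finally show ?thesis using h False by simp
  qed
  have orth_X0: "(\<Sum>\<chi>\<in>?X. \<chi> g) = 0" if g: "g \<in> P" "g \<noteq> ?one" for g
  proof -
    obtain \<psi> where \<psi>: "\<psi> \<in> ?X" "\<psi> g \<noteq> 1" using sep[OF g] by blast
    have mm: "?m \<psi> (?m \<psi> \<chi>) = \<chi>" if "\<chi> \<in> ?X" for \<chi>
    proof
      fix k
      show "?m \<psi> (?m \<psi> \<chi>) k = \<chi> k"
        using X_val[OF \<psi>(1), of k] that X by (cases "k \<in> P") (auto simp: extensional_def)
    qed
    have bij: "bij_betw (?m \<psi>) ?X ?X"
      by (rule bij_betwI[where g = "?m \<psi>"]) (use m \<psi> mm in auto)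
    have "(\<Sum>\<chi>\<in>?X. \<chi> g) = (\<Sum>\<chi>\<in>?X. (?m \<psi> \<chi>) g)"
      by (rule sum.reindex_bij_betw[OF bij, symmetric])
    also have "\<dots> = \<psi> g * (\<Sum>\<chi>\<in>?X. \<chi> g)" using g by (simp add: sum_distrib_left)
    finally show ?thesis using \<psi>(2) by simp
  qed
  have orth_X1: "(\<Sum>\<chi>\<in>?X. \<chi> ?one) = of_nat (card ?X)" by (simp add: X_one)
  have "of_nat (card ?X) = (\<Sum>g\<in>P. \<Sum>\<chi>\<in>?X. \<chi> g)"
  proof -
    have "(\<Sum>g\<in>P. \<Sum>\<chi>\<in>?X. \<chi> g) = (\<Sum>g\<in>P. if g = ?one then of_nat (card ?X) else 0)"
      by (intro sum.cong refl) (use orth_X0 orth_X1 in auto)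
    then show ?thesis using finP Pc by simp
  qed
  also have "\<dots> = (\<Sum>\<chi>\<in>?X. \<Sum>g\<in>P. \<chi> g)" by (rule sum.swap)
  also have "\<dots> = (\<Sum>\<chi>\<in>?X. if \<chi> = ?u then 4 else 0)" by (intro sum.cong refl) (simp add: orth_g)
  also have "\<dots> = 4" using finX u by simp
  finally have orth_X: "(\<Sum>\<chi>\<in>?X. \<chi> g) = (if g = ?one then 4 else 0)" if "g \<in> P" for g
    using orth_X0[OF that] orth_X1 by auto
  have of_perm_mult: "of_perm g * of_perm h = of_perm (g \<otimes>\<^bsub>?G\<^esub> h)" if "g \<in> P" "h \<in> P" for g h
    using that PG by (simp add: of_perm_def mult_single plus_alt5.abs_eq eq_onp_def)
  have of_perm_one: "of_perm ?one = 1"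
    by (simp add: of_perm_def zero_alt5_def[symmetric])
  have e_eq: "e \<chi> = (1/4) *\<^sub>C (\<Sum>g\<in>P. \<chi> g *\<^sub>C of_perm g)" if "\<chi> \<in> ?X" for \<chi>
  proof -
    have "\<chi> (inv\<^bsub>?G\<^esub> g) = \<chi> g" if g: "g \<in> P" for g
      using sq[OF g] g PG by (metis G.inv_equality)
    then show ?thesis by (simp add: e_def char_idem_def)
  qed
  have of_perm_e: "of_perm g = (\<Sum>\<chi>\<in>?X. \<chi> g *\<^sub>C e \<chi>)" if g: "g \<in> P" for g
  proof -
    have "(\<Sum>\<chi>\<in>?X. \<chi> g *\<^sub>C e \<chi>) =
        (\<Sum>\<chi>\<in>?X. \<Sum>h\<in>P. (1/4 * \<chi> (g \<otimes>\<^bsub>?G\<^esub> h)) *\<^sub>C of_perm h)"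
      by (intro sum.cong refl)
        (simp add: e_eq cvec.scale_sum_right scaleC_scaleC X_mult g)
    also have "\<dots> = (\<Sum>h\<in>P. (1/4 * (\<Sum>\<chi>\<in>?X. \<chi> (g \<otimes>\<^bsub>?G\<^esub> h))) *\<^sub>C of_perm h)"
      by (subst sum.swap) (simp only: cvec.scale_sum_left sum_distrib_left)
    also have "\<dots> = (\<Sum>h\<in>P. if h = g then of_perm h else 0)"
    proof (intro sum.cong refl)
      fix h assume h: "h \<in> P"
      have "g \<otimes>\<^bsub>?G\<^esub> h = ?one \<longleftrightarrow> h = g"
        using sq[OF g] G.m_assoc[of g g h] g h PG by (metis G.l_one G.r_one)
      then show "(1/4 * (\<Sum>\<chi>\<in>?X. \<chi> (g \<otimes>\<^bsub>?G\<^esub> h))) *\<^sub>C of_perm h = (if h = g then of_perm h else 0)"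
        using orth_X[of "g \<otimes>\<^bsub>?G\<^esub> h"] g h Pc by simp
    qed
    also have "\<dots> = of_perm g" using finP g by simp
    finally show ?thesis ..
  qed
  have perm_e: "of_perm g * e \<chi> = \<chi> g *\<^sub>C e \<chi>" if g: "g \<in> P" and \<chi>: "\<chi> \<in> ?X" for g \<chi>
  proof -
    have bij: "bij_betw (\<lambda>h. g \<otimes>\<^bsub>?G\<^esub> h) P P"
      using g Pc PG
      by (intro bij_betwI[where g = "\<lambda>h. inv\<^bsub>?G\<^esub> g \<otimes>\<^bsub>?G\<^esub> h"])
        (auto simp: G.m_assoc[symmetric])
    have gg: "\<chi> g * \<chi> g = 1" using X_val[OF \<chi> g] by auto
    have "of_perm g * e \<chi> = (1/4) *\<^sub>C (\<Sum>h\<in>P. \<chi> h *\<^sub>C of_perm (g \<otimes>\<^bsub>?G\<^esub> h))"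
      by (simp add: e_eq \<chi> mult_scaleC_right sum_distrib_left of_perm_mult g)
    also have "(\<Sum>h\<in>P. \<chi> h *\<^sub>C of_perm (g \<otimes>\<^bsub>?G\<^esub> h)) =
        (\<Sum>h\<in>P. (\<chi> g * \<chi> (g \<otimes>\<^bsub>?G\<^esub> h)) *\<^sub>C of_perm (g \<otimes>\<^bsub>?G\<^esub> h))"
      by (intro sum.cong refl) (simp add: X_mult[OF \<chi> g] gg mult.assoc[symmetric])
    also have "\<dots> = (\<Sum>h\<in>P. (\<chi> g * \<chi> h) *\<^sub>C of_perm h)"
      by (rule sum.reindex_bij_betw[OF bij])
    finally show ?thesis
      by (simp add: e_eq \<chi> cvec.scale_sum_right scaleC_scaleC mult_ac)
  qed
  have idem: "e \<psi> * e \<chi> = (if \<psi> = \<chi> then e \<psi> else 0)" if \<psi>: "\<psi> \<in> ?X" and \<chi>: "\<chi> \<in> ?X" for \<psi> \<chi>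
  proof -
    have "e \<psi> * e \<chi> = (1/4) *\<^sub>C (\<Sum>g\<in>P. ?m \<psi> \<chi> g *\<^sub>C e \<chi>)"
      by (simp add: e_eq[OF \<psi>] mult_scaleC_left sum_distrib_right perm_e \<chi> scaleC_scaleC)
    also have "\<dots> = (1/4 * (\<Sum>g\<in>P. ?m \<psi> \<chi> g)) *\<^sub>C e \<chi>"
      by (simp only: cvec.scale_sum_left scaleC_scaleC[symmetric])
    finally have "e \<psi> * e \<chi> = (1/4 * (\<Sum>g\<in>P. ?m \<psi> \<chi> g)) *\<^sub>C e \<chi>" .
    moreover have "?m \<psi> \<chi> = ?u \<longleftrightarrow> \<psi> = \<chi>"
    proof
      assume *: "?m \<psi> \<chi> = ?u"
      have "\<psi> k * \<chi> k = 1" if "k \<in> P" for k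
        using fun_cong[OF *, of k] that by simp
      then have "\<psi> k = \<chi> k" if "k \<in> P" for k
        using that X_val[OF \<psi> that] X_val[OF \<chi> that] by force
      then show "\<psi> = \<chi>" by (rule X_eqI[OF \<psi> \<chi>])
    next
      assume "\<psi> = \<chi>"
      then show "?m \<psi> \<chi> = ?u" using X_sq[OF \<psi>] by (intro restrict_ext) simp
    qed
    ultimately show ?thesis using orth_g[OF m[OF \<psi> \<chi>]] by simp
  qed
  have one: "(\<Sum>\<chi>\<in>?X. e \<chi>) = 1"
    using of_perm_e[of ?one] Pc by (simp add: of_perm_one X_one)
  note D = clinear_group_coalg(1)[where 'g = alt5] and E = clinear_group_coalg(2)[where 'g = alt5]
  have De: "comult group_coalg (e d) = (\<Sum>x\<in>?X. \<Sum>y\<in>?X. if ?m x y = d then e x \<boxtimes> e y else 0)"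
    if d: "d \<in> ?X" for d
  proof -
    have "comult group_coalg (e d) = (1/4) *\<^sub>C (\<Sum>g\<in>P. d g *\<^sub>C (of_perm g \<boxtimes> of_perm g))"
      by (simp add: e_eq d clinear_scale[OF D] clinear_sum[OF D])
        (simp add: of_perm_def group_coalg_single)
    also have "\<dots> = (1/4) *\<^sub>C (\<Sum>g\<in>P. d g *\<^sub>C
        (\<Sum>x\<in>?X. \<Sum>y\<in>?X. (x g * y g) *\<^sub>C (e x \<boxtimes> e y)))"
    proof (rule arg_cong[where f = "scaleC _"], intro sum.cong refl)
      fix g assume g: "g \<in> P"
      show "d g *\<^sub>C (of_perm g \<boxtimes> of_perm g) =
          d g *\<^sub>C (\<Sum>x\<in>?X. \<Sum>y\<in>?X. (x g * y g) *\<^sub>C (e x \<boxtimes> e y))"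
        unfolding of_perm_e[OF g]
        by (simp add: tens_sum_left tens_sum_right tens_scale_left tens_scale_right
            cvec.scale_sum_right scaleC_scaleC mult_ac)
          (rule trans[OF sum.swap], simp add: mult_ac)
    qed
    also have "\<dots> = (\<Sum>g\<in>P. \<Sum>x\<in>?X. \<Sum>y\<in>?X. (1/4 * ?m d (?m x y) g) *\<^sub>C (e x \<boxtimes> e y))"
      by (simp add: cvec.scale_sum_right scaleC_scaleC)
    also have "\<dots> = (\<Sum>x\<in>?X. \<Sum>y\<in>?X. \<Sum>g\<in>P. (1/4 * ?m d (?m x y) g) *\<^sub>C (e x \<boxtimes> e y))"
      by (rule trans[OF sum.swap], rule sum.cong[OF refl], rule sum.swap)
    also have "\<dots> = (\<Sum>x\<in>?X. \<Sum>y\<in>?X. (1/4 * (\<Sum>g\<in>P. ?m d (?m x y) g)) *\<^sub>C (e x \<boxtimes> e y))"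
      by (simp only: cvec.scale_sum_left sum_distrib_left)
    also have "\<dots> = (\<Sum>x\<in>?X. \<Sum>y\<in>?X. if ?m x y = d then e x \<boxtimes> e y else 0)"
    proof (intro sum.cong refl)
      fix x y assume xy: "x \<in> ?X" "y \<in> ?X"
      have mxy: "?m x y \<in> ?X" using m xy .
      have "?m d (?m x y) = ?u \<longleftrightarrow> ?m x y = d"
      proof
        assume *: "?m d (?m x y) = ?u"
        have "d k * ?m x y k = 1" if "k \<in> P" for k
          using fun_cong[OF *, of k] that by simp
        then have "?m x y k = d k" if "k \<in> P" for k
          using that X_val[OF d that] X_val[OF mxy that] by force
        then show "?m x y = d" by (rule X_eqI[OF mxy d])
      next
        assume *: "?m x y = d"
        show "?m d (?m x y) = ?u" unfolding * using X_sq[OF d] by (intro restrict_ext) simp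
      qed
      then show "(1/4 * (\<Sum>g\<in>P. ?m d (?m x y) g)) *\<^sub>C (e x \<boxtimes> e y) =
          (if ?m x y = d then e x \<boxtimes> e y else 0)"
        using orth_g[OF m[OF d mxy]] by simp
    qed
    finally show ?thesis .
  qed
  have Ee: "counit group_coalg (e d) = (if d = ?u then 1 else 0)" if d: "d \<in> ?X" for d
  proof -
    have "counit group_coalg (e d) = 1/4 * (\<Sum>g\<in>P. d g)"
      by (simp add: e_eq d clinear_scale[OF E] clinear_sum[OF E])
        (simp add: of_perm_def group_coalg_single)
    also have "\<dots> = (if d = ?u then 1 else 0)" unfolding orth_g[OF d] by simp
    finally show ?thesis .
  qed
  have K: "mult (dual_group P) = ?m" "one (dual_group P) = ?u"
    by (simp_all add: character_group_def)
  have "is_twist group_coalg (\<Sum>x\<in>?X. \<Sum>y\<in>?X. \<beta> x y *\<^sub>C (e x \<boxtimes> e y))"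
    by (rule is_twist_idempotents[OF D E finX idem one De Ee m u])
      (use \<beta> in \<open>auto simp: normalized_2cocycle_def K\<close>)
  then show ?thesis by (simp add: nikshych_twist_def e_def)
qed

end

theory Submission
  imports Defs
begin

text \<open>
  The twist lies in the tensor square of the coradical \<open>X\<close>, so twisting \<open>H\<close> back by it does not
  change the coradical filtration and yields a bialgebra \<open>H'\<close> in which \<open>X\<close> is spanned by group-likes
  forming a copy of \<open>\<bbbA>\<^sub>5\<close>.  If \<open>X\<close> were proper, \<open>H'\<close> would contain a skew-primitive \<open>x \<notin> X\<close>, with
  group-like \<open>g\<close> and \<open>g x = q x g\<close>.  Powers of \<open>x\<close> are independent if \<open>q = 1\<close>.  Otherwise \<open>g\<close> is
  conjugate to \<open>g\<^sup>-\<^sup>1 \<noteq> g\<close>, or \<open>g\<close> is an involution and \<open>q = - 1\<close>; the conjugates of \<open>x\<close> over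
  \<open>{g, g\<^sup>-\<^sup>1}\<close>, respectively over the three involutions of a Klein four-group, then span a braided space
  of affine Cartan type \<open>A\<^sub>1\<close> or \<open>A\<^sub>2\<close>.  Their braided commutator \<open>z\<close> of imaginary degree has trivial
  self-braiding, and differentiating \<open>z ^ k\<close> along all generators gives a nonzero multiple of
  \<open>z ^ (k - 1)\<close>.  So the powers of \<open>z\<close> leave every term of the filtration, contradicting finite
  dimension.
\<close>

text \<open>The usual route would pass to the associated graded algebra of H' and to
  infinite-dimensional Nichols algebras. Here everything stays inside H': functionals replace
  quotients, and the relation \<open>der\<close> between an element and its leading derivative
  replaces braided derivations, since on a merely filtered algebra a derivative is determined only
  up to lower terms. That X is the coradical is used for H, where it makes the filtration
  exhaustive; H' inherits exhaustiveness from an inclusion of filtrations, so its coradical is never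
  computed. The group enters through one fact: each element is trivial, or an involution in a Klein
  four-group whose involutions are permuted cyclically by some conjugation, or of order 3 or 5 and
  conjugate to its inverse. The Cartan types are read off the braiding matrix: for the pair, q_12
  q_21 = q^(-2) with q_11 = q_22 = q gives off-diagonal entries -2; for the triangle, q_ii = -1 and
  q_ij q_ji = -1 give entries -1. The degree of z is the sum of all simple roots.\<close>

text \<open>As a simp rule, \<open>scaleC_complex_def\<close> also rewrites the unapplied \<open>scaleC\<close> inside \<open>clinear\<close>.\<close>

declare scaleC_complex_def [simp del]

section \<open>Slices of tensors\<close>

definition slice_left :: "('a::complex_vector \<Rightarrow> complex) \<Rightarrow> ('a, 'b::complex_vector) tensor \<Rightarrow> 'b" where
  "slice_left \<xi> = tlift (\<lambda>x y. \<xi> x *\<^sub>C y)"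

definition slice_right :: "('b::complex_vector \<Rightarrow> complex) \<Rightarrow> ('a::complex_vector, 'b) tensor \<Rightarrow> 'a" where
  "slice_right \<xi> = tlift (\<lambda>x y. \<xi> y *\<^sub>C x)"

lemma slice_tens [simp]:
  "clinear \<xi> \<Longrightarrow> slice_left \<xi> (a \<boxtimes> b) = \<xi> a *\<^sub>C b"
  "clinear \<eta> \<Longrightarrow> slice_right \<eta> (a \<boxtimes> b) = \<eta> b *\<^sub>C a"
  by (simp_all add: slice_left_def slice_right_def bilin_counit1 bilin_counit2)

lemma clinear_slice:
  "clinear \<xi> \<Longrightarrow> clinear (slice_left \<xi>)" "clinear \<eta> \<Longrightarrow> clinear (slice_right \<eta>)"
  by (simp_all add: slice_left_def slice_right_def clinear_tlift bilin_counit1 bilin_counit2)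

lemma clinear_add_fun: "clinear f \<Longrightarrow> clinear g \<Longrightarrow> clinear (\<lambda>x. f x + g x)"
  by (simp add: clinear_iff scaleC_add_right)

lemma clinear_diff_fun: "clinear f \<Longrightarrow> clinear g \<Longrightarrow> clinear (\<lambda>x. f x - g x)"
  by (simp add: clinear_iff cvec.scale_right_diff_distrib)

lemma clinear_scale_fun: "clinear f \<Longrightarrow> clinear (\<lambda>x. c *\<^sub>C f x)"
  by (simp add: clinear_iff scaleC_add_right scaleC_scaleC mult.commute)

lemma clinear_zero_fun: "clinear (\<lambda>x. 0)"
  by (simp add: clinear_iff)

lemma clinear_sum_fun: "(\<And>i. i \<in> I \<Longrightarrow> clinear (f i)) \<Longrightarrow> clinear (\<lambda>x. \<Sum>i\<in>I. f i x)"
  by (induction I rule: infinite_finite_induct) (simp_all add: clinear_zero_fun clinear_add_fun)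

lemma slice_fun_add:
  "slice_left (\<lambda>x. \<xi> x + \<xi>' x) t = slice_left \<xi> t + slice_left \<xi>' t"
  "slice_right (\<lambda>x. \<eta> x + \<eta>' x) t = slice_right \<eta> t + slice_right \<eta>' t"
  by (simp_all add: slice_left_def slice_right_def scaleC_add_left tlift_fun_add)

lemma slice_fun_scale:
  "slice_left (\<lambda>x. c * \<xi> x) t = c *\<^sub>C slice_left \<xi> t"
  "slice_right (\<lambda>x. c * \<eta> x) t = c *\<^sub>C slice_right \<eta> t"
  by (simp_all add: slice_left_def slice_right_def tlift_fun_scale flip: scaleC_scaleC)

lemma slice_fun_zero:
  "slice_left (\<lambda>x. 0) t = 0" "slice_right (\<lambda>x. 0) t = 0"
  by (simp_all add: slice_left_def slice_right_def tlift_def free_ext_def)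

lemma functional_slice_swap:
  assumes "clinear \<xi>" "clinear \<mu>"
  shows "\<xi> (slice_left \<mu> t) = \<mu> (slice_right \<xi> t)"
  by (rule clinear_eq_on_tens[where f = "\<lambda>t. \<xi> (slice_left \<mu> t)"])
    (simp_all add: assms clinear_comp clinear_slice clinear_scale[OF assms(1)] clinear_scale[OF assms(2)]
      scaleC_complex_def)

lemma subspace_vimage: "clinear f \<Longrightarrow> cvec.subspace W \<Longrightarrow> cvec.subspace {x. f x \<in> W}"
  unfolding cvec.subspace_def
  by (simp add: clinear_add clinear_scale clinear_zero)

lemma subspace_image: "clinear f \<Longrightarrow> cvec.subspace W \<Longrightarrow> cvec.subspace (f ` W)"
  by (rule cvec_pair.linear_subspace_image)

lemma subspace_all: "(\<And>i. Q i \<Longrightarrow> cvec.subspace {x. P i x}) \<Longrightarrow> cvec.subspace {x. \<forall>i. Q i \<longrightarrow> P i x}"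
  by (simp add: cvec.subspace_def)

lemma separating_functional:
  fixes v :: "'a::complex_vector"
  assumes W: "cvec.subspace W" and v: "v \<notin> W"
  obtains \<xi> :: "'a \<Rightarrow> complex" where "clinear \<xi>" "\<And>x. x \<in> W \<Longrightarrow> \<xi> x = 0" "\<xi> v = 1"
proof -
  obtain B where B: "B \<subseteq> W" "cvec.independent B" "W \<subseteq> cvec.span B"
    by (rule cvec.basis_exists)
  have "cvec.span B = W" using B W by (intro subset_antisym cvec.span_minimal)
  with v have ind: "cvec.independent (insert v B)" by (simp add: B(2) cvec.independent_insertI)
  obtain \<xi> :: "'a \<Rightarrow> complex" where \<xi>: "clinear \<xi>" "\<forall>x\<in>insert v B. \<xi> x = (if x = v then 1 else 0)"
    using cvec_pair.linear_independent_extend[OF ind, where f = "\<lambda>x. if x = v then 1 else 0"] by auto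
  have 0: "\<xi> b = 0" if "b \<in> B" for b
    using \<xi>(2) that B(1) v by (metis insertI2 subsetD)
  have "\<xi> x = 0" if "x \<in> W" for x
    using B(3) that by (intro cvec_pair.linear_eq_0_on_span[OF \<xi>(1) 0]) auto
  moreover have "\<xi> v = 1" using bspec[OF \<xi>(2) insertI1] by simp
  ultimately show thesis by (rule that[OF \<xi>(1)])
qed

lemma functionals_separate:
  fixes x :: "'a::complex_vector"
  assumes "\<And>\<xi> :: 'a \<Rightarrow> complex. clinear \<xi> \<Longrightarrow> \<xi> x = 0" shows "x = 0"
proof (rule ccontr)
  assume "x \<noteq> 0"
  then have "x \<notin> {0}" by simp
  with cvec.subspace_single_0 obtain \<xi> :: "'a \<Rightarrow> complex" where "clinear \<xi>" "\<xi> x = 1"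
    by (rule separating_functional)
  with assms[of \<xi>] show False by simp
qed

lemma adapted_basis:
  fixes X :: "'a::complex_vector set"
  assumes "finite_dimensional TYPE('a)" "cvec.subspace X"
  obtains B C where "finite C" "B \<subseteq> C" "cvec.independent C" "cvec.span B = X" "cvec.span C = UNIV"
proof -
  obtain F :: "'a set" where F: "finite F" "cvec.span F = UNIV"
    using assms(1) by (auto simp: finite_dimensional_def)
  obtain B where B: "B \<subseteq> X" "cvec.independent B" "X \<subseteq> cvec.span B"
    by (rule cvec.basis_exists)
  define C where "C = cvec.extend_basis B"
  have C: "cvec.independent C" "B \<subseteq> C" "cvec.span C = UNIV"
    using B(2) by (simp_all add: C_def cvec.independent_extend_basis cvec.extend_basis_superset)
  have "finite C" using cvec.independent_span_bound[OF F(1) C(1)] F(2) by simp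
  with B C that show thesis using assms(2) by (metis cvec.span_minimal subset_antisym)
qed

lemma clinear_representation:
  assumes "cvec.independent B" "cvec.span B = UNIV"
  shows "clinear (\<lambda>v. cvec.representation B v b)"
  by (simp add: clinear_iff assms cvec.representation_add cvec.representation_scale
      scaleC_complex_def)

lemma tensor_expand_right:
  fixes t :: "('a::complex_vector, 'b::complex_vector) tensor"
  assumes B: "finite B" "cvec.independent B" "cvec.span B = UNIV"
  shows "t = (\<Sum>b\<in>B. slice_right (\<lambda>v. cvec.representation B v b) t \<boxtimes> b)"
proof (rule clinear_eq_on_tens[where f = "\<lambda>t. t"])
  note lin = clinear_representation[OF B(2,3)]
  show "clinear (\<lambda>t. \<Sum>b\<in>B. slice_right (\<lambda>v. cvec.representation B v b) t \<boxtimes> b)"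
    by (intro clinear_sum_fun clinear_comp[OF clinear_tens(1)] clinear_slice lin)
  show "clinear (\<lambda>t :: ('a, 'b) tensor. t)" by (simp add: clinear_iff)
  fix x and y :: 'b
  have "y = (\<Sum>b\<in>B. cvec.representation B y b *\<^sub>C b)"
    using cvec.sum_representation_eq[OF B(2) _ B(1), of y] B(3) by simp
  then have "x \<boxtimes> y = x \<boxtimes> (\<Sum>b\<in>B. cvec.representation B y b *\<^sub>C b)" by simp
  also have "\<dots> = (\<Sum>b\<in>B. slice_right (\<lambda>v. cvec.representation B v b) (x \<boxtimes> y) \<boxtimes> b)"
    unfolding slice_tens(2)[OF lin] by (simp add: tens_sum_right tens_scale_left tens_scale_right)
  finally show "x \<boxtimes> y = (\<Sum>b\<in>B. slice_right (\<lambda>v. cvec.representation B v b) (x \<boxtimes> y) \<boxtimes> b)" .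
qed

lemma tens_in_tensor_sub: "x \<in> X \<Longrightarrow> y \<in> Y \<Longrightarrow> x \<boxtimes> y \<in> tensor_sub X Y"
  unfolding tensor_sub_def by (rule cvec.span_base) blast

lemma subspace_tensor_sub: "cvec.subspace (tensor_sub X Y)"
  by (simp add: tensor_sub_def cvec.subspace_span)

lemma tensor_sub_least:
  assumes "cvec.subspace S" "\<And>x y. x \<in> X \<Longrightarrow> y \<in> Y \<Longrightarrow> x \<boxtimes> y \<in> S"
  shows "tensor_sub X Y \<subseteq> S"
  unfolding tensor_sub_def by (rule cvec.span_minimal) (use assms in auto)

lemma slice_right_tensor_sub:
  assumes "t \<in> tensor_sub X Y" "clinear \<xi>" "cvec.subspace X"
  shows "slice_right \<xi> t \<in> X"
proof -
  have "tensor_sub X Y \<subseteq> {t. slice_right \<xi> t \<in> X}"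
    by (intro tensor_sub_least subspace_vimage clinear_slice)
      (use assms in \<open>auto intro: cvec.subspace_scale\<close>)
  then show ?thesis using assms(1) by blast
qed

lemma slice_left_tensor_sub:
  assumes "t \<in> tensor_sub X Y" "clinear \<xi>" "cvec.subspace Y"
  shows "slice_left \<xi> t \<in> Y"
proof -
  have "tensor_sub X Y \<subseteq> {t. slice_left \<xi> t \<in> Y}"
    by (intro tensor_sub_least subspace_vimage clinear_slice)
      (use assms in \<open>auto intro: cvec.subspace_scale\<close>)
  then show ?thesis using assms(1) by blast
qed

lemma slice_right_vanish:
  assumes t: "t \<in> tensor_sub X Y" and \<xi>: "clinear \<xi>" and zero: "\<And>y. y \<in> Y \<Longrightarrow> \<xi> y = 0"
  shows "slice_right \<xi> t = 0"
proof -
  have "tensor_sub X Y \<subseteq> {t. slice_right \<xi> t \<in> {0}}"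
    by (intro tensor_sub_least subspace_vimage clinear_slice) (simp_all add: \<xi> zero)
  then show ?thesis using t by auto
qed

lemma tensor_sub_mono: "X \<subseteq> X' \<Longrightarrow> Y \<subseteq> Y' \<Longrightarrow> tensor_sub X Y \<subseteq> tensor_sub X' Y'"
  by (intro tensor_sub_least subspace_tensor_sub) (auto intro: tens_in_tensor_sub)

lemma tensor_sub_zero: "tensor_sub {0} Y = {0}"
proof -
  have "tensor_sub {0} Y \<subseteq> {0}"
    by (rule tensor_sub_least) simp_all
  then show ?thesis using cvec.subspace_0[OF subspace_tensor_sub] by blast
qed

lemma tensor_sub_mult:
  fixes X X' Z :: "'a::complex_algebra_1 set" and Y Y' W :: "'b::complex_algebra_1 set"
  assumes s: "s \<in> tensor_sub X Y" and t: "t \<in> tensor_sub X' Y'"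
    and X: "\<And>x x'. x \<in> X \<Longrightarrow> x' \<in> X' \<Longrightarrow> x * x' \<in> Z"
    and Y: "\<And>y y'. y \<in> Y \<Longrightarrow> y' \<in> Y' \<Longrightarrow> y * y' \<in> W"
  shows "s * t \<in> tensor_sub Z W"
proof -
  have 1: "(x \<boxtimes> y) * t \<in> tensor_sub Z W" if "x \<in> X" "y \<in> Y" for x y
  proof -
    have "tensor_sub X' Y' \<subseteq> {t. (x \<boxtimes> y) * t \<in> tensor_sub Z W}"
      by (intro tensor_sub_least subspace_vimage subspace_tensor_sub clinear_mult)
        (auto simp: tens_times intro!: tens_in_tensor_sub X Y that)
    then show ?thesis using t by blast
  qed
  have "tensor_sub X Y \<subseteq> {s. s * t \<in> tensor_sub Z W}"
    by (intro tensor_sub_least subspace_vimage subspace_tensor_sub clinear_mult) (simp_all add: 1)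
  then show ?thesis using s by blast
qed

text \<open>Expand the right factor in a basis adapted to X: coordinates outside X are functionals
  vanishing on X, so their slices fall in Y, and the remaining terms have right leg in X. This turns
  conditions on slices back into statements about tensors.\<close>

lemma tensor_decompose:
  fixes t :: "('a::complex_vector, 'b::complex_vector) tensor"
  assumes "finite_dimensional TYPE('b)" "cvec.subspace X"
    and Y: "\<And>\<xi>. clinear \<xi> \<Longrightarrow> (\<And>x. x \<in> X \<Longrightarrow> \<xi> x = 0) \<Longrightarrow> slice_right \<xi> t \<in> Y"
    and Z: "\<And>\<xi>. clinear \<xi> \<Longrightarrow> slice_right \<xi> t \<in> Z"
  obtains r s where "r \<in> tensor_sub Y UNIV" "s \<in> tensor_sub Z X" "t = r + s"
proof -
  obtain B C where BC: "finite C" "B \<subseteq> C" "cvec.independent C" "cvec.span B = X" "cvec.span C = UNIV"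
    using adapted_basis[OF assms(1,2)] .
  let ?r = "\<lambda>b v. cvec.representation C v b"
  note lin = clinear_representation[OF BC(3,5)]
  have van: "?r b x = 0" if "b \<in> C - B" "x \<in> X" for b x
  proof -
    have "?r b x = cvec.representation B x b"
      by (rule fun_cong[OF cvec.representation_extend[OF BC(3) _ BC(2)]]) (simp add: BC(4) that(2))
    then show ?thesis using that(1) cvec.representation_ne_zero[of B x b] by auto
  qed
  have "t = (\<Sum>b\<in>C. slice_right (?r b) t \<boxtimes> b)"
    by (rule tensor_expand_right[OF BC(1,3,5)])
  also have "\<dots> = (\<Sum>b\<in>C - B. slice_right (?r b) t \<boxtimes> b) + (\<Sum>b\<in>B. slice_right (?r b) t \<boxtimes> b)"
    by (rule sum.subset_diff[OF BC(2,1)])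
  finally have eq: "t = (\<Sum>b\<in>C - B. slice_right (?r b) t \<boxtimes> b) + (\<Sum>b\<in>B. slice_right (?r b) t \<boxtimes> b)" .
  have 1: "(\<Sum>b\<in>C - B. slice_right (?r b) t \<boxtimes> b) \<in> tensor_sub Y UNIV"
  proof (rule cvec.subspace_sum[OF subspace_tensor_sub])
    fix b assume "b \<in> C - B"
    then have "slice_right (?r b) t \<in> Y" by (intro Y lin van)
    then show "slice_right (?r b) t \<boxtimes> b \<in> tensor_sub Y UNIV" by (simp add: tens_in_tensor_sub)
  qed
  have 2: "(\<Sum>b\<in>B. slice_right (?r b) t \<boxtimes> b) \<in> tensor_sub Z X"
  proof (rule cvec.subspace_sum[OF subspace_tensor_sub])
    fix b assume "b \<in> B"
    then have "b \<in> X" using cvec.span_base BC(4) by blast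
    then show "slice_right (?r b) t \<boxtimes> b \<in> tensor_sub Z X" by (simp add: tens_in_tensor_sub Z lin)
  qed
  show thesis by (rule that[OF 1 2 eq])
qed

section \<open>The two actions of the dual algebra\<close>

text \<open>In Sweedler notation, h_1 \<xi>(h_2) here and \<xi>(h_1) h_2 for \<open>ract\<close>:
  the left and right actions of the convolution algebra of functionals. Working with them avoids
  most computations in triple tensor products.\<close>

definition lact :: "'a::complex_vector coalg \<Rightarrow> ('a \<Rightarrow> complex) \<Rightarrow> 'a \<Rightarrow> 'a" where
  "lact A \<xi> h = slice_right \<xi> (comult A h)"

definition ract :: "'a::complex_vector coalg \<Rightarrow> ('a \<Rightarrow> complex) \<Rightarrow> 'a \<Rightarrow> 'a" where
  "ract A \<xi> h = slice_left \<xi> (comult A h)"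

locale coalgebra_loc =
  fixes A :: "'a::complex_vector coalg"
  assumes coalgebra: "coalgebra A"
begin

lemma clinear_comult: "clinear (comult A)" and clinear_counit: "clinear (counit A)"
  using coalgebra by (simp_all add: coalgebra_def)

lemma clinear_lact: "clinear \<xi> \<Longrightarrow> clinear (lact A \<xi>)"
  and clinear_ract: "clinear \<xi> \<Longrightarrow> clinear (ract A \<xi>)"
  unfolding lact_def ract_def
  by (simp_all add: clinear_comp clinear_slice clinear_comult)

lemma lact_counit: "lact A (counit A) h = h" and ract_counit: "ract A (counit A) h = h"
  using coalgebra by (simp_all add: coalgebra_def lact_def ract_def slice_left_def slice_right_def)

lemma functional_ract: "clinear \<xi> \<Longrightarrow> clinear \<mu> \<Longrightarrow> \<xi> (ract A \<mu> h) = \<mu> (lact A \<xi> h)"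
  by (simp add: lact_def ract_def functional_slice_swap)

lemma coassoc: "tassoc (tmap (comult A) id (comult A h)) = tmap id (comult A) (comult A h)"
  using coalgebra by (simp add: coalgebra_def)

lemma lact_lact:
  assumes \<xi>: "clinear \<xi>" and \<eta>: "clinear \<eta>"
  shows "lact A \<xi> (lact A \<eta> h) = lact A (\<lambda>k. \<xi> (lact A \<eta> k)) h"
proof -
  \<comment> \<open>\<open>\<Phi>\<close> keeps the first leg and contracts the second with \<xi>
    and the third with \<eta>; the lemma compares its values on the two sides of
    coassociativity.\<close>
  define \<Phi> :: "('a, ('a, 'a) tensor) tensor \<Rightarrow> 'a"
    where "\<Phi> = slice_right (\<lambda>s. \<xi> (slice_right \<eta> s))"
  have lin2: "clinear (\<lambda>s. \<xi> (slice_right \<eta> s))"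
    by (simp add: \<xi> \<eta> clinear_comp clinear_slice)
  have \<Phi>: "clinear \<Phi>" unfolding \<Phi>_def by (rule clinear_slice(2)[OF lin2])
  have e: "\<xi> (lact A \<eta> k) = \<xi> (slice_right \<eta> (comult A k))" for k by (simp add: lact_def)
  note D1 = clinear_tmap[OF clinear_comult clinear_id'(1)]
  note D2 = clinear_tmap[OF clinear_id'(1) clinear_comult]
  have "\<Phi> (tassoc (s \<boxtimes> c)) = \<eta> c *\<^sub>C slice_right \<xi> s" for s and c :: 'a
  proof (rule clinear_eq_on_tens[where f = "\<lambda>s. \<Phi> (tassoc (s \<boxtimes> c))"])
    show "clinear (\<lambda>s. \<Phi> (tassoc (s \<boxtimes> c)))"
      by (rule clinear_comp[OF \<Phi> clinear_comp[OF clinear_tassoc clinear_tens(1)]])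
    show "clinear (\<lambda>s. \<eta> c *\<^sub>C slice_right \<xi> s)"
      by (rule clinear_scale_fun[OF clinear_slice(2)[OF \<xi>]])
  qed (simp add: tassoc_tens \<Phi>_def lin2 \<xi> \<eta> clinear_scale[OF \<xi>] scaleC_scaleC scaleC_complex_def)
  note \<Phi>_assoc = this
  have 1: "\<Phi> (tassoc (tmap (comult A) id t)) = lact A \<xi> (slice_right \<eta> t)" for t
  proof (rule clinear_eq_on_tens[where f = "\<lambda>t. \<Phi> (tassoc (tmap (comult A) id t))"])
    show "clinear (\<lambda>t. \<Phi> (tassoc (tmap (comult A) id t)))"
      by (rule clinear_comp[OF \<Phi> clinear_comp[OF clinear_tassoc D1]])
    show "clinear (\<lambda>t. lact A \<xi> (slice_right \<eta> t))"
      by (rule clinear_comp[OF clinear_lact[OF \<xi>] clinear_slice(2)[OF \<eta>]])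
    show "\<Phi> (tassoc (tmap (comult A) id (a \<boxtimes> b))) = lact A \<xi> (slice_right \<eta> (a \<boxtimes> b))" for a b
      by (simp add: tmap_tens[OF clinear_comult clinear_id'(1)] \<Phi>_assoc slice_tens(2)[OF \<eta>]
          clinear_scale[OF clinear_lact[OF \<xi>]]) (simp add: lact_def)
  qed
  have 2: "\<Phi> (tmap id (comult A) t) = slice_right (\<lambda>k. \<xi> (lact A \<eta> k)) t" for t
  proof (rule clinear_eq_on_tens[where f = "\<lambda>t. \<Phi> (tmap id (comult A) t)"])
    have lin3: "clinear (\<lambda>k. \<xi> (lact A \<eta> k))" by (rule clinear_comp[OF \<xi> clinear_lact[OF \<eta>]])
    show "clinear (\<lambda>t. \<Phi> (tmap id (comult A) t))" by (rule clinear_comp[OF \<Phi> D2])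
    show "clinear (slice_right (\<lambda>k. \<xi> (lact A \<eta> k)))" by (rule clinear_slice(2)[OF lin3])
    show "\<Phi> (tmap id (comult A) (a \<boxtimes> b)) = slice_right (\<lambda>k. \<xi> (lact A \<eta> k)) (a \<boxtimes> b)" for a b
      by (simp add: tmap_tens[OF clinear_id'(1) clinear_comult] slice_tens(2)[OF lin3])
        (simp add: \<Phi>_def slice_tens(2)[OF lin2] lact_def)
  qed
  have "lact A \<xi> (lact A \<eta> h) = \<Phi> (tassoc (tmap (comult A) id (comult A h)))"
    unfolding 1 by (simp only: lact_def)
  also have "\<dots> = lact A (\<lambda>k. \<xi> (lact A \<eta> k)) h"
    unfolding coassoc 2 by (simp only: lact_def)
  finally show ?thesis .
qed

lemma clinear_functional_act:
  "clinear \<xi> \<Longrightarrow> clinear \<eta> \<Longrightarrow> clinear (\<lambda>k. \<xi> (lact A \<eta> k))"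
  "clinear \<xi> \<Longrightarrow> clinear \<eta> \<Longrightarrow> clinear (\<lambda>k. \<xi> (ract A \<eta> k))"
  for \<xi> :: "'a \<Rightarrow> complex"
  by (rule clinear_comp, assumption, erule clinear_lact) (rule clinear_comp, assumption, erule clinear_ract)

text \<open>Pairing with \<zeta> and moving \<open>ract\<close> across by
  \<open>functional_ract\<close> reduces the commutation of the two actions to
  \<open>lact_lact\<close>.\<close>

lemma lact_ract:
  assumes \<xi>: "clinear \<xi>" and \<eta>: "clinear \<eta>"
  shows "lact A \<xi> (ract A \<eta> h) = ract A \<eta> (lact A \<xi> h)"
proof (rule eq_iff_diff_eq_0[THEN iffD2], rule functionals_separate)
  fix \<zeta> :: "'a \<Rightarrow> complex" assume \<zeta>: "clinear \<zeta>"
  have "\<zeta> (lact A \<xi> (ract A \<eta> h)) = \<eta> (lact A (\<lambda>k. \<zeta> (lact A \<xi> k)) h)"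
    by (rule functional_ract[OF clinear_functional_act(1)[OF \<zeta> \<xi>] \<eta>])
  also have "\<dots> = \<eta> (lact A \<zeta> (lact A \<xi> h))" by (simp only: lact_lact[OF \<zeta> \<xi>])
  also have "\<dots> = \<zeta> (ract A \<eta> (lact A \<xi> h))" by (rule functional_ract[OF \<zeta> \<eta>, symmetric])
  finally show "\<zeta> (lact A \<xi> (ract A \<eta> h) - ract A \<eta> (lact A \<xi> h)) = 0"
    by (simp add: clinear_diff[OF \<zeta>])
qed

lemma ract_ract:
  assumes \<xi>: "clinear \<xi>" and \<eta>: "clinear \<eta>"
  shows "ract A \<xi> (ract A \<eta> h) = ract A (\<lambda>k. \<xi> (ract A \<eta> k)) h"
proof (rule eq_iff_diff_eq_0[THEN iffD2], rule functionals_separate)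
  fix \<zeta> :: "'a \<Rightarrow> complex" assume \<zeta>: "clinear \<zeta>"
  note c = clinear_functional_act(2)[OF \<xi> \<eta>]
  have "\<zeta> (ract A \<xi> (ract A \<eta> h)) = \<xi> (ract A \<eta> (lact A \<zeta> h))"
    by (simp only: functional_ract[OF \<zeta> \<xi>] lact_ract[OF \<zeta> \<eta>])
  also have "\<dots> = \<zeta> (ract A (\<lambda>k. \<xi> (ract A \<eta> k)) h)"
    by (rule functional_ract[OF \<zeta> c, symmetric])
  finally show "\<zeta> (ract A \<xi> (ract A \<eta> h) - ract A (\<lambda>k. \<xi> (ract A \<eta> k)) h) = 0"
    by (simp add: clinear_diff[OF \<zeta>])
qed

end

section \<open>Coideals and subcoalgebras as submodules for the dual algebra\<close>

definition left_stable :: "'a::complex_vector coalg \<Rightarrow> 'a set \<Rightarrow> bool" where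
  "left_stable A T \<longleftrightarrow> cvec.subspace T \<and> (\<forall>\<xi>. clinear \<xi> \<longrightarrow> lact A \<xi> ` T \<subseteq> T)"

text \<open>Left-stable subspaces are the right coideals, \<Delta>T \<subseteq> T \<otimes> A.
  Stability under both actions characterizes subcoalgebras, by \<open>subcoalgebra_bistable\<close>
  and, in finite dimension, \<open>bistable_subcoalgebra\<close>.\<close>

definition bistable :: "'a::complex_vector coalg \<Rightarrow> 'a set \<Rightarrow> bool" where
  "bistable A T \<longleftrightarrow> left_stable A T \<and> (\<forall>\<xi>. clinear \<xi> \<longrightarrow> ract A \<xi> ` T \<subseteq> T)"

lemma left_stableD:
  assumes "left_stable A T"
  shows "cvec.subspace T" "clinear \<xi> \<Longrightarrow> t \<in> T \<Longrightarrow> lact A \<xi> t \<in> T"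
  using assms by (auto simp: left_stable_def)

lemma bistableD:
  assumes "bistable A T"
  shows "left_stable A T" "cvec.subspace T"
    "clinear \<xi> \<Longrightarrow> t \<in> T \<Longrightarrow> lact A \<xi> t \<in> T" "clinear \<xi> \<Longrightarrow> t \<in> T \<Longrightarrow> ract A \<xi> t \<in> T"
  using assms by (simp_all add: bistable_def left_stable_def image_subset_iff)

lemma subcoalgebra_bistable: "subcoalgebra A C \<Longrightarrow> bistable A C"
  unfolding subcoalgebra_def bistable_def left_stable_def lact_def ract_def
  by (auto intro!: slice_right_tensor_sub slice_left_tensor_sub)

lemma finite_dimensional_locale:
  assumes "finite_dimensional TYPE('a::complex_vector)"
  obtains B where "finite_dimensional_vector_space (scaleC :: complex \<Rightarrow> 'a \<Rightarrow> 'a) B"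
proof -
  obtain B C :: "'a set" where "finite C" "cvec.independent C" "cvec.span C = UNIV"
    by (rule adapted_basis[OF assms cvec.subspace_UNIV])
  then have "finite_dimensional_vector_space (scaleC :: complex \<Rightarrow> 'a \<Rightarrow> 'a) C"
    by unfold_locales simp_all
  then show thesis by (rule that)
qed

lemma minimal_subspace:
  fixes P :: "'a::complex_vector set \<Rightarrow> bool"
  assumes fd: "finite_dimensional TYPE('a)" and P: "P T" and sub: "\<And>T. P T \<Longrightarrow> cvec.subspace T"
  obtains T where "P T" "\<And>S. P S \<Longrightarrow> S \<subseteq> T \<Longrightarrow> S = T"
proof -
  obtain B where "finite_dimensional_vector_space (scaleC :: complex \<Rightarrow> 'a \<Rightarrow> 'a) B"
    using finite_dimensional_locale[OF fd] .
  then interpret fd: finite_dimensional_vector_space "scaleC :: complex \<Rightarrow> 'a \<Rightarrow> 'a" B .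
  obtain T where T: "P T" "\<And>S. P S \<Longrightarrow> cvec.dim T \<le> cvec.dim S"
    using ex_has_least_nat[where P = P and m = cvec.dim, OF P] by blast
  show thesis
  proof (rule that[OF T(1)])
    fix S assume "P S" "S \<subseteq> T"
    then show "S = T" by (intro fd.subspace_dim_equal sub T)
  qed
qed

context coalgebra_loc begin

lemma ract_fun_add: "ract A (\<lambda>x. \<xi> x + \<eta> x) h = ract A \<xi> h + ract A \<eta> h"
  and ract_fun_scale: "ract A (\<lambda>x. c * \<xi> x) h = c *\<^sub>C ract A \<xi> h"
  by (simp_all add: ract_def slice_fun_add slice_fun_scale)

lemma ract_fun_zero: "ract A (\<lambda>x. 0) h = 0"
  by (simp add: ract_def slice_fun_zero)

text \<open>A double annihilator argument: by \<open>functional_ract\<close> the functionals killing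
  the orbit of t under \<open>ract\<close> are those with \<open>lact A \<xi> t = 0\<close>, and a
  subspace is the common kernel of the functionals vanishing on it.\<close>

lemma in_ract_orbit:
  assumes "\<And>\<xi>. clinear \<xi> \<Longrightarrow> lact A \<xi> t = 0 \<Longrightarrow> \<xi> d = 0"
  obtains \<mu> where "clinear \<mu>" "d = ract A \<mu> t"
proof -
  define Y where "Y = {ract A \<mu> t | \<mu>. clinear \<mu>}"
  have Y: "cvec.subspace Y"
    unfolding cvec.subspace_def
  proof (intro conjI ballI allI)
    show "0 \<in> Y" unfolding Y_def using ract_fun_zero[of t] clinear_zero_fun by force
    fix x y c assume "x \<in> Y"
    then obtain \<xi> where \<xi>: "clinear \<xi>" "x = ract A \<xi> t" unfolding Y_def by blast
    have "clinear (\<lambda>x. c * \<xi> x)" using clinear_scale_fun[OF \<xi>(1), of c] by (simp add: scaleC_complex_def)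
    then show "c *\<^sub>C x \<in> Y"
      unfolding Y_def \<xi>(2) ract_fun_scale[symmetric] by blast
    assume "y \<in> Y"
    then obtain \<eta> where \<eta>: "clinear \<eta>" "y = ract A \<eta> t" unfolding Y_def by blast
    show "x + y \<in> Y"
      unfolding Y_def \<xi>(2) \<eta>(2) ract_fun_add[symmetric] using clinear_add_fun[OF \<xi>(1) \<eta>(1)] by blast
  qed
  have "d \<in> Y"
  proof (rule ccontr)
    assume "d \<notin> Y"
    then obtain \<xi> :: "'a \<Rightarrow> complex" where \<xi>: "clinear \<xi>" "\<And>x. x \<in> Y \<Longrightarrow> \<xi> x = 0" "\<xi> d = 1"
      using separating_functional[OF Y] by metis
    have "lact A \<xi> t = 0"
    proof (rule functionals_separate)
      fix \<mu> :: "'a \<Rightarrow> complex" assume \<mu>: "clinear \<mu>"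
      then have "\<xi> (ract A \<mu> t) = 0" by (intro \<xi>(2)) (auto simp: Y_def)
      then show "\<mu> (lact A \<xi> t) = 0" using functional_ract[OF \<xi>(1) \<mu>] by simp
    qed
    then show False using assms[OF \<xi>(1)] \<xi>(3) by simp
  qed
  then show thesis using that unfolding Y_def by blast
qed

text \<open>This is \<open>tensor_decompose\<close> with left part {0}: if \<xi> vanishes on C then
  \<open>lact A \<xi> h\<close> is zero for h in C, since \<mu> of it equals \<xi> of
  \<open>ract A \<mu> h\<close>, which lies in C again.\<close>

lemma bistable_subcoalgebra:
  assumes fd: "finite_dimensional TYPE('a)" and C: "bistable A C"
  shows "subcoalgebra A C"
  unfolding subcoalgebra_def
proof (intro conjI subsetI)
  show sub: "cvec.subspace C" by (rule bistableD[OF C])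
  fix t assume "t \<in> comult A ` C"
  then obtain h where h: "h \<in> C" "t = comult A h" by blast
  have 1: "slice_right \<xi> t \<in> {0}" if \<xi>: "clinear \<xi>" "\<And>x. x \<in> C \<Longrightarrow> \<xi> x = 0" for \<xi>
  proof -
    have "lact A \<xi> h = 0"
    proof (rule functionals_separate)
      fix \<mu> :: "'a \<Rightarrow> complex" assume \<mu>: "clinear \<mu>"
      show "\<mu> (lact A \<xi> h) = 0"
        using functional_ract[OF \<xi>(1) \<mu>, of h] \<xi>(2) bistableD(4)[OF C \<mu> h(1)] by simp
    qed
    then show ?thesis by (simp add: h(2) lact_def)
  qed
  have 2: "slice_right \<xi> t \<in> C" if "clinear \<xi>" for \<xi>
    using bistableD(3)[OF C that h(1)] by (simp add: h(2) lact_def)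
  obtain r s where "r \<in> tensor_sub {0} (UNIV :: 'a set)" "s \<in> tensor_sub C C" "t = r + s"
    using tensor_decompose[OF fd sub 1 2] by blast
  then show "t \<in> tensor_sub C C" by (simp add: tensor_sub_zero)
qed

text \<open>A simple subcoalgebra \<open>D\<close> inside the coefficient coalgebra of \<open>T\<close> meets a right translate
  of \<open>T\<close>; comparing annihilators gives mutually inverse translations, hence \<open>T \<subseteq> D\<close>.\<close>

lemma minimal_left_stable_in_coradical:
  assumes fd: "finite_dimensional TYPE('a)"
    and T: "left_stable A T" "T \<noteq> {0}"
    and minimal: "\<And>S. left_stable A S \<Longrightarrow> S \<subseteq> T \<Longrightarrow> S = {0} \<or> S = T"
  shows "T \<subseteq> coradical A"
proof -
  note Tsub = left_stableD(1)[OF T(1)]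
  define C where "C = cvec.span {ract A \<kappa> t | \<kappa> t. clinear \<kappa> \<and> t \<in> T}"
  have gen: "ract A \<kappa> t \<in> C" if "clinear \<kappa>" "t \<in> T" for \<kappa> t
    unfolding C_def using that by (intro cvec.span_base) blast
  have C: "bistable A C"
    unfolding bistable_def left_stable_def
  proof (intro conjI allI impI)
    show Csub: "cvec.subspace C" by (simp add: C_def)
    fix \<xi> :: "'a \<Rightarrow> complex" assume \<xi>: "clinear \<xi>"
    have "C \<subseteq> {h. lact A \<xi> h \<in> C}"
      unfolding C_def
      by (rule cvec.span_minimal, fold C_def)
        (use \<xi> in \<open>auto simp: lact_ract intro!: gen left_stableD(2)[OF T(1)]
           subspace_vimage clinear_lact Csub\<close>)
    then show "lact A \<xi> ` C \<subseteq> C" by blast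
    have "C \<subseteq> {h. ract A \<xi> h \<in> C}"
      unfolding C_def
      by (rule cvec.span_minimal, fold C_def)
        (auto simp: ract_ract[OF \<xi>] intro!: gen[OF clinear_functional_act(2)[OF \<xi>]]
           subspace_vimage clinear_ract[OF \<xi>] Csub)
    then show "ract A \<xi> ` C \<subseteq> C" by blast
  qed
  have "T \<subseteq> C" using gen[OF clinear_counit] by (auto simp: ract_counit)
  with T(2) have C0: "C \<noteq> {0}" using cvec.subspace_0[OF Tsub] by blast
  obtain D where D: "bistable A D \<and> D \<noteq> {0} \<and> D \<subseteq> C"
    and Dmin: "\<And>S. bistable A S \<and> S \<noteq> {0} \<and> S \<subseteq> C \<Longrightarrow> S \<subseteq> D \<Longrightarrow> S = D"
    using minimal_subspace[OF fd, of "\<lambda>D. bistable A D \<and> D \<noteq> {0} \<and> D \<subseteq> C" C] C C0 bistableD(2)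
    by (metis (no_types, lifting) order_refl)
  have simple: "simple_subcoalgebra A D"
    unfolding simple_subcoalgebra_def
    using D Dmin bistable_subcoalgebra[OF fd] subcoalgebra_bistable by (meson order_trans)
  let ?sum = "\<lambda>xs. sum_list (map (\<lambda>(\<kappa>, t). ract A \<kappa> t) xs)"
  let ?ok = "\<lambda>xs. \<forall>(\<kappa>, t) \<in> set xs. clinear \<kappa> \<and> t \<in> T"
  have rep: "\<exists>xs. ?ok xs \<and> h = ?sum xs" if "h \<in> C" for h
    using that unfolding C_def
  proof (induction h rule: cvec.span_induct_alt)
    case base
    show ?case by (rule exI[of _ "[]"]) simp
  next
    case (step c x y)
    from step.hyps obtain \<kappa> t where x: "clinear \<kappa>" "t \<in> T" "x = ract A \<kappa> t" by blast
    from step.IH obtain xs where xs: "?ok xs" "y = ?sum xs" by blast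
    have "clinear (\<lambda>z. c * \<kappa> z)" using clinear_scale_fun[OF x(1), of c] by (simp add: scaleC_complex_def)
    with x xs show ?case
      by (intro exI[of _ "(\<lambda>z. c * \<kappa> z, t) # xs"]) (auto simp: ract_fun_scale)
  qed
  \<comment> \<open>Nonzero elements of D written as sums of right translates of T. A shortest such
    expression is used like a shortest relation in the proof that characters are
    independent.\<close>
  define good where "good xs \<longleftrightarrow> ?ok xs \<and> ?sum xs \<in> D \<and> ?sum xs \<noteq> 0" for xs
  obtain h where "h \<in> D" "h \<noteq> 0" using D cvec.subspace_0[OF bistableD(2)] by blast
  with rep D have "\<exists>xs. good xs" unfolding good_def by blast
  then obtain zs where "good zs" ..
  then obtain xs where good: "good xs" and short: "\<And>ys. good ys \<Longrightarrow> length xs \<le> length ys"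
    using ex_has_least_nat[where P = good and m = length] by blast
  have xs: "?ok xs" "?sum xs \<in> D" "?sum xs \<noteq> 0" using good unfolding good_def by blast+
  obtain \<kappa>' t ys where xs_eq: "xs = (\<kappa>', t) # ys" using xs(3) by (cases xs) auto
  have ok: "clinear \<kappa>'" "t \<in> T" "?ok ys" using xs(1) by (auto simp: xs_eq)
  define d where "d = ?sum xs"
  have d: "d \<in> D" "d \<noteq> 0" using xs by (simp_all add: d_def)
  \<comment> \<open>Acting by such a \<xi> deletes the first summand and keeps the value in D, so
    minimal length makes the rest vanish.\<close>
  have lact_d: "lact A \<xi> d = 0" if \<xi>: "clinear \<xi>" "lact A \<xi> t = 0" for \<xi>
  proof -
    let ?zs = "map (\<lambda>(\<kappa>, t). (\<kappa>, lact A \<xi> t)) ys"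
    have "lact A \<xi> (?sum zs) = ?sum (map (\<lambda>(\<kappa>, t). (\<kappa>, lact A \<xi> t)) zs)" if "?ok zs" for zs
      using that by (induction zs)
        (auto simp: clinear_zero[OF clinear_lact[OF \<xi>(1)]] clinear_add[OF clinear_lact[OF \<xi>(1)]] lact_ract[OF \<xi>(1)])
    from this[OF xs(1)] have eq: "lact A \<xi> d = ?sum ?zs"
      by (simp add: d_def xs_eq \<xi>(2) clinear_zero[OF clinear_ract[OF ok(1)]])
    have "?ok ?zs" using ok(3) left_stableD(2)[OF T(1) \<xi>(1)] by auto
    moreover have "?sum ?zs \<in> D" unfolding eq[symmetric] using D d(1) \<xi>(1) bistableD(3) by blast
    moreover have "\<not> good ?zs" using short[of ?zs] by (auto simp: xs_eq)
    ultimately have "?sum ?zs = 0" unfolding good_def by blast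
    then show ?thesis using eq by simp
  qed
  have "\<xi> d = 0" if "clinear \<xi>" "lact A \<xi> t = 0" for \<xi>
  proof -
    have "\<xi> (ract A (counit A) d) = counit A (lact A \<xi> d)"
      by (rule functional_ract[OF that(1) clinear_counit])
    then show ?thesis using lact_d[OF that] clinear_zero[OF clinear_counit] by (simp add: ract_counit)
  qed
  then obtain \<mu> where \<mu>: "clinear \<mu>" "d = ract A \<mu> t" using in_ract_orbit by blast
  \<comment> \<open>Translation by \<mu> is injective on T, its kernel being a left-stable subspace
    that misses t; this gives the annihilator inclusion in the other direction.\<close>
  define K where "K = {s \<in> T. ract A \<mu> s = 0}"
  have "left_stable A K"
    unfolding left_stable_def
  proof (intro conjI allI impI)
    show "cvec.subspace K"
      using cvec.subspace_inter[OF Tsub subspace_vimage[OF clinear_ract[OF \<mu>(1)] cvec.subspace_single_0]]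
      by (simp add: K_def Int_def)
    show "lact A \<xi> ` K \<subseteq> K" if \<xi>: "clinear \<xi>" for \<xi>
      using left_stableD(2)[OF T(1) \<xi>] clinear_zero[OF clinear_lact[OF \<xi>]]
      by (auto simp: K_def lact_ract[OF \<xi> \<mu>(1), symmetric])
  qed
  moreover have "K \<subseteq> T" "t \<notin> K" using \<mu>(2) d(2) by (auto simp: K_def)
  ultimately have K: "K = {0}" using minimal ok(2) by blast
  have "\<xi> t = 0" if \<xi>: "clinear \<xi>" "lact A \<xi> d = 0" for \<xi>
  proof -
    have "lact A \<xi> t \<in> K"
      using \<xi> left_stableD(2)[OF T(1) \<xi>(1) ok(2)] by (simp add: K_def lact_ract[OF \<xi>(1) \<mu>(1), symmetric] \<mu>(2)[symmetric])
    then have "lact A \<xi> t = 0" using K by simp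
    then show ?thesis
      using functional_ract[OF \<xi>(1) clinear_counit, of t] clinear_zero[OF clinear_counit]
      by (simp add: ract_counit)
  qed
  then obtain \<nu> where "clinear \<nu>" "t = ract A \<nu> d" using in_ract_orbit by blast
  then have tD: "t \<in> D" using D d(1) bistableD(4) by blast
  have "left_stable A (T \<inter> D)"
    using cvec.subspace_inter[OF Tsub bistableD(2)] left_stableD(2)[OF T(1)] bistableD(3) D
    by (auto simp: left_stable_def)
  moreover have "t \<noteq> 0" using d(2) \<mu> clinear_zero[OF clinear_ract] by auto
  ultimately have "T \<subseteq> D" using minimal[of "T \<inter> D"] tD ok(2) by blast
  also have "D \<subseteq> \<Union>{C. simple_subcoalgebra A C}" using simple by blast
  also have "\<dots> \<subseteq> coradical A" unfolding coradical_def by (rule cvec.span_superset)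
  finally show ?thesis .
qed

end

section \<open>The coradical filtration\<close>

text \<open>The condition \<Delta>h \<in> \<open>wedge A X n\<close> \<otimes> A + A \<otimes> X,
  tested on slices. Starting from {0} shifts the usual numbering by one: the term of degree zero is
  \<open>wedge A X (Suc 0)\<close>, and index 0 serves as degree -1.\<close>

primrec wedge :: "'a::complex_vector coalg \<Rightarrow> 'a set \<Rightarrow> nat \<Rightarrow> 'a set" where
  "wedge A X 0 = {0}"
| "wedge A X (Suc n) =
     {h. \<forall>\<xi>. clinear \<xi> \<and> (\<forall>x\<in>X. \<xi> x = 0) \<longrightarrow> lact A \<xi> h \<in> wedge A X n}"

context coalgebra_loc begin

lemma subcoalgebra_left_stable:
  assumes "subcoalgebra A X" shows "left_stable A X"
  using subcoalgebra_bistable[OF assms] by (rule bistableD)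

lemma left_stable_wedge:
  assumes X: "left_stable A X" shows "left_stable A (wedge A X n)"
proof (induction n)
  case 0
  show ?case by (auto simp: left_stable_def cvec.subspace_single_0 clinear_zero[OF clinear_lact])
next
  case (Suc n)
  have "lact A \<eta> h \<in> wedge A X (Suc n)" if h: "h \<in> wedge A X (Suc n)" and \<eta>: "clinear \<eta>" for h \<eta>
  proof -
    have "lact A \<xi> (lact A \<eta> h) \<in> wedge A X n" if \<xi>: "clinear \<xi>" "\<forall>x\<in>X. \<xi> x = 0" for \<xi>
    proof -
      have "\<forall>x\<in>X. \<xi> (lact A \<eta> x) = 0" using \<xi>(2) left_stableD(2)[OF X \<eta>] by simp
      then have "lact A (\<lambda>k. \<xi> (lact A \<eta> k)) h \<in> wedge A X n"
        using h clinear_functional_act(1)[OF \<xi>(1) \<eta>] by simp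
      then show ?thesis by (simp add: lact_lact[OF \<xi>(1) \<eta>])
    qed
    then show ?thesis by simp
  qed
  moreover have "cvec.subspace (wedge A X (Suc n))"
    unfolding wedge.simps
    by (rule subspace_all) (use Suc left_stableD(1) in \<open>auto intro!: subspace_vimage[OF clinear_lact]\<close>)
  ultimately show ?case unfolding left_stable_def by blast
qed

lemma subspace_wedge: "left_stable A X \<Longrightarrow> cvec.subspace (wedge A X n)"
  by (rule left_stableD(1)[OF left_stable_wedge])

lemma wedge_Suc_subset:
  assumes X: "left_stable A X" shows "wedge A X n \<subseteq> wedge A X (Suc n)"
proof (induction n)
  case 0
  show ?case by (simp add: clinear_zero[OF clinear_lact])
next
  case (Suc n)
  then show ?case by (subst (1 2) wedge.simps) blast
qed

lemma wedge_mono: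
  assumes "left_stable A X" "m \<le> n" shows "wedge A X m \<subseteq> wedge A X n"
  using assms(2) by (rule lift_Suc_mono_le[rotated]) (rule wedge_Suc_subset[OF assms(1)])

lemma wedge_one:
  assumes X: "subcoalgebra A X" shows "wedge A X (Suc 0) = X"
proof
  note sub = bistableD(2)[OF subcoalgebra_bistable[OF X]]
  have "x \<in> wedge A X (Suc 0)" if x: "x \<in> X" for x
  proof -
    have "comult A x \<in> tensor_sub X X" using X x by (auto simp: subcoalgebra_def)
    then show ?thesis by (auto simp: lact_def intro: slice_right_vanish)
  qed
  then show "X \<subseteq> wedge A X (Suc 0)" by blast
  show "wedge A X (Suc 0) \<subseteq> X"
  proof
    fix h assume h: "h \<in> wedge A X (Suc 0)"
    show "h \<in> X"
    proof (rule ccontr)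
      assume "h \<notin> X"
      then obtain \<xi> :: "'a \<Rightarrow> complex" where \<xi>: "clinear \<xi>" "\<And>x. x \<in> X \<Longrightarrow> \<xi> x = 0" "\<xi> h = 1"
        using separating_functional[OF sub] by metis
      then have "lact A \<xi> h = 0" using h by simp
      then have "counit A (lact A \<xi> h) = 0" by (simp add: clinear_zero[OF clinear_counit])
      then have "\<xi> (ract A (counit A) h) = 0"
        by (simp add: functional_ract[OF \<xi>(1) clinear_counit])
      then show False using \<xi>(3) by (simp add: ract_counit)
    qed
  qed
qed

text \<open>By dimension the filtration stops at some F. If F were proper, a left-stable M minimal
  above F would have a simple quotient M/F. Translation by a functional vanishing on F factors
  through M/F, so its image is zero or minimal left-stable and lies in the coradical; this puts M
  into the next term, which is F.\<close>

lemma wedge_coradical_exhaustive: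
  assumes fd: "finite_dimensional TYPE('a)"
    and X: "subcoalgebra A (coradical A)"
  obtains n where "wedge A (coradical A) n = UNIV"
proof -
  let ?X = "coradical A"
  note ls = subcoalgebra_left_stable[OF X]
  obtain Bs where "finite_dimensional_vector_space (scaleC :: complex \<Rightarrow> 'a \<Rightarrow> 'a) Bs"
    using finite_dimensional_locale[OF fd] .
  then interpret fd: finite_dimensional_vector_space "scaleC :: complex \<Rightarrow> 'a \<Rightarrow> 'a" Bs .
  have "\<exists>n. wedge A ?X n = wedge A ?X (Suc n)"
  proof (rule ccontr)
    assume "\<nexists>n. wedge A ?X n = wedge A ?X (Suc n)"
    then have "cvec.dim (wedge A ?X n) < cvec.dim (wedge A ?X (Suc n))" for n
      using fd.subspace_dim_equal[OF subspace_wedge[OF ls] subspace_wedge[OF ls] wedge_Suc_subset[OF ls]]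
      by (metis not_le)
    then have "strict_mono (\<lambda>n. cvec.dim (wedge A ?X n))" by (simp add: strict_mono_Suc_iff)
    then have "n \<le> cvec.dim (wedge A ?X n)" for n by (rule strict_mono_imp_increasing)
    from this[of "Suc fd.dimension"] show False
      using fd.dim_subset_UNIV[of "wedge A ?X (Suc fd.dimension)"] by simp
  qed
  then obtain n where n: "wedge A ?X (Suc n) = wedge A ?X n" by metis
  define F where "F = wedge A ?X n"
  have F: "left_stable A F" unfolding F_def by (rule left_stable_wedge[OF ls])
  note Fsub = left_stableD(1)[OF F]
  have "F = UNIV"
  proof (rule ccontr)
    assume "F \<noteq> UNIV"
    moreover have "left_stable A UNIV" by (simp add: left_stable_def)
    ultimately have "left_stable A UNIV \<and> F \<subset> UNIV" by blast
    from minimal_subspace[OF fd, where P = "\<lambda>M. left_stable A M \<and> F \<subset> M", OF this]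
    obtain M where M: "left_stable A M \<and> F \<subset> M"
      and Mmin: "\<And>S. left_stable A S \<and> F \<subset> S \<Longrightarrow> S \<subseteq> M \<Longrightarrow> S = M"
      using left_stableD(1) by blast
    note Msub = left_stableD(1)[OF conjunct1[OF M]]
    have in_X: "ract A \<kappa> m \<in> ?X" if \<kappa>: "clinear \<kappa>" "\<And>x. x \<in> F \<Longrightarrow> \<kappa> x = 0" and m: "m \<in> M" for \<kappa> m
    proof (cases "ract A \<kappa> ` M = {0}")
      case True
      then have "ract A \<kappa> m = 0" using m by blast
      then show ?thesis using cvec.subspace_0[OF left_stableD(1)[OF ls]] by simp
    next
      case False
      have F0: "ract A \<kappa> x = 0" if "x \<in> F" for x
      proof (rule functionals_separate)
        fix \<xi> :: "'a \<Rightarrow> complex" assume \<xi>: "clinear \<xi>"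
        show "\<xi> (ract A \<kappa> x) = 0"
          using functional_ract[OF \<xi> \<kappa>(1), of x] \<kappa>(2) left_stableD(2)[OF F \<xi> that] by simp
      qed
      have "ract A \<kappa> ` M \<subseteq> ?X"
      proof (rule minimal_left_stable_in_coradical[OF fd _ False])
        show "left_stable A (ract A \<kappa> ` M)"
          unfolding left_stable_def
        proof (intro conjI allI impI)
          show "cvec.subspace (ract A \<kappa> ` M)" by (rule subspace_image[OF clinear_ract[OF \<kappa>(1)] Msub])
          show "lact A \<xi> ` ract A \<kappa> ` M \<subseteq> ract A \<kappa> ` M" if "clinear \<xi>" for \<xi>
            using left_stableD(2)[OF conjunct1[OF M] that] by (auto simp: lact_ract[OF that \<kappa>(1)])
        qed
        fix S assume S: "left_stable A S" "S \<subseteq> ract A \<kappa> ` M"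
        define N where "N = {m \<in> M. ract A \<kappa> m \<in> S}"
        have "left_stable A N"
          unfolding left_stable_def
        proof (intro conjI allI impI)
          show "cvec.subspace N"
            using cvec.subspace_inter[OF Msub subspace_vimage[OF clinear_ract[OF \<kappa>(1)] left_stableD(1)[OF S(1)]]]
            by (simp add: N_def Int_def)
          show "lact A \<xi> ` N \<subseteq> N" if "clinear \<xi>" for \<xi>
            using left_stableD(2)[OF conjunct1[OF M] that] left_stableD(2)[OF S(1) that]
            by (auto simp: N_def lact_ract[OF that \<kappa>(1), symmetric])
        qed
        moreover have "F \<subseteq> N"
          using M cvec.subspace_0[OF left_stableD(1)[OF S(1)]] by (auto simp: N_def F0)
        ultimately have N: "N = F \<or> N = M" using Mmin[of N] unfolding N_def by blast
        show "S = {0} \<or> S = ract A \<kappa> ` M"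
        proof (cases "N = M")
          case True
          then show ?thesis using S(2) by (auto simp: N_def)
        next
          case False
          with N have NF: "N = F" by simp
          have "s = 0" if s: "s \<in> S" for s
          proof -
            obtain m where "m \<in> M" "s = ract A \<kappa> m" using S(2) s by blast
            with s NF have "m \<in> F" by (auto simp: N_def)
            then show ?thesis using F0 \<open>s = ract A \<kappa> m\<close> by simp
          qed
          then show ?thesis using cvec.subspace_0[OF left_stableD(1)[OF S(1)]] by blast
        qed
      qed
      then show ?thesis using m by blast
    qed
    have "m \<in> wedge A ?X (Suc n)" if m: "m \<in> M" for m
    proof -
      have "lact A \<xi> m \<in> F" if \<xi>: "clinear \<xi>" "\<forall>x\<in>?X. \<xi> x = 0" for \<xi>
      proof (rule ccontr)
        assume "lact A \<xi> m \<notin> F"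
        then obtain \<kappa> :: "'a \<Rightarrow> complex"
          where \<kappa>: "clinear \<kappa>" "\<And>x. x \<in> F \<Longrightarrow> \<kappa> x = 0" "\<kappa> (lact A \<xi> m) = 1"
          using separating_functional[OF Fsub] by metis
        have "\<xi> (ract A \<kappa> m) = 0" using \<xi>(2) in_X[OF \<kappa>(1,2) m] by blast
        then show False using functional_ract[OF \<xi>(1) \<kappa>(1), of m] \<kappa>(3) by simp
      qed
      then show ?thesis by (simp add: F_def)
    qed
    then have "M \<subseteq> F" unfolding F_def n by blast
    with M show False by blast
  qed
  then show thesis using that unfolding F_def by blast
qed

end

section \<open>Filtrations of bialgebras\<close>

text \<open>X is a subbialgebra and not necessarily the coradical, so that the results apply to the
  given Hopf algebra and to its untwisted form with the same X.\<close>

locale fd_bialgebra =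
  fixes A :: "'a::complex_algebra_1 coalg" and X :: "'a set"
  assumes bialgebra: "bialgebra A"
    and fd: "finite_dimensional TYPE('a)"
    and X: "subcoalgebra A X" and one_X: "1 \<in> X"
    and mult_X: "\<And>x y. x \<in> X \<Longrightarrow> y \<in> X \<Longrightarrow> x * y \<in> X"
begin

sublocale coalgebra_loc A
  using bialgebra by unfold_locales (simp add: bialgebra_def)

lemma comult_one: "comult A 1 = 1" and comult_mult: "comult A (a * b) = comult A a * comult A b"
  using bialgebra by (simp_all add: bialgebra_def)

lemmas left_stable_X = subcoalgebra_left_stable[OF X]
  and wedge_X = wedge_one[OF X]

lemmas subspace_X = left_stableD(1)[OF left_stable_X]
  and subspace_E = subspace_wedge[OF left_stable_X]
  and E_mono = wedge_mono[OF left_stable_X]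

lemma comult_wedge:
  assumes h: "h \<in> wedge A X (Suc n)"
  obtains r s where "r \<in> tensor_sub (wedge A X n) UNIV" "s \<in> tensor_sub (wedge A X (Suc n)) X"
    "comult A h = r + s"
proof -
  have 1: "slice_right \<xi> (comult A h) \<in> wedge A X n" if "clinear \<xi>" "\<And>x. x \<in> X \<Longrightarrow> \<xi> x = 0" for \<xi>
    using h that by (simp add: lact_def)
  have 2: "slice_right \<xi> (comult A h) \<in> wedge A X (Suc n)" if "clinear \<xi>" for \<xi>
    using left_stableD(2)[OF left_stable_wedge[OF left_stable_X] that h] by (simp only: lact_def)
  show thesis by (rule tensor_decompose[OF fd subspace_X 1 2 that])
qed

lemma comult_wedge_left:
  assumes "h \<in> wedge A X n" shows "comult A h \<in> tensor_sub (wedge A X n) UNIV"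
proof (cases n)
  case 0
  then show ?thesis using assms cvec.subspace_0[OF subspace_tensor_sub]
    by (simp add: clinear_zero[OF clinear_comult])
next
  case (Suc m)
  obtain r s where rs: "r \<in> tensor_sub (wedge A X m) UNIV" "s \<in> tensor_sub (wedge A X n) X"
    "comult A h = r + s"
    using comult_wedge[of h m] assms Suc by metis
  have "tensor_sub (wedge A X m) UNIV \<subseteq> tensor_sub (wedge A X n) (UNIV :: 'a set)"
    "tensor_sub (wedge A X n) X \<subseteq> tensor_sub (wedge A X n) (UNIV :: 'a set)"
    by (rule tensor_sub_mono; use E_mono[of m n] Suc in simp)+
  then show ?thesis unfolding rs(3) using rs(1,2) cvec.subspace_add[OF subspace_tensor_sub] by blast
qed

text \<open>The - 1 comes from the shifted numbering, and truncated subtraction is harmless because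
  an index 0 forces a zero factor. In \<Delta>(a b) the only product whose left leg is not of lower
  degree is \<open>s * s'\<close>; its right leg lies in X, where the tested functionals
  vanish.\<close>

lemma wedge_mult:
  "a \<in> wedge A X i \<Longrightarrow> b \<in> wedge A X j \<Longrightarrow> a * b \<in> wedge A X (i + j - 1)"
proof (induction "i + j" arbitrary: i j a b rule: less_induct)
  case less
  note zero = cvec.subspace_0[OF subspace_E]
  show ?case
  proof (cases "i = 0 \<or> j = 0")
    case True
    then show ?thesis using less.prems zero by auto
  next
    case False
    then obtain i' j' where ij: "i = Suc i'" "j = Suc j'" by (metis not0_implies_Suc)
    have IH1: "u * v \<in> wedge A X (i' + j')" if "u \<in> wedge A X i'" "v \<in> wedge A X j" for u v
      using less.hyps[of i' j] that by (simp add: ij)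
    have IH2: "u * v \<in> wedge A X (i' + j')" if "u \<in> wedge A X i" "v \<in> wedge A X j'" for u v
      using less.hyps[of i j'] that by (simp add: ij)
    obtain r s where rs: "r \<in> tensor_sub (wedge A X i') UNIV" "s \<in> tensor_sub (wedge A X i) X"
      "comult A a = r + s"
      using comult_wedge[of a i'] less.prems(1) ij by metis
    obtain r' s' where rs': "r' \<in> tensor_sub (wedge A X j') UNIV" "s' \<in> tensor_sub (wedge A X j) X"
      "comult A b = r' + s'"
      using comult_wedge[of b j'] less.prems(2) ij by metis
    have eq: "comult A (a * b) = r * comult A b + s * r' + s * s'"
      unfolding comult_mult rs(3) rs'(3) by (simp add: algebra_simps)
    have "lact A \<xi> (a * b) \<in> wedge A X (i' + j')" if \<xi>: "clinear \<xi>" "\<forall>x\<in>X. \<xi> x = 0" for \<xi>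
    proof -
      have "r * comult A b \<in> tensor_sub (wedge A X (i' + j')) UNIV"
        by (rule tensor_sub_mult[OF rs(1) comult_wedge_left[OF less.prems(2)]]) (simp_all add: IH1)
      then have 1: "slice_right \<xi> (r * comult A b) \<in> wedge A X (i' + j')"
        by (rule slice_right_tensor_sub[OF _ \<xi>(1) subspace_E])
      have "s * r' \<in> tensor_sub (wedge A X (i' + j')) UNIV"
        by (rule tensor_sub_mult[OF rs(2) rs'(1)]) (simp_all add: IH2)
      then have 2: "slice_right \<xi> (s * r') \<in> wedge A X (i' + j')"
        by (rule slice_right_tensor_sub[OF _ \<xi>(1) subspace_E])
      have "s * s' \<in> tensor_sub UNIV X"
        by (rule tensor_sub_mult[OF rs(2) rs'(2)]) (simp_all add: mult_X)
      then have 3: "slice_right \<xi> (s * s') = 0"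
        by (rule slice_right_vanish[OF _ \<xi>(1)]) (use \<xi>(2) in simp)
      show ?thesis
        using 1 2 3 cvec.subspace_add[OF subspace_E]
        by (simp add: lact_def eq clinear_add[OF clinear_slice(2)[OF \<xi>(1)]])
    qed
    then show ?thesis by (simp add: ij)
  qed
qed

lemma wedge_X_mult:
  assumes "x \<in> X" "h \<in> wedge A X n"
  shows "x * h \<in> wedge A X n" "h * x \<in> wedge A X n"
  using wedge_mult[of x "Suc 0" h n] wedge_mult[of h n x "Suc 0"] assms
  by (simp_all del: wedge.simps add: wedge_X)

text \<open>Multiplying by tensors with both legs in X preserves both \<open>wedge A X n\<close>
  \<otimes> A and A \<otimes> X. One inclusion suffices to carry exhaustiveness over.\<close>

lemma wedge_twist:
  assumes JK: "J \<in> tensor_sub X X" "K \<in> tensor_sub X X"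
    and A': "\<And>h. comult A' h = K * comult A h * J"
  shows "wedge A X n \<subseteq> wedge A' X n"
proof (induction n)
  case (Suc n)
  have "lact A' \<xi> h \<in> wedge A X n"
    if h: "h \<in> wedge A X (Suc n)" and \<xi>: "clinear \<xi>" "\<forall>x\<in>X. \<xi> x = 0" for h \<xi>
  proof -
    obtain r s where rs: "r \<in> tensor_sub (wedge A X n) UNIV" "s \<in> tensor_sub (wedge A X (Suc n)) X"
      "comult A h = r + s"
      using comult_wedge[OF h] .
    have "K * r \<in> tensor_sub (wedge A X n) UNIV"
      by (rule tensor_sub_mult[OF JK(2) rs(1)]) (simp_all add: wedge_X_mult)
    then have "K * r * J \<in> tensor_sub (wedge A X n) UNIV"
      by (rule tensor_sub_mult[OF _ JK(1)]) (simp_all add: wedge_X_mult)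
    then have 1: "slice_right \<xi> (K * r * J) \<in> wedge A X n"
      by (rule slice_right_tensor_sub[OF _ \<xi>(1) subspace_E])
    have "K * s \<in> tensor_sub UNIV X"
      by (rule tensor_sub_mult[OF JK(2) rs(2)]) (simp_all add: mult_X)
    then have "K * s * J \<in> tensor_sub UNIV X"
      by (rule tensor_sub_mult[OF _ JK(1)]) (simp_all add: mult_X)
    then have 2: "slice_right \<xi> (K * s * J) = 0"
      by (rule slice_right_vanish[OF _ \<xi>(1)]) (use \<xi>(2) in simp)
    show ?thesis
      using 1 2 by (simp add: lact_def A' rs(3) distrib_left distrib_right clinear_add[OF clinear_slice(2)[OF \<xi>(1)]])
  qed
  with Suc show ?case unfolding wedge.simps by blast
qed simp

end

section \<open>Undoing a twist\<close>

lemma tensor_mult_hom: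
  fixes F :: "('a::complex_algebra_1, 'b::complex_algebra_1) tensor \<Rightarrow> 'c::complex_algebra_1"
  assumes F: "clinear F"
    and tens: "\<And>a b c d. F ((a \<boxtimes> b) * (c \<boxtimes> d)) = F (a \<boxtimes> b) * F (c \<boxtimes> d)"
  shows "F (s * t) = F s * F t"
proof (rule clinear_eq_on_tens[where f = "\<lambda>s. F (s * t)"])
  show "clinear (\<lambda>s. F (s * t))" by (rule clinear_comp[OF F clinear_mult(1)])
  show "clinear (\<lambda>s. F s * F t)" by (rule clinear_comp[OF clinear_mult(1) F])
  fix a b
  show "F ((a \<boxtimes> b) * t) = F (a \<boxtimes> b) * F t"
    by (rule clinear_eq_on_tens[where f = "\<lambda>t. F ((a \<boxtimes> b) * t)"])
      (rule clinear_comp[OF F clinear_mult(2)], rule clinear_comp[OF clinear_mult(2) F], rule tens)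
qed

lemma tmap_mult:
  assumes f: "clinear f" "\<And>x y. f (x * y) = f x * f y" and g: "clinear g" "\<And>x y. g (x * y) = g x * g y"
  shows "tmap f g (s * t) = tmap f g s * tmap f g t"
  by (rule tensor_mult_hom) (simp_all add: clinear_tmap tmap_tens tens_times f g)

lemma tmap_one: "clinear f \<Longrightarrow> clinear g \<Longrightarrow> f 1 = 1 \<Longrightarrow> g 1 = 1 \<Longrightarrow> tmap f g 1 = 1"
  by (simp add: one_tensor_def tmap_tens)

lemma tassoc_mult: "tassoc (s * t) = tassoc s * tassoc t"
  for s t :: "(('a::complex_algebra_1, 'b::complex_algebra_1) tensor, 'c::complex_algebra_1) tensor"
proof (rule tensor_mult_hom[OF clinear_tassoc])
  fix u v :: "('a, 'b) tensor" and c d :: 'c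
  have lin: "clinear (\<lambda>u. tassoc ((u * v) \<boxtimes> (c * d)))" "clinear (\<lambda>u. tassoc (u \<boxtimes> c) * tassoc (v \<boxtimes> d))"
    for v :: "('a, 'b) tensor"
    by (rule clinear_comp[OF clinear_tassoc clinear_comp[OF clinear_tens(1) clinear_mult(1)]])
      (rule clinear_comp[OF clinear_mult(1) clinear_comp[OF clinear_tassoc clinear_tens(1)]])
  have lin': "clinear (\<lambda>v. tassoc ((u * v) \<boxtimes> (c * d)))" "clinear (\<lambda>v. tassoc (u \<boxtimes> c) * tassoc (v \<boxtimes> d))"
    for u :: "('a, 'b) tensor"
    by (rule clinear_comp[OF clinear_tassoc clinear_comp[OF clinear_tens(1) clinear_mult(2)]])
      (rule clinear_comp[OF clinear_mult(2) clinear_comp[OF clinear_tassoc clinear_tens(1)]])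
  have "tassoc ((u * v) \<boxtimes> (c * d)) = tassoc (u \<boxtimes> c) * tassoc (v \<boxtimes> d)"
    by (rule clinear_eq_on_tens[OF lin], rule clinear_eq_on_tens[OF lin']) (simp add: tens_times tassoc_tens)
  then show "tassoc ((u \<boxtimes> c) * (v \<boxtimes> d)) = tassoc (u \<boxtimes> c) * tassoc (v \<boxtimes> d)"
    by (simp add: tens_times)
qed

lemma tassoc_tmap:
  assumes f: "clinear f" and g: "clinear g" and h: "clinear h"
  shows "tassoc (tmap (tmap f g) h t) = tmap f (tmap g h) (tassoc t)"
proof (rule clinear_eq_on_tens[where f = "\<lambda>t. tassoc (tmap (tmap f g) h t)"])
  note fg = clinear_tmap[OF f g] and gh = clinear_tmap[OF g h]
  note l = clinear_comp[OF clinear_tassoc clinear_tmap[OF fg h]]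
    and r = clinear_comp[OF clinear_tmap[OF f gh] clinear_tassoc]
  show "clinear (\<lambda>t. tassoc (tmap (tmap f g) h t))" by (rule l)
  show "clinear (\<lambda>t. tmap f (tmap g h) (tassoc t))" by (rule r)
  fix s c
  show "tassoc (tmap (tmap f g) h (s \<boxtimes> c)) = tmap f (tmap g h) (tassoc (s \<boxtimes> c))"
    by (rule clinear_eq_on_tens[OF clinear_comp[OF l clinear_tens(1)] clinear_comp[OF r clinear_tens(1)]])
      (simp add: tmap_tens f g h fg gh tassoc_tens)
qed

text \<open>Coassociativity has to hold on all of A, not only on the image of f, and it rests on a
  cocycle identity for the inverse twist. The identity for J acquires the opposite order of factors
  when \<open>comult B\<close> is replaced by \<open>comult A\<close>; inverting both sides then
  gives the identity for K.\<close>

lemma bialgebra_untwist: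
  fixes A :: "'a::complex_algebra_1 coalg" and B :: "'b::complex_algebra_1 coalg"
  assumes A: "bialgebra A" and B: "clinear (comult B)" "clinear (counit B)"
    and J: "(1 \<boxtimes> J) * tmap id (comult B) J = tassoc ((J \<boxtimes> 1) * tmap (comult B) id J)"
      "slice_left (counit B) J = 1" "slice_right (counit B) J = 1"
    and K: "J * K = 1" "K * J = 1"
    and f: "clinear f" "f 1 = 1" "\<And>a b. f (a * b) = f a * f b"
      "\<And>b. comult A (f b) = tmap f f (J * comult B b * K)" "\<And>b. counit A (f b) = counit B b"
  defines "A' \<equiv> \<lparr>comult = (\<lambda>h. tmap f f K * comult A h * tmap f f J), counit = counit A\<rparr>"
  shows "bialgebra A'" and "comult A' (f b) = tmap f f (comult B b)"
proof -
  interpret A: coalgebra_loc A using A by unfold_locales (simp add: bialgebra_def)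
  let ?J = "tmap f f J" and ?K = "tmap f f K" and ?F = "tmap f (tmap f f)"
  let ?D = "comult A" and ?D' = "comult A'" and ?E = "counit A"
  have ops: "?D' h = ?K * ?D h * ?J" "counit A' = ?E" for h by (simp_all add: A'_def)
  note D = A.clinear_comult and E = A.clinear_counit
  have Dm: "?D (a * b) = ?D a * ?D b" "?E (a * b) = ?E a * ?E b" "?D 1 = 1" "?E 1 = 1" for a b
    using A by (simp_all add: bialgebra_def)
  note ffm = tmap_mult[OF f(1,3) f(1,3)] and ff1 = tmap_one[OF f(1,1,2,2)] and ff = clinear_tmap[OF f(1,1)]
  have JK: "?J * ?K = 1" "?K * ?J = 1" by (simp_all add: ffm[symmetric] K ff1)
  have "?D' (f b) = (?K * ?J) * tmap f f (comult B b) * (?K * ?J)" for b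
    by (simp only: ops f(4) ffm mult.assoc)
  then show D'f: "?D' (f b) = tmap f f (comult B b)" for b by (simp add: JK)
  have D': "clinear ?D'"
    unfolding A'_def coalg.simps
    by (rule clinear_comp[OF clinear_mult(1) clinear_comp[OF clinear_mult(2) D]])
  have D1: "tmap ?D id (s * t) = tmap ?D id s * tmap ?D id t" for s t
    by (rule tmap_mult[OF D Dm(1) clinear_id'(1)]) simp
  have D2: "tmap id ?D (s * t) = tmap id ?D s * tmap id ?D t" for s t
    by (rule tmap_mult[OF clinear_id'(1) _ D Dm(1)]) simp
  have D'1: "tmap ?D' id t = (?K \<boxtimes> 1) * tmap ?D id t * (?J \<boxtimes> 1)" for t
    by (rule clinear_eq_on_tens[OF clinear_tmap[OF D' clinear_id'(1)]
          clinear_comp[OF clinear_mult(1) clinear_comp[OF clinear_mult(2) clinear_tmap[OF D clinear_id'(1)]]]])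
      (simp add: tmap_tens D D' clinear_id' tens_times ops)
  have D'2: "tmap id ?D' t = (1 \<boxtimes> ?K) * tmap id ?D t * (1 \<boxtimes> ?J)" for t
    by (rule clinear_eq_on_tens[OF clinear_tmap[OF clinear_id'(1) D']
          clinear_comp[OF clinear_mult(1) clinear_comp[OF clinear_mult(2) clinear_tmap[OF clinear_id'(1) D]]]])
      (simp add: tmap_tens D D' clinear_id' tens_times ops)
  have DfJ: "?D (f b) * ?J = ?J * tmap f f (comult B b)" for b
  proof -
    have "?D (f b) * ?J = ?J * tmap f f (comult B b) * (?K * ?J)"
      by (simp only: f(4) ffm mult.assoc)
    then show ?thesis by (simp add: JK)
  qed
  have ffbig: "tmap (tmap f f) f (s * t) = tmap (tmap f f) f s * tmap (tmap f f) f t"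
    "?F (s' * t') = ?F s' * ?F t'" for s t s' t'
    by (rule tmap_mult; simp add: ff f ffm)+
  have P1: "tmap ?D id (tmap f f t) * (?J \<boxtimes> 1) = tmap (tmap f f) f ((J \<boxtimes> 1) * tmap (comult B) id t)" for t
    unfolding ffbig
    by (rule clinear_eq_on_tens[OF
          clinear_comp[OF clinear_mult(1) clinear_comp[OF clinear_tmap[OF D clinear_id'(1)] ff]]
          clinear_comp[OF clinear_mult(2) clinear_comp[OF clinear_tmap[OF ff f(1)] clinear_tmap[OF B(1) clinear_id'(1)]]]])
      (simp add: tmap_tens D clinear_id' f(1,2) B ff tens_times DfJ)
  have P2: "tmap id ?D (tmap f f t) * (1 \<boxtimes> ?J) = ?F ((1 \<boxtimes> J) * tmap id (comult B) t)" for t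
    unfolding ffbig
    by (rule clinear_eq_on_tens[OF
          clinear_comp[OF clinear_mult(1) clinear_comp[OF clinear_tmap[OF clinear_id'(1) D] ff]]
          clinear_comp[OF clinear_mult(2) clinear_comp[OF clinear_tmap[OF f(1) ff] clinear_tmap[OF clinear_id'(1) B(1)]]]])
      (simp add: tmap_tens D clinear_id' f(1,2) B ff tens_times DfJ)
  define P where "P = tmap id ?D ?J * (1 \<boxtimes> ?J)"
  have P: "tassoc (tmap ?D id ?J * (?J \<boxtimes> 1)) = P"
    unfolding P_def P1 P2 by (simp only: tassoc_tmap[OF f(1,1,1)] J(1))
  have one3: "tassoc 1 = (1 :: ('a, ('a, 'a) tensor) tensor)"
    by (simp add: one_tensor_def tassoc_tens)
  \<comment> \<open>\<open>Q1\<close> is a left inverse and \<open>Q2\<close> a right inverse of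
    \<open>P\<close>, so they agree; this is the cocycle identity of the inverse twist.\<close>
  define Q1 where "Q1 = tassoc ((?K \<boxtimes> 1) * tmap ?D id ?K)"
  define Q2 where "Q2 = (1 \<boxtimes> ?K) * tmap id ?D ?K"
  have "Q1 * P = tassoc ((?K \<boxtimes> 1) * (tmap ?D id ?K * tmap ?D id ?J) * (?J \<boxtimes> 1))"
    unfolding Q1_def P[symmetric] tassoc_mult[symmetric] by (simp only: mult.assoc)
  also have "\<dots> = 1"
    unfolding D1[symmetric] JK
    by (simp add: tmap_one D clinear_id' Dm tens_times JK one3 flip: one_tensor_def)
  finally have Q1P: "Q1 * P = 1" .
  have "P * Q2 = tmap id ?D ?J * ((1 \<boxtimes> ?J) * (1 \<boxtimes> ?K)) * tmap id ?D ?K"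
    unfolding P_def Q2_def by (simp only: mult.assoc)
  also have "\<dots> = tmap id ?D (?J * ?K)"
    unfolding D2 by (simp add: tens_times JK flip: one_tensor_def)
  also have "\<dots> = 1" unfolding JK by (simp add: tmap_one D clinear_id' Dm)
  finally have PQ2: "P * Q2 = 1" .
  have "Q1 = Q1 * (P * Q2)" by (simp add: PQ2)
  also have "\<dots> = Q2" by (simp add: Q1P flip: mult.assoc)
  finally have Q: "Q1 = Q2" .
  have coassoc: "tassoc (tmap ?D' id (?D' a)) = tmap id ?D' (?D' a)" for a
  proof -
    have "tassoc (tmap ?D' id (?D' a)) =
        tassoc (((?K \<boxtimes> 1) * tmap ?D id ?K) * tmap ?D id (?D a) * (tmap ?D id ?J * (?J \<boxtimes> 1)))"
      unfolding D'1 ops D1 by (simp only: mult.assoc)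
    also have "\<dots> = Q1 * tmap id ?D (?D a) * P"
      by (simp only: tassoc_mult[of _ "tmap ?D id ?J * (?J \<boxtimes> 1)"] tassoc_mult[of "(?K \<boxtimes> 1) * tmap ?D id ?K"]
          P A.coassoc Q1_def)
    also have "\<dots> = tmap id ?D' (?D' a)"
      unfolding Q unfolding Q2_def P_def D'2 ops D2 by (simp only: mult.assoc)
    finally show ?thesis .
  qed
  have slm: "slice_left ?E (s * t) = slice_left ?E s * slice_left ?E t" for s t :: "('a, 'a) tensor"
    by (rule tensor_mult_hom)
      (simp_all add: clinear_slice E tens_times Dm mult_scaleC_left mult_scaleC_right scaleC_scaleC mult.commute)
  have srm: "slice_right ?E (s * t) = slice_right ?E s * slice_right ?E t" for s t :: "('a, 'a) tensor"
    by (rule tensor_mult_hom)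
      (simp_all add: clinear_slice E tens_times Dm mult_scaleC_left mult_scaleC_right scaleC_scaleC mult.commute)
  have slf: "slice_left ?E (tmap f f t) = f (slice_left (counit B) t)" for t
    by (rule clinear_eq_on_tens[OF clinear_comp[OF clinear_slice(1)[OF E] ff]
          clinear_comp[OF f(1) clinear_slice(1)[OF B(2)]]])
      (simp add: tmap_tens f E B clinear_scale[OF f(1)])
  have srf: "slice_right ?E (tmap f f t) = f (slice_right (counit B) t)" for t
    by (rule clinear_eq_on_tens[OF clinear_comp[OF clinear_slice(2)[OF E] ff]
          clinear_comp[OF f(1) clinear_slice(2)[OF B(2)]]])
      (simp add: tmap_tens f E B clinear_scale[OF f(1)])
  have one: "slice_left ?E 1 = (1::'a)" "slice_right ?E 1 = (1::'a)"
    by (simp_all add: one_tensor_def E Dm)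
  have J1: "slice_left ?E ?J = 1" "slice_right ?E ?J = 1" by (simp_all add: slf srf J f)
  have K1: "slice_left ?E ?K = 1" "slice_right ?E ?K = 1"
    using slm[of ?K ?J] srm[of ?K ?J] by (simp_all add: JK J1 one)
  have counit: "slice_left ?E (?D' a) = a" "slice_right ?E (?D' a) = a" for a
    using A.ract_counit[of a] A.lact_counit[of a]
    by (simp_all add: ops slm srm J1 K1 ract_def lact_def)
  have "?D' (a * b) = ?D' a * ?D' b" for a b
  proof -
    have "?D' a * ?D' b = ?K * ?D a * (?J * ?K) * ?D b * ?J" by (simp only: ops mult.assoc)
    then show ?thesis by (simp add: JK ops Dm mult.assoc)
  qed
  moreover have "?D' 1 = 1" by (simp add: ops Dm JK)
  ultimately show "bialgebra A'"
    using coassoc counit D' E Dm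
    by (simp add: bialgebra_def coalgebra_def ops(2) slice_left_def slice_right_def)
qed

section \<open>Skew-primitive elements\<close>

context coalgebra_loc begin

lemma comult_lact:
  assumes \<xi>: "clinear \<xi>" shows "comult A (lact A \<xi> h) = tmap id (lact A \<xi>) (comult A h)"
proof -
  let ?\<Psi> = "tmap id (slice_right \<xi>) :: ('a, ('a, 'a) tensor) tensor \<Rightarrow> ('a, 'a) tensor"
  note \<Psi> = clinear_tmap[OF clinear_id'(1) clinear_slice(2)[OF \<xi>]]
  have \<Psi>_tens: "?\<Psi> (a \<boxtimes> s) = a \<boxtimes> slice_right \<xi> s" for a s
    by (simp add: tmap_tens clinear_id' clinear_slice \<xi>)
  have s: "?\<Psi> (tassoc (s \<boxtimes> c)) = \<xi> c *\<^sub>C s" for s c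
    by (rule clinear_eq_on_tens[OF clinear_comp[OF \<Psi> clinear_comp[OF clinear_tassoc clinear_tens(1)]]
          clinear_scale_fun[OF clinear_id'(2)]])
      (simp add: tassoc_tens \<Psi>_tens \<xi> tens_scale_right)
  have 1: "?\<Psi> (tassoc (tmap (comult A) id t)) = comult A (slice_right \<xi> t)" for t
    by (rule clinear_eq_on_tens[OF
          clinear_comp[OF \<Psi> clinear_comp[OF clinear_tassoc clinear_tmap[OF clinear_comult clinear_id'(1)]]]
          clinear_comp[OF clinear_comult clinear_slice(2)[OF \<xi>]]])
      (simp add: tmap_tens clinear_comult clinear_id' s \<xi> clinear_scale[OF clinear_comult])
  have 2: "?\<Psi> (tmap id (comult A) t) = tmap id (lact A \<xi>) t" for t
    by (rule clinear_eq_on_tens[OF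
          clinear_comp[OF \<Psi> clinear_tmap[OF clinear_id'(1) clinear_comult]]
          clinear_tmap[OF clinear_id'(1) clinear_lact[OF \<xi>]]])
      (simp add: tmap_tens clinear_comult clinear_id' clinear_lact \<xi> \<Psi>_tens, simp add: lact_def)
  have "comult A (lact A \<xi> h) = ?\<Psi> (tassoc (tmap (comult A) id (comult A h)))"
    unfolding 1 by (simp only: lact_def)
  then show ?thesis by (simp only: coassoc 2)
qed

lemma comult_ract:
  assumes \<xi>: "clinear \<xi>" shows "comult A (ract A \<xi> h) = tmap (ract A \<xi>) id (comult A h)"
proof -
  let ?\<Psi> = "slice_left \<xi> :: ('a, ('a, 'a) tensor) tensor \<Rightarrow> ('a, 'a) tensor"
  note \<Psi> = clinear_slice(1)[OF \<xi>]
  have s: "?\<Psi> (tassoc (s \<boxtimes> c)) = slice_left \<xi> s \<boxtimes> c" for s :: "('a, 'a) tensor" and c :: 'a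
    by (rule clinear_eq_on_tens[OF clinear_comp[OF \<Psi> clinear_comp[OF clinear_tassoc clinear_tens(1)]]
          clinear_comp[OF clinear_tens(1) clinear_slice(1)[OF \<xi>]]])
      (simp add: tassoc_tens \<xi> tens_scale_left)
  have 1: "?\<Psi> (tassoc (tmap (comult A) id t)) = tmap (ract A \<xi>) id t" for t
    by (rule clinear_eq_on_tens[OF
          clinear_comp[OF \<Psi> clinear_comp[OF clinear_tassoc clinear_tmap[OF clinear_comult clinear_id'(1)]]]
          clinear_tmap[OF clinear_ract[OF \<xi>] clinear_id'(1)]])
      (simp add: tmap_tens clinear_comult clinear_id' s clinear_ract \<xi>, simp add: ract_def)
  have 2: "?\<Psi> (tmap id (comult A) t) = comult A (slice_left \<xi> t)" for t
    by (rule clinear_eq_on_tens[OF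
          clinear_comp[OF \<Psi> clinear_tmap[OF clinear_id'(1) clinear_comult]]
          clinear_comp[OF clinear_comult clinear_slice(1)[OF \<xi>]]])
      (simp add: tmap_tens clinear_comult clinear_id' \<xi> clinear_scale[OF clinear_comult])
  have "comult A (ract A \<xi> h) = ?\<Psi> (tmap id (comult A) (comult A h))"
    unfolding 2 by (simp only: ract_def)
  then show ?thesis by (simp only: coassoc[symmetric] 1)
qed

end

text \<open>The assumption on \<open>wedge\<close> takes the place of X being the coradical.\<close>

locale pointed_bialgebra = fd_bialgebra A X
  for A :: "'a::complex_algebra_1 coalg" and X +
  fixes \<gamma> :: "'g::group_add \<Rightarrow> 'a"
  assumes gamma_zero: "\<gamma> 0 = 1" and gamma_add: "\<gamma> (g + h) = \<gamma> g * \<gamma> h"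
    and comult_gamma: "comult A (\<gamma> g) = \<gamma> g \<boxtimes> \<gamma> g"
    and X_eq: "X = cvec.span (range \<gamma>)"
    and inj_gamma: "inj \<gamma>" and independent_gamma: "cvec.independent (range \<gamma>)"
    and exhaustive: "\<exists>n. wedge A X n = UNIV"
begin

lemma finite_UNIV_group: "finite (UNIV :: 'g set)"
proof -
  obtain B where "finite_dimensional_vector_space (scaleC :: complex \<Rightarrow> 'a \<Rightarrow> 'a) B"
    using finite_dimensional_locale[OF fd] .
  then interpret fd: finite_dimensional_vector_space "scaleC :: complex \<Rightarrow> 'a \<Rightarrow> 'a" B .
  show ?thesis using fd.finiteI_independent[OF independent_gamma] inj_gamma by (simp add: finite_image_iff)
qed

lemma gamma_in_X: "\<gamma> g \<in> X" unfolding X_eq by (rule cvec.span_base) simp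

lemma gamma_inverse: "\<gamma> g * \<gamma> (- g) = 1" "\<gamma> (- g) * \<gamma> g = 1"
  by (simp_all add: gamma_zero flip: gamma_add)

lemma gamma_inverse_assoc: "\<gamma> g * (\<gamma> (- g) * y) = y" "\<gamma> (- g) * (\<gamma> g * y) = y"
  by (simp_all add: gamma_inverse flip: mult.assoc)

definition dual :: "'g \<Rightarrow> 'a \<Rightarrow> complex" where
  "dual g = (SOME \<xi>. clinear \<xi> \<and> (\<forall>h. \<xi> (\<gamma> h) = (if h = g then 1 else 0)))"

lemma dual: "clinear (dual g)" "dual g (\<gamma> h) = (if h = g then 1 else 0)"
proof -
  obtain \<xi> :: "'a \<Rightarrow> complex" where "clinear \<xi>" "\<forall>x\<in>range \<gamma>. \<xi> x = (if x = \<gamma> g then 1 else 0)"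
    using cvec_pair.linear_independent_extend[OF independent_gamma,
        where f = "\<lambda>x. if x = \<gamma> g then 1 else 0 :: complex"] by blast
  then have "\<exists>\<xi> :: 'a \<Rightarrow> complex. clinear \<xi> \<and> (\<forall>h. \<xi> (\<gamma> h) = (if h = g then 1 else 0))"
    using inj_gamma by (intro exI[of _ \<xi>]) (simp add: inj_eq)
  from someI_ex[OF this] show "clinear (dual g)" "dual g (\<gamma> h) = (if h = g then 1 else 0)"
    unfolding dual_def by blast+
qed

lemma X_expand:
  assumes "x \<in> X" shows "x = (\<Sum>g\<in>UNIV. dual g x *\<^sub>C \<gamma> g)"
proof (rule cvec_pair.linear_eq_on[of "\<lambda>x. x" "\<lambda>x. \<Sum>g\<in>UNIV. dual g x *\<^sub>C \<gamma> g" x "range \<gamma>"])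
  have "clinear (\<lambda>x. dual g x *\<^sub>C \<gamma> g)" for g
    using dual(1)[of g] by (simp add: clinear_iff scaleC_add_left scaleC_complex_def scaleC_scaleC)
  then show "clinear (\<lambda>x. \<Sum>g\<in>UNIV. dual g x *\<^sub>C \<gamma> g)" by (rule clinear_sum_fun)
  show "clinear (\<lambda>x::'a. x)" by (rule clinear_id')
  show "x \<in> cvec.span (range \<gamma>)" using assms by (simp add: X_eq)
  fix b assume "b \<in> range \<gamma>"
  then obtain h where h: "b = \<gamma> h" ..
  have "(\<Sum>g\<in>UNIV. dual g b *\<^sub>C \<gamma> g) = (\<Sum>g\<in>UNIV. if g = h then \<gamma> g else 0)"
    unfolding h dual by (intro sum.cong refl) simp
  then show "b = (\<Sum>g\<in>UNIV. dual g b *\<^sub>C \<gamma> g)" using finite_UNIV_group h by simp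
qed

lemma tensor_sub_X_left:
  assumes "r \<in> tensor_sub X (UNIV :: 'a set)" obtains w where "r = (\<Sum>g\<in>UNIV. \<gamma> g \<boxtimes> w g)"
proof -
  let ?f = "\<lambda>r :: ('a, 'a) tensor. \<Sum>g\<in>UNIV. \<gamma> g \<boxtimes> slice_left (dual g) r"
  have f: "clinear (\<lambda>r. r - ?f r)"
    by (intro clinear_diff_fun clinear_id' clinear_sum_fun
        clinear_comp[OF clinear_tens(2) clinear_slice(1)[OF dual(1)]])
  have "tensor_sub X UNIV \<subseteq> {r. r - ?f r \<in> {0}}"
  proof (rule tensor_sub_least[OF subspace_vimage[OF f cvec.subspace_single_0]])
    fix x y :: 'a assume "x \<in> X"
    from X_expand[OF this] have "x \<boxtimes> y = (\<Sum>g\<in>UNIV. dual g x *\<^sub>C \<gamma> g) \<boxtimes> y" by simp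
    also have "\<dots> = ?f (x \<boxtimes> y)"
      by (simp add: tens_sum_left dual(1) tens_scale_left tens_scale_right)
    finally show "x \<boxtimes> y \<in> {r. r - ?f r \<in> {0}}" by simp
  qed
  with assms have "r = ?f r" by auto
  then show thesis by (rule that)
qed

lemma tensor_sub_X_right:
  assumes "r \<in> tensor_sub (Z :: 'a set) X" obtains u where "r = (\<Sum>g\<in>UNIV. u g \<boxtimes> \<gamma> g)"
proof -
  let ?f = "\<lambda>r :: ('a, 'a) tensor. \<Sum>g\<in>UNIV. slice_right (dual g) r \<boxtimes> \<gamma> g"
  have f: "clinear (\<lambda>r. r - ?f r)"
    by (intro clinear_diff_fun clinear_id' clinear_sum_fun
        clinear_comp[OF clinear_tens(1) clinear_slice(2)[OF dual(1)]])
  have "tensor_sub Z X \<subseteq> {r. r - ?f r \<in> {0}}"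
  proof (rule tensor_sub_least[OF subspace_vimage[OF f cvec.subspace_single_0]])
    fix x y :: 'a assume "y \<in> X"
    from X_expand[OF this] have "x \<boxtimes> y = x \<boxtimes> (\<Sum>g\<in>UNIV. dual g y *\<^sub>C \<gamma> g)" by simp
    also have "\<dots> = ?f (x \<boxtimes> y)"
      by (simp add: tens_sum_right dual(1) tens_scale_left tens_scale_right)
    finally show "x \<boxtimes> y \<in> {r. r - ?f r \<in> {0}}" by simp
  qed
  with assms have "r = ?f r" by auto
  then show thesis by (rule that)
qed

lemma wedge_two_bigger:
  assumes "X \<noteq> UNIV" shows "\<not> wedge A X (Suc (Suc 0)) \<subseteq> X"
proof
  assume *: "wedge A X (Suc (Suc 0)) \<subseteq> X"
  have "wedge A X n \<subseteq> wedge A X (Suc 0)" for n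
  proof (induction n)
    case 0
    show ?case by (rule E_mono) simp
  next
    case (Suc n)
    then have "wedge A X (Suc n) \<subseteq> wedge A X (Suc (Suc 0))" by (subst (1 2) wedge.simps) blast
    with * show ?case by (simp only: wedge_X)
  qed
  with exhaustive assms show False unfolding wedge_X by blast
qed

definition skew :: "'g \<Rightarrow> 'a \<Rightarrow> bool" where
  "skew g x \<longleftrightarrow> comult A x = x \<boxtimes> 1 + \<gamma> g \<boxtimes> x"

text \<open>Slicing \<open>\<Delta>u\<close> on the right along a dual basis vector of the group leaves one group-like
  on the right, slicing the result on the left isolates a skew-primitive element.\<close>

lemma skew_exists:
  assumes "X \<noteq> UNIV" obtains g x where "skew g x" "x \<notin> X"
proof -
  note fin = finite_UNIV_group and sumX = cvec.subspace_sum[OF subspace_X]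
    and scX = cvec.subspace_scale[OF subspace_X gamma_in_X]
  note idl = clinear_tmap[OF clinear_id'(1) clinear_lact] and idr = clinear_tmap[OF clinear_ract clinear_id'(1)]
  obtain u where u: "u \<in> wedge A X (Suc (Suc 0))" "u \<notin> X" using wedge_two_bigger[OF assms] by blast
  obtain r s where "r \<in> tensor_sub (wedge A X (Suc 0)) UNIV"
    and s: "s \<in> tensor_sub (wedge A X (Suc (Suc 0))) X" and rs: "comult A u = r + s"
    using comult_wedge[OF u(1)] .
  then have r: "r \<in> tensor_sub X UNIV" by (simp only: wedge_X)
  obtain w v where w: "r = (\<Sum>g\<in>UNIV. \<gamma> g \<boxtimes> w g)" and v: "s = (\<Sum>g\<in>UNIV. v g \<boxtimes> \<gamma> g)"
    using tensor_sub_X_left[OF r] tensor_sub_X_right[OF s] by metis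
  have lu: "lact A \<xi> u = (\<Sum>g\<in>UNIV. \<xi> (w g) *\<^sub>C \<gamma> g) + (\<Sum>g\<in>UNIV. \<xi> (\<gamma> g) *\<^sub>C v g)"
    if "clinear \<xi>" for \<xi>
    unfolding lact_def rs w v
    by (simp add: clinear_add[OF clinear_slice(2)[OF that]] clinear_sum[OF clinear_slice(2)[OF that]] that)
  have "\<exists>k. v k \<notin> X"
  proof (rule ccontr)
    assume "\<nexists>k. v k \<notin> X"
    then have "lact A (counit A) u \<in> X"
      unfolding lu[OF clinear_counit]
      by (intro cvec.subspace_add[OF subspace_X] sumX scX cvec.subspace_scale[OF subspace_X]) simp
    then show False using u(2) by (simp add: lact_counit)
  qed
  then obtain k where k: "v k \<notin> X" ..
  define p where "p = lact A (dual k) u"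
  have p: "p = (\<Sum>g\<in>UNIV. dual k (w g) *\<^sub>C \<gamma> g) + v k"
  proof -
    have "(\<Sum>g\<in>UNIV. dual k (\<gamma> g) *\<^sub>C v g) = (\<Sum>g\<in>UNIV. if g = k then v g else 0)"
      unfolding dual by (intro sum.cong refl) simp
    then show ?thesis unfolding p_def lu[OF dual(1)] using fin by simp
  qed
  have pX: "p \<notin> X"
  proof
    assume "p \<in> X"
    then have "p - (\<Sum>g\<in>UNIV. dual k (w g) *\<^sub>C \<gamma> g) \<in> X"
      by (intro cvec.subspace_diff[OF subspace_X] sumX scX)
    then show False using k by (simp add: p)
  qed
  \<comment> \<open>p differs from \<open>v k\<close> by an element of X; the subtracted term
    compensates for this when \<open>v k \<boxtimes> \<gamma> k\<close> is rewritten through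
    \<open>p \<boxtimes> \<gamma> k\<close>.\<close>
  define y where "y g = lact A (dual k) (w g) - dual k (w g) *\<^sub>C \<gamma> k" for g
  have "comult A p = (\<Sum>g\<in>UNIV. \<gamma> g \<boxtimes> lact A (dual k) (w g)) +
      (\<Sum>g\<in>UNIV. v g \<boxtimes> lact A (dual k) (\<gamma> g))"
    unfolding p_def comult_lact[OF dual(1)] rs w v
    by (simp add: clinear_add[OF idl[OF dual(1)]] clinear_sum[OF idl[OF dual(1)]]
        tmap_tens clinear_id' clinear_lact dual(1))
  also have "(\<Sum>g\<in>UNIV. v g \<boxtimes> lact A (dual k) (\<gamma> g)) = (\<Sum>g\<in>UNIV. if g = k then v k \<boxtimes> \<gamma> k else 0)"
    by (intro sum.cong refl) (simp add: lact_def comult_gamma dual)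
  also have "\<dots> = p \<boxtimes> \<gamma> k - (\<Sum>g\<in>UNIV. \<gamma> g \<boxtimes> dual k (w g) *\<^sub>C \<gamma> k)"
    using fin by (simp add: p tens_add_left tens_sum_left tens_scale_left tens_scale_right)
  also have "(\<Sum>g\<in>UNIV. \<gamma> g \<boxtimes> lact A (dual k) (w g)) + \<dots> = p \<boxtimes> \<gamma> k + (\<Sum>g\<in>UNIV. \<gamma> g \<boxtimes> y g)"
    by (simp add: y_def clinear_diff[OF clinear_tens(2)] sum_subtractf)
  finally have Dp: "comult A p = p \<boxtimes> \<gamma> k + (\<Sum>g\<in>UNIV. \<gamma> g \<boxtimes> y g)" .
  \<comment> \<open>Right multiplication turns the group-like on the right into 1, the normalization
    in \<open>skew\<close>.\<close>
  define q where "q = p * \<gamma> (- k)"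
  have qX: "q \<notin> X"
  proof
    assume "q \<in> X"
    from mult_X[OF this gamma_in_X[of k]] pX show False
      by (simp add: q_def mult.assoc gamma_inverse)
  qed
  define z where "z g = y (g + k) * \<gamma> (- k)" for g
  have "comult A q = q \<boxtimes> 1 + (\<Sum>g\<in>UNIV. \<gamma> (g + - k) \<boxtimes> (y g * \<gamma> (- k)))"
    by (simp add: q_def comult_mult Dp comult_gamma distrib_right tens_times sum_distrib_right
        gamma_inverse gamma_add del: add_uminus_conv_diff)
  also have "(\<Sum>g\<in>UNIV. \<gamma> (g + - k) \<boxtimes> (y g * \<gamma> (- k))) = (\<Sum>g\<in>UNIV. \<gamma> g \<boxtimes> z g)"
    by (rule sum.reindex_bij_witness[of _ "\<lambda>g. g + k" "\<lambda>g. g - k"]) (simp_all add: z_def)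
  finally have Dq: "comult A q = q \<boxtimes> 1 + (\<Sum>g\<in>UNIV. \<gamma> g \<boxtimes> z g)" .
  have rq: "ract A \<xi> q = \<xi> q *\<^sub>C 1 + (\<Sum>g\<in>UNIV. \<xi> (\<gamma> g) *\<^sub>C z g)" if "clinear \<xi>" for \<xi>
    unfolding ract_def Dq
    by (simp add: clinear_add[OF clinear_slice(1)[OF that]] clinear_sum[OF clinear_slice(1)[OF that]] that)
  have sk: "skew g (z g)" for g
  proof -
    have delta: "(\<Sum>h\<in>UNIV. if h = g then f h else 0) = f g" for f :: "'g \<Rightarrow> 'b::comm_monoid_add"
      using fin by simp
    have e1: "ract A (dual g) q = dual g q *\<^sub>C 1 + z g"
    proof -
      have "(\<Sum>h\<in>UNIV. dual g (\<gamma> h) *\<^sub>C z h) = (\<Sum>h\<in>UNIV. if h = g then z h else 0)"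
        unfolding dual by (intro sum.cong refl) simp
      then show ?thesis unfolding rq[OF dual(1)] by (simp add: delta)
    qed
    have "comult A (ract A (dual g) q) =
        ract A (dual g) q \<boxtimes> 1 + (\<Sum>h\<in>UNIV. ract A (dual g) (\<gamma> h) \<boxtimes> z h)"
      unfolding comult_ract[OF dual(1)] Dq
      by (simp add: clinear_add[OF idr[OF dual(1)]] clinear_sum[OF idr[OF dual(1)]]
          tmap_tens clinear_id' clinear_ract dual(1))
    also have "(\<Sum>h\<in>UNIV. ract A (dual g) (\<gamma> h) \<boxtimes> z h) = (\<Sum>h\<in>UNIV. if h = g then \<gamma> h \<boxtimes> z h else 0)"
      by (intro sum.cong refl) (simp add: ract_def comult_gamma dual)
    finally have "comult A (dual g q *\<^sub>C 1 + z g) = (dual g q *\<^sub>C 1 + z g) \<boxtimes> 1 + \<gamma> g \<boxtimes> z g"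
      by (simp add: delta e1)
    then show ?thesis
      by (simp add: skew_def clinear_add[OF clinear_comult] clinear_scale[OF clinear_comult] comult_one
          one_tensor_def tens_add_left tens_scale_left)
  qed
  \<comment> \<open>The counit recovers q from 1 and the \<open>z g\<close>, so these cannot all lie
    in X.\<close>
  have "\<exists>g. z g \<notin> X"
  proof (rule ccontr)
    assume "\<nexists>g. z g \<notin> X"
    then have "ract A (counit A) q \<in> X"
      unfolding rq[OF clinear_counit]
      by (intro cvec.subspace_add[OF subspace_X] sumX cvec.subspace_scale[OF subspace_X] one_X) simp
    then show False using qX by (simp add: ract_counit)
  qed
  with sk show thesis using that by blast
qed

text \<open>The eigenvector equation for conjugation by \<open>\<gamma> p\<close>. For
  skew-primitives x_i over g_i, the scalars by which g_i acts on x_j form the braiding matrix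
  q_ij.\<close>

definition comm :: "'g \<Rightarrow> complex \<Rightarrow> 'a \<Rightarrow> bool" where
  "comm p c x \<longleftrightarrow> \<gamma> p * x = c *\<^sub>C (x * \<gamma> p)"

lemma skew_conj:
  assumes "skew g x" shows "skew (p + g + - p) (\<gamma> p * x * \<gamma> (- p))"
  using assms
  by (simp add: skew_def comult_mult comult_gamma distrib_left distrib_right tens_times gamma_inverse
      gamma_add mult.assoc del: add_uminus_conv_diff)

lemma conj_in_X: "\<gamma> p * x * \<gamma> (- p) \<in> X \<longleftrightarrow> x \<in> X"
proof
  assume "\<gamma> p * x * \<gamma> (- p) \<in> X"
  from mult_X[OF mult_X[OF gamma_in_X[of "- p"] this] gamma_in_X[of p]] show "x \<in> X" by (simp add: mult.assoc gamma_inverse gamma_inverse_assoc)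
qed (intro mult_X gamma_in_X)

lemma subspace_skew: "cvec.subspace {x. skew g x}"
proof -
  have "clinear (\<lambda>x. comult A x - (x \<boxtimes> 1 + \<gamma> g \<boxtimes> x))"
    by (intro clinear_diff_fun clinear_add_fun clinear_comult clinear_tens)
  from subspace_vimage[OF this cvec.subspace_single_0] show ?thesis by (simp add: skew_def)
qed

lemma subspace_comm: "cvec.subspace {x. comm p c x}"
proof -
  have "clinear (\<lambda>x. \<gamma> p * x - c *\<^sub>C (x * \<gamma> p))"
    by (intro clinear_diff_fun clinear_scale_fun clinear_mult)
  from subspace_vimage[OF this cvec.subspace_single_0] show ?thesis by (simp add: comm_def)
qed

lemma comm_conj:
  assumes "comm p c x" "t + p = p' + t"
  shows "comm p' c (\<gamma> t * x * \<gamma> (- t))"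
proof -
  have "\<gamma> p' * \<gamma> t = \<gamma> t * \<gamma> p" using assms(2) by (metis gamma_add)
  then have 1: "\<gamma> p' * (\<gamma> t * y) = \<gamma> t * (\<gamma> p * y)" for y by (simp flip: mult.assoc)
  have "p + - t = - t + p'"
    using assms(2) by (metis add.assoc add.right_inverse add.right_neutral add_0 left_minus)
  then have 2: "\<gamma> p * \<gamma> (- t) = \<gamma> (- t) * \<gamma> p'" by (metis gamma_add)
  have x: "\<gamma> p * (x * y) = c *\<^sub>C (x * (\<gamma> p * y))" for y
    using assms(1) by (simp add: comm_def mult_scaleC_left flip: mult.assoc)
  show ?thesis by (simp add: comm_def mult.assoc 1 2 x mult_scaleC_right)
qed

lemma comm_mult: "comm p c x \<Longrightarrow> comm p d y \<Longrightarrow> comm p (c * d) (x * y)"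
proof -
  assume x: "comm p c x" and y: "comm p d y"
  have "\<gamma> p * (x * y) = c *\<^sub>C (x * (\<gamma> p * y))"
    using x by (simp add: comm_def mult_scaleC_left flip: mult.assoc)
  then show ?thesis using y by (simp add: comm_def mult_scaleC_right scaleC_scaleC mult.assoc)
qed

lemma comm_lin: "comm p c x \<Longrightarrow> comm p c y \<Longrightarrow> comm p c (x + y)" "comm p c x \<Longrightarrow> comm p c (d *\<^sub>C x)"
  using cvec.subspace_add[OF subspace_comm] cvec.subspace_scale[OF subspace_comm] by blast+

lemma comm_inverse:
  assumes "comm p c x" "c \<noteq> 0" shows "comm (- p) (inverse c) x"
proof -
  have "\<gamma> (- p) * (\<gamma> p * x) * \<gamma> (- p) = c *\<^sub>C (\<gamma> (- p) * (x * \<gamma> p) * \<gamma> (- p))"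
    using assms(1) by (simp add: comm_def mult_scaleC_left mult_scaleC_right)
  then have "x * \<gamma> (- p) = c *\<^sub>C (\<gamma> (- p) * x)"
    by (simp add: mult.assoc gamma_inverse gamma_inverse_assoc)
  then show ?thesis using assms(2) by (simp add: comm_def scaleC_scaleC)
qed

lemma comm_add: "comm p c x \<Longrightarrow> comm p' c' x \<Longrightarrow> comm (p + p') (c * c') x"
proof -
  assume p: "comm p c x" and p': "comm p' c' x"
  have "\<gamma> p * (\<gamma> p' * x) = c' *\<^sub>C (\<gamma> p * x * \<gamma> p')"
    using p' by (simp add: comm_def mult_scaleC_right mult.assoc)
  also have "\<dots> = (c * c') *\<^sub>C (x * (\<gamma> p * \<gamma> p'))"
    using p by (simp add: comm_def mult_scaleC_left scaleC_scaleC mult.commute mult.assoc)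
  finally show ?thesis by (simp add: comm_def gamma_add mult.assoc)
qed

end

section \<open>Diagonalizing conjugation by a group-like element\<close>

lemma primitive_root_of_unity:
  assumes "n > 0" obtains \<zeta> :: complex where "\<zeta> ^ n = 1" "\<And>k. 0 < k \<Longrightarrow> k < n \<Longrightarrow> \<zeta> ^ k \<noteq> 1"
proof -
  let ?f = "\<lambda>k::nat. cis (2 * pi * real k / real n)"
  have bij: "bij_betw ?f {..<n} {z. z ^ n = 1}" by (rule bij_betw_roots_unity[OF assms])
  have pow: "cis (2 * pi / real n) ^ k = ?f k" for k by (simp add: DeMoivre mult_ac)
  show thesis
  proof (rule that[of "cis (2 * pi / real n)"])
    show "cis (2 * pi / real n) ^ n = 1" using assms by (simp add: pow)
    fix k assume k: "0 < k" "k < n"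
    then have "?f k \<noteq> ?f 0"
      using inj_onD[OF bij_betw_imp_inj_on[OF bij], of k 0] by auto
    then show "cis (2 * pi / real n) ^ k \<noteq> 1" by (simp add: pow)
  qed
qed

context pointed_bialgebra begin

text \<open>A discrete Fourier transform over the powers of \<open>\<gamma> p\<close>: n times x is
  a sum of eigenvectors inside W, and they cannot all lie in X.\<close>

lemma eigenvector_exists:
  assumes n: "n > 0" "\<gamma> p ^ n = 1"
    and W: "cvec.subspace W" "\<And>x. x \<in> W \<Longrightarrow> \<gamma> p * x * \<gamma> (- p) \<in> W"
    and x: "x \<in> W" "x \<notin> X"
  obtains q y where "q ^ n = 1" "y \<in> W" "y \<notin> X" "comm p q y"
proof -
  obtain \<zeta> :: complex where \<zeta>: "\<zeta> ^ n = 1" "\<And>k. 0 < k \<Longrightarrow> k < n \<Longrightarrow> \<zeta> ^ k \<noteq> 1"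
    using primitive_root_of_unity[OF n(1)] by blast
  have n': "\<gamma> (- p) ^ n = 1"
  proof -
    have "\<gamma> p ^ k * \<gamma> (- p) ^ k = 1" for k
    proof (induction k)
      case (Suc k)
      have "\<gamma> p ^ Suc k * \<gamma> (- p) ^ Suc k = \<gamma> p ^ k * (\<gamma> p * \<gamma> (- p)) * \<gamma> (- p) ^ k"
        unfolding power_Suc2[of "\<gamma> p"] power_Suc[of "\<gamma> (- p)"] by (simp only: mult.assoc)
      then show ?case by (simp add: gamma_inverse Suc)
    qed simp
    from this[of n] show ?thesis by (simp add: n)
  qed
  define T where "T k = \<gamma> p ^ k * x * \<gamma> (- p) ^ k" for k
  have T_Suc: "\<gamma> p * T k * \<gamma> (- p) = T (Suc k)" for k
    by (simp add: T_def mult.assoc power_commutes)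
  have T0: "T 0 = x" and Tn: "T n = x" by (simp_all add: T_def n n')
  have TW: "T k \<in> W" for k by (induction k) (simp_all add: T0 x T_Suc[symmetric] W(2))
  define y where "y q = (\<Sum>k<n. q ^ k *\<^sub>C T k)" for q
  have yW: "y q \<in> W" for q
    unfolding y_def by (intro cvec.subspace_sum cvec.subspace_scale W TW)
  have y_comm: "comm p (inverse q) (y q)" if q: "q ^ n = 1" for q
  proof -
    have q0: "q \<noteq> 0" using q n(1) by (metis power_0_left zero_neq_one not_gr_zero)
    have "q *\<^sub>C (\<gamma> p * y q * \<gamma> (- p)) = (\<Sum>k<n. q ^ Suc k *\<^sub>C T (Suc k))"
      by (simp add: y_def sum_distrib_left sum_distrib_right mult_scaleC_left mult_scaleC_right T_Suc
          cvec.scale_sum_right scaleC_scaleC)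
    also have "\<dots> = (\<Sum>k<Suc n. q ^ k *\<^sub>C T k) - T 0" by (subst sum.lessThan_Suc_shift) simp
    also have "\<dots> = y q" by (simp add: y_def q T0 Tn)
    finally have "\<gamma> p * y q * \<gamma> (- p) = inverse q *\<^sub>C y q"
      using q0 by (metis cvec_1 left_inverse scaleC_scaleC)
    then have "\<gamma> p * y q * \<gamma> (- p) * \<gamma> p = inverse q *\<^sub>C (y q * \<gamma> p)" by (simp add: mult_scaleC_left)
    then show ?thesis by (simp add: comm_def mult.assoc gamma_inverse)
  qed
  have "(\<Sum>j<n. y (\<zeta> ^ j)) = (\<Sum>k<n. (\<Sum>j<n. (\<zeta> ^ k) ^ j) *\<^sub>C T k)"
    unfolding y_def by (subst sum.swap) (simp add: cvec.scale_sum_left power_mult[symmetric] mult.commute)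
  also have "\<dots> = (\<Sum>k<n. if k = 0 then of_nat n *\<^sub>C T k else 0)"
  proof (intro sum.cong refl)
    fix k assume "k \<in> {..<n}"
    then have "k \<noteq> 0 \<Longrightarrow> \<zeta> ^ k \<noteq> 1" using \<zeta>(2) by simp
    moreover have "(\<zeta> ^ k) ^ n = 1" using \<zeta>(1) by (metis power_mult mult.commute power_one)
    ultimately have "(\<Sum>j<n. (\<zeta> ^ k) ^ j) = (if k = 0 then of_nat n else 0)"
      by (simp add: sum_gp_strict)
    then show "(\<Sum>j<n. (\<zeta> ^ k) ^ j) *\<^sub>C T k = (if k = 0 then of_nat n *\<^sub>C T k else 0)" by simp
  qed
  also have "\<dots> = of_nat n *\<^sub>C x" using n(1) by (simp add: T0)
  finally have sum_y: "(\<Sum>j<n. y (\<zeta> ^ j)) = of_nat n *\<^sub>C x" .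
  have "\<exists>j. y (\<zeta> ^ j) \<notin> X"
  proof (rule ccontr)
    assume "\<nexists>j. y (\<zeta> ^ j) \<notin> X"
    then have "of_nat n *\<^sub>C x \<in> X" unfolding sum_y[symmetric] by (intro cvec.subspace_sum subspace_X) simp
    from cvec.subspace_scale[OF subspace_X this, of "inverse (of_nat n)"] show False
      using n(1) x(2) by (simp add: scaleC_scaleC)
  qed
  then obtain j where j: "y (\<zeta> ^ j) \<notin> X" ..
  have *: "(\<zeta> ^ j) ^ n = 1" using \<zeta>(1) by (metis power_mult mult.commute power_one)
  have "inverse (\<zeta> ^ j) ^ n = 1" by (simp only: power_inverse * inverse_1)
  with yW j y_comm[OF *] show thesis by (intro that)
qed

end

section \<open>Leading terms of the comultiplication\<close>

text \<open>In closed form, the sum of z^i v z^(k-1-i) over i < k: the derivative of z^k by the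
  Leibniz rule when z has derivative v.\<close>

primrec psum :: "'a::semiring_1 \<Rightarrow> 'a \<Rightarrow> nat \<Rightarrow> 'a" where
  "psum z v 0 = 0"
| "psum z v (Suc k) = psum z v k * z + z ^ k * v"

lemma psum_mult_right:
  assumes "p * z = z * p" shows "psum z (v * p) k = psum z v k * p"
proof (induction k)
  case (Suc k)
  have "psum z v k * p * z = psum z v k * z * p" by (simp add: assms mult.assoc)
  with Suc show ?case by (simp add: distrib_right mult.assoc)
qed simp

lemma psum_scale: "psum z (c *\<^sub>C v) k = c *\<^sub>C psum z v k" for z v :: "'a::complex_algebra_1"
  by (induction k) (simp_all add: mult_scaleC_left mult_scaleC_right scaleC_add_right)

lemma psum_zero: "psum z 0 k = 0"
  by (induction k) simp_all

lemma psum_commuting: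
  fixes z v :: "'a::complex_algebra_1"
  assumes "v * z = z * v" shows "psum z v (Suc k) = of_nat (Suc k) *\<^sub>C (z ^ k * v)"
proof (induction k)
  case (Suc k)
  have "z ^ k * v * z = z ^ Suc k * v" by (simp add: assms mult.assoc power_Suc2 del: power_Suc)
  then have "psum z v (Suc (Suc k)) = of_nat (Suc k) *\<^sub>C (z ^ Suc k * v) + 1 *\<^sub>C (z ^ Suc k * v)"
    by (subst psum.simps(2), subst Suc) (simp add: mult_scaleC_left del: psum.simps power_Suc)
  also have "\<dots> = of_nat (Suc (Suc k)) *\<^sub>C (z ^ Suc k * v)"
    unfolding scaleC_add_left[symmetric] by simp
  finally show ?case .
qed simp

text \<open>\<open>independent_x\<close> is linear independence of the \<open>x i\<close> modulo X,
  given directly by dual functionals because \<open>der_drop\<close> slices with them.\<close>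

locale skew_family = pointed_bialgebra +
  fixes m :: nat and x :: "nat \<Rightarrow> 'a" and g :: "nat \<Rightarrow> 'b"
  assumes skew_x: "i < m \<Longrightarrow> skew (g i) (x i)"
    and independent_x: "i < m \<Longrightarrow>
      \<exists>\<xi> :: 'a \<Rightarrow> complex. clinear \<xi> \<and> (\<forall>y\<in>X. \<xi> y = 0) \<and> (\<forall>j<m. \<xi> (x j) = (if j = i then 1 else 0))"
begin

text \<open>\<open>a\<close> has degree at most \<open>n\<close>, and modulo terms whose left factor has degree at most \<open>n - 2\<close>,
  the coefficient of \<open>x j\<close> on the right of \<open>\<Delta>a\<close> is \<open>b\<close>.  The degree \<open>n\<close> term of the
  filtration is \<open>wedge A X (Suc n)\<close>.\<close>

definition der :: "nat \<Rightarrow> nat \<Rightarrow> 'a \<Rightarrow> 'a \<Rightarrow> bool" where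
  "der j n a b \<longleftrightarrow> a \<in> wedge A X (Suc n) \<and>
     (\<exists>\<alpha>. \<alpha> j = b \<and> (\<forall>i<m. \<alpha> i \<in> wedge A X n) \<and>
       comult A a - a \<boxtimes> 1 - (\<Sum>i<m. \<alpha> i \<boxtimes> x i) \<in> tensor_sub (wedge A X (n - 1)) UNIV)"

lemma derE:
  assumes "der j n a b"
  obtains \<alpha> r where "a \<in> wedge A X (Suc n)" "\<alpha> j = b" "\<forall>i<m. \<alpha> i \<in> wedge A X n"
    "r \<in> tensor_sub (wedge A X (n - 1)) UNIV" "comult A a = a \<boxtimes> 1 + (\<Sum>i<m. \<alpha> i \<boxtimes> x i) + r"
proof -
  obtain \<alpha> where "a \<in> wedge A X (Suc n)" "\<alpha> j = b" "\<forall>i<m. \<alpha> i \<in> wedge A X n"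
    "comult A a - a \<boxtimes> 1 - (\<Sum>i<m. \<alpha> i \<boxtimes> x i) \<in> tensor_sub (wedge A X (n - 1)) UNIV"
    using assms unfolding der_def by blast
  then show thesis
    by (intro that[of \<alpha> "comult A a - a \<boxtimes> 1 - (\<Sum>i<m. \<alpha> i \<boxtimes> x i)"]) simp_all
qed

lemma derI:
  assumes "a \<in> wedge A X (Suc n)" "\<alpha> j = b" "\<And>i. i < m \<Longrightarrow> \<alpha> i \<in> wedge A X n"
    "r \<in> tensor_sub (wedge A X (n - 1)) UNIV" "comult A a = a \<boxtimes> 1 + (\<Sum>i<m. \<alpha> i \<boxtimes> x i) + r"
  shows "der j n a b"
  unfolding der_def using assms by (intro conjI exI[of _ \<alpha>]) (simp_all del: wedge.simps)

lemma der_cong: "der j n a b \<Longrightarrow> n = n' \<Longrightarrow> b = b' \<Longrightarrow> der j n' a b'"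
  by simp

lemma wedge_zero: "0 \<in> wedge A X n" by (rule cvec.subspace_0[OF subspace_E])

lemma der_one: "der j 0 1 0"
  by (rule derI[where \<alpha> = "\<lambda>_. 0" and r = 0])
    (simp_all del: wedge.simps add: wedge_X one_X wedge_zero comult_one one_tensor_def
      cvec.subspace_0[OF subspace_tensor_sub])

lemma der_x:
  assumes "i < m" shows "der j 1 (x i) (if i = j then \<gamma> (g i) else 0)"
proof (rule derI[where \<alpha> = "\<lambda>j. if i = j then \<gamma> (g i) else 0" and r = 0])
  show "x i \<in> wedge A X (Suc 1)"
  proof -
    have "lact A \<xi> (x i) \<in> X" if "clinear \<xi>" "\<forall>y\<in>X. \<xi> y = 0" for \<xi>
      using that skew_x[OF assms] one_X cvec.subspace_scale[OF subspace_X gamma_in_X]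
      by (simp add: lact_def skew_def clinear_add[OF clinear_slice(2)[OF that(1)]])
    then show ?thesis unfolding One_nat_def wedge.simps(2)[of A X "Suc 0"] wedge_X by blast
  qed
  show "(if i = k then \<gamma> (g i) else 0) \<in> wedge A X 1" for k
    unfolding One_nat_def wedge_X using gamma_in_X cvec.subspace_0[OF subspace_X] by simp
  have "(\<Sum>k<m. (if i = k then \<gamma> (g i) else 0) \<boxtimes> x k) = (\<Sum>k<m. if i = k then \<gamma> (g i) \<boxtimes> x k else 0)"
    by (intro sum.cong refl) simp
  also have "\<dots> = \<gamma> (g i) \<boxtimes> x i" using assms by simp
  finally show "comult A (x i) = x i \<boxtimes> 1 + (\<Sum>k<m. (if i = k then \<gamma> (g i) else 0) \<boxtimes> x k) + 0"
    using skew_x[OF assms] by (simp add: skew_def)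
qed (simp_all add: cvec.subspace_0[OF subspace_tensor_sub])

lemma der_add:
  assumes "der j n a b" "der j n a' b'" shows "der j n (a + a') (b + b')"
proof -
  obtain \<alpha> r where 1: "a \<in> wedge A X (Suc n)" "\<alpha> j = b" "\<forall>i<m. \<alpha> i \<in> wedge A X n"
    "r \<in> tensor_sub (wedge A X (n - 1)) UNIV" "comult A a = a \<boxtimes> 1 + (\<Sum>i<m. \<alpha> i \<boxtimes> x i) + r"
    using derE[OF assms(1)] .
  obtain \<alpha>' r' where 2: "a' \<in> wedge A X (Suc n)" "\<alpha>' j = b'" "\<forall>i<m. \<alpha>' i \<in> wedge A X n"
    "r' \<in> tensor_sub (wedge A X (n - 1)) UNIV" "comult A a' = a' \<boxtimes> 1 + (\<Sum>i<m. \<alpha>' i \<boxtimes> x i) + r'"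
    using derE[OF assms(2)] .
  show ?thesis
  proof (rule derI[where \<alpha> = "\<lambda>i. \<alpha> i + \<alpha>' i" and r = "r + r'"])
    show "a + a' \<in> wedge A X (Suc n)" by (rule cvec.subspace_add[OF subspace_E 1(1) 2(1)])
    show "\<alpha> j + \<alpha>' j = b + b'" by (simp add: 1 2)
    show "\<alpha> i + \<alpha>' i \<in> wedge A X n" if "i < m" for i
      by (rule cvec.subspace_add[OF subspace_E 1(3)[rule_format, OF that] 2(3)[rule_format, OF that]])
    show "r + r' \<in> tensor_sub (wedge A X (n - 1)) UNIV"
      by (rule cvec.subspace_add[OF subspace_tensor_sub 1(4) 2(4)])
  qed (simp add: clinear_add[OF clinear_comult] 1(5) 2(5) tens_add_left sum.distrib)
qed

lemma der_scale:
  assumes "der j n a b" shows "der j n (c *\<^sub>C a) (c *\<^sub>C b)"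
proof -
  obtain \<alpha> r where 1: "a \<in> wedge A X (Suc n)" "\<alpha> j = b" "\<forall>i<m. \<alpha> i \<in> wedge A X n"
    "r \<in> tensor_sub (wedge A X (n - 1)) UNIV" "comult A a = a \<boxtimes> 1 + (\<Sum>i<m. \<alpha> i \<boxtimes> x i) + r"
    using derE[OF assms(1)] .
  show ?thesis
  proof (rule derI[where \<alpha> = "\<lambda>i. c *\<^sub>C \<alpha> i" and r = "c *\<^sub>C r"])
    show "c *\<^sub>C a \<in> wedge A X (Suc n)" by (rule cvec.subspace_scale[OF subspace_E 1(1)])
    show "c *\<^sub>C \<alpha> j = c *\<^sub>C b" by (simp add: 1)
    show "c *\<^sub>C \<alpha> i \<in> wedge A X n" if "i < m" for i
      by (rule cvec.subspace_scale[OF subspace_E 1(3)[rule_format, OF that]])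
    show "c *\<^sub>C r \<in> tensor_sub (wedge A X (n - 1)) UNIV"
      by (rule cvec.subspace_scale[OF subspace_tensor_sub 1(4)])
  qed (simp add: clinear_scale[OF clinear_comult] 1(5) tens_scale_left scaleC_add_right cvec.scale_sum_right)
qed

lemma wedge_mult_le:
  assumes "a \<in> wedge A X i" "b \<in> wedge A X j" "i \<noteq> 0 \<Longrightarrow> j \<noteq> 0 \<Longrightarrow> i + j \<le> Suc k"
  shows "a * b \<in> wedge A X k"
proof (cases "i = 0 \<or> j = 0")
  case True
  then show ?thesis using assms(1,2) wedge_zero by auto
next
  case False
  then have "i + j - 1 \<le> k" using assms(3) by auto
  from E_mono[OF this] show ?thesis using wedge_mult[OF assms(1,2)] by blast
qed

text \<open>This Leibniz rule carries no braiding factor: the group-like part of a derivative stays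
  inside the coefficient, and is moved past other factors only later, by
  \<open>comm\<close>.\<close>

lemma der_mult:
  assumes "der j n a b" "der j n' a' b'" shows "der j (n + n') (a * a') (a * b' + b * a')"
proof -
  obtain \<alpha> r where 1: "a \<in> wedge A X (Suc n)" "\<alpha> j = b" "\<forall>i<m. \<alpha> i \<in> wedge A X n"
    "r \<in> tensor_sub (wedge A X (n - 1)) UNIV" "comult A a = a \<boxtimes> 1 + (\<Sum>i<m. \<alpha> i \<boxtimes> x i) + r"
    using derE[OF assms(1)] .
  obtain \<alpha>' r' where 2: "a' \<in> wedge A X (Suc n')" "\<alpha>' j = b'" "\<forall>i<m. \<alpha>' i \<in> wedge A X n'"
    "r' \<in> tensor_sub (wedge A X (n' - 1)) UNIV" "comult A a' = a' \<boxtimes> 1 + (\<Sum>i<m. \<alpha>' i \<boxtimes> x i) + r'"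
    using derE[OF assms(2)] .
  let ?S = "\<Sum>i<m. \<alpha> i \<boxtimes> x i" and ?S' = "\<Sum>i<m. \<alpha>' i \<boxtimes> x i"
  let ?T = "tensor_sub (wedge A X (n + n' - 1)) (UNIV :: 'a set)"
  \<comment> \<open>Each of the four products has left degree at most n + n' - 2, which is index n +
    n' - 1 in the shifted numbering.\<close>
  let ?r = "(a \<boxtimes> 1) * r' + ?S * ?S' + ?S * r' + r * comult A a'"
  note addT = cvec.subspace_add[OF subspace_tensor_sub]
  have S: "?S \<in> tensor_sub (wedge A X n) UNIV" and S': "?S' \<in> tensor_sub (wedge A X n') UNIV"
    by (intro cvec.subspace_sum[OF subspace_tensor_sub] tens_in_tensor_sub 1(3)[rule_format] 2(3)[rule_format]; simp)+
  have t1: "(a \<boxtimes> 1) * r' \<in> ?T"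
    by (rule tensor_sub_mult[OF tens_in_tensor_sub[OF 1(1) UNIV_I[of "1 :: 'a"]] 2(4)])
      (erule (1) wedge_mult_le, simp_all)
  have t2: "?S * ?S' \<in> ?T"
    by (rule tensor_sub_mult[OF S S']) (erule (1) wedge_mult_le, simp_all)
  have t3: "?S * r' \<in> ?T"
    by (rule tensor_sub_mult[OF S 2(4)]) (erule (1) wedge_mult_le, simp_all)
  have t4: "r * comult A a' \<in> ?T"
    by (rule tensor_sub_mult[OF 1(4) comult_wedge_left[OF 2(1)]]) (erule (1) wedge_mult_le, simp_all)
  show ?thesis
  proof (rule derI[where \<alpha> = "\<lambda>i. a * \<alpha>' i + \<alpha> i * a'" and r = ?r])
    show "a * a' \<in> wedge A X (Suc (n + n'))" by (rule wedge_mult_le[OF 1(1) 2(1)]) simp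
    show "a * \<alpha>' j + \<alpha> j * a' = a * b' + b * a'" by (simp add: 1 2)
    show "a * \<alpha>' i + \<alpha> i * a' \<in> wedge A X (n + n')" if "i < m" for i
      by (rule cvec.subspace_add[OF subspace_E wedge_mult_le[OF 1(1) 2(3)[rule_format, OF that]]
            wedge_mult_le[OF 1(3)[rule_format, OF that] 2(1)]]) simp_all
    show "?r \<in> ?T" by (intro addT t1 t2 t3 t4)
    have "comult A (a * a') = (a \<boxtimes> 1 + ?S + r) * comult A a'"
      by (simp only: comult_mult 1(5))
    also have "\<dots> = (a \<boxtimes> 1) * (a' \<boxtimes> 1) + ((a \<boxtimes> 1) * ?S' + ?S * (a' \<boxtimes> 1)) + ?r"
      unfolding distrib_right unfolding 2(5) by (simp add: distrib_left add_ac)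
    also have "(a \<boxtimes> 1) * ?S' + ?S * (a' \<boxtimes> 1) = (\<Sum>i<m. (a * \<alpha>' i + \<alpha> i * a') \<boxtimes> x i)"
      by (simp add: sum_distrib_left sum_distrib_right tens_times tens_add_left sum.distrib)
    finally show "comult A (a * a') = (a * a') \<boxtimes> 1 + (\<Sum>i<m. (a * \<alpha>' i + \<alpha> i * a') \<boxtimes> x i) + ?r"
      by (simp add: tens_times)
  qed
qed

text \<open>The functional dual to \<open>x j\<close> vanishes on X, so slicing \<Delta>a with it
  isolates b up to the error term; if a has lower degree than announced, so has this slice. Loss of
  degree thus passes to derivatives.\<close>

lemma der_drop:
  assumes "der j (Suc n) a b" "a \<in> wedge A X (Suc n)" "j < m"
  shows "b \<in> wedge A X n"
proof -
  obtain \<alpha> r where 1: "\<alpha> j = b"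
    "r \<in> tensor_sub (wedge A X n) UNIV" "comult A a = a \<boxtimes> 1 + (\<Sum>i<m. \<alpha> i \<boxtimes> x i) + r"
    using derE[OF assms(1)] by (metis diff_Suc_1)
  obtain \<xi> :: "'a \<Rightarrow> complex"
    where \<xi>: "clinear \<xi>" "\<forall>y\<in>X. \<xi> y = 0" "\<forall>i<m. \<xi> (x i) = (if i = j then 1 else 0)"
    using independent_x[OF assms(3)] by blast
  have "(\<Sum>i<m. \<xi> (x i) *\<^sub>C \<alpha> i) = (\<Sum>i<m. if i = j then \<alpha> i else 0)"
    using \<xi>(3) by (intro sum.cong refl) simp
  then have "lact A \<xi> a = b + slice_right \<xi> r"
    using \<xi>(1,2) one_X assms(3) by (simp add: lact_def 1 clinear_add[OF clinear_slice(2)[OF \<xi>(1)]]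
        clinear_sum[OF clinear_slice(2)[OF \<xi>(1)]])
  moreover have "lact A \<xi> a \<in> wedge A X n" using assms(2) \<xi>(1,2) by simp
  moreover have "slice_right \<xi> r \<in> wedge A X n"
    by (rule slice_right_tensor_sub[OF 1(2) \<xi>(1) subspace_E])
  ultimately show ?thesis using cvec.subspace_diff[OF subspace_E] by (metis add_diff_cancel_right')
qed

lemma der_psum_power: "der j d z v \<Longrightarrow> der j (k * d) (z ^ k) (psum z v k)"
proof (induction k)
  case 0
  show ?case using der_one by simp
next
  case (Suc k)
  from der_mult[OF Suc.IH[OF Suc.prems] Suc.prems] show ?case
    by (simp add: power_Suc2 add.commute del: power_Suc)
qed

text \<open>Since z has derivative zero in direction j it acts as a constant, and only the inserted
  factor v is differentiated.\<close>

lemma der_psum: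
  assumes z: "der j d z 0" and v: "der j e v w"
  shows "der j (k * d + e) (psum z v (Suc k)) (psum z w (Suc k))"
proof (induction k)
  case 0
  show ?case using v by simp
next
  case (Suc k)
  have "der j (Suc k * d + e) (psum z v (Suc k) * z) (psum z w (Suc k) * z)"
    using der_mult[OF Suc z] by (simp add: add_ac del: psum.simps)
  moreover have "der j (Suc k * d + e) (z ^ Suc k * v) (z ^ Suc k * w)"
    using der_mult[OF der_psum_power[OF z, of "Suc k"] v] by (simp add: psum_zero del: psum.simps)
  ultimately show ?case by (subst (1 2) psum.simps(2)) (rule der_add)
qed

text \<open>\<open>wedge A X (k * d)\<close> consists of elements of degree below k d, the expected
  degree of z^k. Exhaustiveness gives such a drop for some k, and the descent carries it to z^0 = 1,
  which is not in \<open>wedge A X 0\<close>.\<close>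

lemma no_descent:
  assumes d: "d > 0" and step: "\<And>k. z ^ Suc k \<in> wedge A X (Suc k * d) \<Longrightarrow> z ^ k \<in> wedge A X (k * d)"
  shows False
proof -
  obtain n where n: "wedge A X n = UNIV" using exhaustive by blast
  have "n \<le> n * d" using d by simp
  with n have "z ^ n \<in> wedge A X (n * d)" using E_mono by blast
  then have "z ^ 0 \<in> wedge A X (0 * d)" by (induction n) (use step in blast)+
  then show False by simp
qed

end

section \<open>Configurations of skew-primitive elements that cannot occur\<close>

context pointed_bialgebra begin

lemma vanishing_functional:
  assumes "x \<notin> X" obtains \<xi> where "clinear \<xi>" "\<forall>y\<in>X. \<xi> y = 0" "\<xi> x = (1::complex)"
  using separating_functional[OF subspace_X assms] by metis

text \<open>Compose \<xi> with conjugation by \<open>\<gamma> p\<close> minus b: this operator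
  preserves X and multiplies c-eigenvectors by c - b.\<close>

lemma separate_eigenvectors:
  assumes \<xi>: "clinear \<xi>" "\<forall>y\<in>X. \<xi> y = 0" "\<xi> x \<noteq> 0" and x: "comm p a x" and ab: "a \<noteq> b"
  obtains \<xi>' where "clinear \<xi>'" "\<forall>y\<in>X. \<xi>' y = 0" "\<xi>' x \<noteq> (0::complex)"
    "\<And>y c. comm p c y \<Longrightarrow> \<xi>' y = (c - b) * \<xi> y"
proof -
  let ?\<xi> = "\<lambda>y. \<xi> (\<gamma> p * y * \<gamma> (- p)) - b *\<^sub>C \<xi> y"
  have 1: "clinear ?\<xi>"
    by (intro clinear_diff_fun clinear_scale_fun \<xi>(1)
        clinear_comp[OF \<xi>(1) clinear_comp[OF clinear_mult(1) clinear_mult(2)]])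
  have 2: "\<forall>y\<in>X. ?\<xi> y = 0" using \<xi>(2) by (simp add: conj_in_X scaleC_complex_def)
  have 3: "?\<xi> y = (c - b) * \<xi> y" if "comm p c y" for y c
    using that by (simp add: comm_def mult_scaleC_left mult.assoc gamma_inverse clinear_scale[OF \<xi>(1)]
        scaleC_complex_def algebra_simps)
  have "?\<xi> x \<noteq> 0" using 3[OF x] ab \<xi>(3) by simp
  from that[OF 1 2 this 3] show thesis .
qed

lemma normalize_functional:
  assumes "clinear \<xi>" "\<forall>y\<in>X. \<xi> y = 0" "\<xi> x \<noteq> (0::complex)"
  obtains \<xi>' where "clinear \<xi>'" "\<forall>y\<in>X. \<xi>' y = 0" "\<xi>' x = 1" "\<And>y. \<xi> y = 0 \<Longrightarrow> \<xi>' y = (0::complex)"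
proof (rule that[of "\<lambda>y. inverse (\<xi> x) *\<^sub>C \<xi> y"])
  show "clinear (\<lambda>y. inverse (\<xi> x) *\<^sub>C \<xi> y)" by (rule clinear_scale_fun[OF assms(1)])
qed (use assms in \<open>simp_all add: scaleC_complex_def\<close>)

lemma functional_apart2:
  assumes x: "x \<notin> X" "comm p a x" "comm p b y" "a \<noteq> b"
  obtains \<xi> where "clinear \<xi>" "\<forall>y\<in>X. \<xi> y = 0" "\<xi> x = 1" "\<xi> y = (0::complex)"
proof -
  obtain \<xi> where \<xi>: "clinear \<xi>" "\<forall>y\<in>X. \<xi> y = 0" "\<xi> x = (1::complex)" using vanishing_functional[OF x(1)] .
  obtain \<xi>' where \<xi>': "clinear \<xi>'" "\<forall>y\<in>X. \<xi>' y = 0" "\<xi>' x \<noteq> (0::complex)"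
    "\<And>y c. comm p c y \<Longrightarrow> \<xi>' y = (c - b) * \<xi> y"
    using separate_eigenvectors[OF \<xi>(1,2) _ x(2,4)] \<xi>(3) by (metis zero_neq_one)
  then have "\<xi>' y = 0" using x(3) by simp
  with normalize_functional[OF \<xi>'(1-3)] that show thesis by metis
qed

lemma functional_apart3:
  assumes x: "x \<notin> X" "comm p a x" "comm p b y" "a \<noteq> b"
    and z: "comm p' a' x" "comm p' b' z" "a' \<noteq> b'" and y: "comm p' c y"
  obtains \<xi> where "clinear \<xi>" "\<forall>y\<in>X. \<xi> y = 0" "\<xi> x = 1" "\<xi> y = (0::complex)" "\<xi> z = 0"
proof -
  obtain \<xi> where \<xi>: "clinear \<xi>" "\<forall>y\<in>X. \<xi> y = 0" "\<xi> x = 1" "\<xi> y = (0::complex)"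
    using functional_apart2[OF x] .
  obtain \<xi>' where \<xi>': "clinear \<xi>'" "\<forall>y\<in>X. \<xi>' y = 0" "\<xi>' x \<noteq> (0::complex)"
    "\<And>y c. comm p' c y \<Longrightarrow> \<xi>' y = (c - b') * \<xi> y"
    using separate_eigenvectors[OF \<xi>(1,2) _ z(1,3)] \<xi>(3) by (metis zero_neq_one)
  \<comment> \<open>Passing to \<open>\<xi>'\<close> keeps the zero at y because y is an eigenvector
    for p' as well.\<close>
  have "\<xi>' y = 0" "\<xi>' z = 0" using \<xi>'(4)[OF y] \<xi>'(4)[OF z(2)] \<xi>(4) by simp_all
  with normalize_functional[OF \<xi>'(1-3)] that show thesis by metis
qed

lemma wedge_cancel:
  assumes "c *\<^sub>C (y * \<gamma> p) \<in> wedge A X n" "c \<noteq> 0" shows "y \<in> wedge A X n"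
proof -
  have "inverse c *\<^sub>C (c *\<^sub>C (y * \<gamma> p)) * \<gamma> (- p) \<in> wedge A X n"
    by (intro wedge_X_mult gamma_in_X cvec.subspace_scale[OF subspace_E] assms(1))
  then show ?thesis using assms(2) by (simp add: scaleC_scaleC mult.assoc gamma_inverse)
qed

text \<open>All k + 1 summands coincide because \<open>\<gamma> p\<close> commutes with z, and k + 1
  is invertible in characteristic zero.\<close>

lemma psum_gamma_cancel:
  assumes "psum z (\<gamma> p) (Suc k) \<in> wedge A X n" "comm p 1 z" shows "z ^ k \<in> wedge A X n"
proof (rule wedge_cancel)
  show "of_nat (Suc k) *\<^sub>C (z ^ k * \<gamma> p) \<in> wedge A X n"
    using assms psum_commuting[of "\<gamma> p" z k] by (simp add: comm_def)
qed (simp del: of_nat_Suc)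

lemma psum_scale_gamma_cancel:
  assumes "psum z (c *\<^sub>C (v * \<gamma> p)) k \<in> wedge A X n" "comm p 1 z" "c \<noteq> 0"
  shows "psum z v k \<in> wedge A X n"
proof (rule wedge_cancel)
  show "c *\<^sub>C (psum z v k * \<gamma> p) \<in> wedge A X n"
    using assms(1,2) by (simp add: psum_scale psum_mult_right comm_def)
qed (rule assms(3))

text \<open>As g commutes with x, the derivative of x^(k+1) is (k + 1) x^k times
  \<open>\<gamma> g\<close>. The case g = 0 excludes ordinary primitive elements.\<close>

lemma no_central_skew:
  assumes "skew g x" "x \<notin> X" "comm g 1 x" shows False
proof -
  interpret skew_family A X \<gamma> 1 "\<lambda>_. x" "\<lambda>_. g"
  proof
    show "skew g x" by (rule assms(1))
    fix i :: nat assume i: "i < 1"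
    obtain \<xi> :: "'a \<Rightarrow> complex" where "clinear \<xi>" "\<forall>y\<in>X. \<xi> y = 0" "\<xi> x = 1"
      using vanishing_functional[OF assms(2)] .
    then show "\<exists>\<xi>::'a \<Rightarrow> complex. clinear \<xi> \<and> (\<forall>y\<in>X. \<xi> y = 0) \<and>
        (\<forall>j<1. \<xi> x = (if j = i then 1 else 0))"
      using i by (intro exI[of _ \<xi>]) simp
  qed
  have x: "der 0 1 x (\<gamma> g)" using der_x[of 0 0] by simp
  show False
  proof (rule no_descent[of 1 x])
    fix k assume "x ^ Suc k \<in> wedge A X (Suc k * 1)"
    with der_psum_power[OF x, of "Suc k"] have "psum x (\<gamma> g) (Suc k) \<in> wedge A X k"
      by (intro der_drop[of 0 k "x ^ Suc k"]) (simp_all del: psum.simps power_Suc wedge.simps)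
    then show "x ^ k \<in> wedge A X (k * 1)" using psum_gamma_cancel[OF _ assms(3)] by simp
  qed simp
qed

text \<open>The braided commutator \<open>z\<close> of \<open>x\<close> and \<open>y\<close> is an imaginary root vector for the affine
  type \<open>A\<^sub>1\<close>: it has trivial self-braiding, hence infinite height.\<close>

lemma no_opposite_skew_pair:
  assumes x: "skew g x" "x \<notin> X" "comm g q x" and y: "skew (- g) y" "y \<notin> X" "comm g (inverse q) y"
    and q: "q \<noteq> 0" "q ^ 2 \<noteq> 1"
  shows False
proof -
  \<comment> \<open>Distinct eigenvalues of \<open>\<gamma> g\<close> on x and y make the pair
    independent modulo X.\<close>
  have qi: "q \<noteq> inverse q" using q by (auto simp: power2_eq_square field_simps)
  let ?x = "\<lambda>i::nat. if i = 0 then x else y" and ?g = "\<lambda>i::nat. if i = 0 then g else - g"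
  interpret skew_family A X \<gamma> 2 ?x ?g
  proof
    show "skew (?g i) (?x i)" for i using x y by simp
    fix i :: nat assume "i < 2"
    then consider "i = 0" | "i = 1" by linarith
    then show "\<exists>\<xi>::'a \<Rightarrow> complex. clinear \<xi> \<and> (\<forall>y\<in>X. \<xi> y = 0) \<and>
        (\<forall>j<2. \<xi> (?x j) = (if j = i then 1 else 0))"
    proof cases
      case 1
      obtain \<xi> :: "'a \<Rightarrow> complex" where "clinear \<xi>" "\<forall>y\<in>X. \<xi> y = 0" "\<xi> x = 1" "\<xi> y = 0"
        using functional_apart2[OF x(2,3) y(3) qi] .
      then show ?thesis by (intro exI[of _ \<xi>]) (simp add: 1)
    next
      case 2
      obtain \<xi> :: "'a \<Rightarrow> complex" where "clinear \<xi>" "\<forall>y\<in>X. \<xi> y = 0" "\<xi> y = 1" "\<xi> x = 0"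
        using functional_apart2[OF y(2,3) x(3) qi[symmetric]] .
      then show ?thesis by (intro exI[of _ \<xi>]) (auto simp: 2 less_2_cases_iff)
    qed
  qed
  have d: "der 0 1 x (\<gamma> g)" "der 1 1 x 0" "der 0 1 y 0" "der 1 1 y (\<gamma> (- g))"
    using der_x[of 0 0] der_x[of 0 1] der_x[of 1 0] der_x[of 1 1] by simp_all
  \<comment> \<open>The coefficient comes from the scalar q_12 by which \<open>\<gamma> g\<close>
    acts on y, as in the braided commutator x y - q_12 y x; it makes the derivative along x
    vanish.\<close>
  define z where "z = x * y + (- inverse q) *\<^sub>C (y * x)"
  have "comm g 1 (x * y)" "comm g 1 (y * x)"
    using comm_mult[OF x(3) y(3)] comm_mult[OF y(3) x(3)] q(1) by simp_all
  then have zg: "comm g 1 z" unfolding z_def by (intro comm_lin)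
  then have zg': "comm (- g) 1 z" using comm_inverse by fastforce
  \<comment> \<open>This is 1 - q_12 q_21.\<close>
  define c where "c = 1 - inverse q * inverse q"
  have c: "c \<noteq> 0" using q by (auto simp: c_def power2_eq_square field_simps)
  have z0: "der 0 2 z 0"
    unfolding z_def
    by (rule der_cong[OF der_add[OF der_mult[OF d(1,3)] der_scale[OF der_mult[OF d(3,1)]]]])
      (use y(3) in \<open>simp_all add: comm_def\<close>)
  have "\<gamma> (- g) * x = inverse q *\<^sub>C (x * \<gamma> (- g))"
    using comm_inverse[OF x(3) q(1)] by (simp add: comm_def)
  then have z1: "der 1 2 z (c *\<^sub>C (x * \<gamma> (- g)))"
    unfolding z_def
    by (intro der_cong[OF der_add[OF der_mult[OF d(2,4)] der_scale[OF der_mult[OF d(4,2)]]]])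
      (simp_all add: c_def scaleC_scaleC cvec.scale_left_diff_distrib)
  show False
  proof (rule no_descent[of 2 z])
    \<comment> \<open>Differentiating along y and then along x lowers the degree from 2 k + 2 to 2
      k; the second time only the inserted x contributes, as z has derivative zero along x.\<close>
    fix k assume z: "z ^ Suc k \<in> wedge A X (Suc k * 2)"
    from der_psum_power[OF z1, of "Suc k"] z
    have "psum z (c *\<^sub>C (x * \<gamma> (- g))) (Suc k) \<in> wedge A X (Suc (k * 2))"
      by (intro der_drop[of 1 "Suc (k * 2)" "z ^ Suc k"]) (simp_all del: psum.simps power_Suc wedge.simps)
    then have "psum z x (Suc k) \<in> wedge A X (Suc (k * 2))"
      by (rule psum_scale_gamma_cancel[OF _ zg' c])
    with der_psum[OF z0 d(1), of k] have "psum z (\<gamma> g) (Suc k) \<in> wedge A X (k * 2)"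
      by (intro der_drop[of 0 "k * 2" "psum z x (Suc k)"]) (simp_all del: psum.simps power_Suc wedge.simps)
    then show "z ^ k \<in> wedge A X (k * 2)" by (rule psum_gamma_cancel[OF _ zg])
  qed simp
qed

text \<open>The iterated braided commutator \<open>z\<close> below is an imaginary root vector for the
  affine type \<open>A\<^sub>2\<close>.\<close>

lemma no_skew_triangle:
  assumes sk: "skew a x1" "skew b x2" "skew c x3" and nX: "x1 \<notin> X" "x2 \<notin> X" "x3 \<notin> X"
    and x1: "comm a (- 1) x1" "comm b e x1" "comm c (- e) x1"
    and x2: "comm a (- e) x2" "comm b (- 1) x2" "comm c e x2"
    and x3: "comm a e x3" "comm b (- e) x3" "comm c (- 1) x3"
    and e: "e * e = 1"
  shows False
proof -
  have "e \<noteq> 0" using e by auto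
  then have "e + e \<noteq> 0" by (simp flip: mult_2)
  then have ne: "e \<noteq> - e" "- e \<noteq> e" by (auto simp: eq_neg_iff_add_eq_0 neg_eq_iff_add_eq_0)
  let ?x = "\<lambda>i::nat. if i = 0 then x1 else if i = 1 then x2 else x3"
    and ?g = "\<lambda>i::nat. if i = 0 then a else if i = 1 then b else c"
  interpret skew_family A X \<gamma> 3 ?x ?g
  proof
    show "skew (?g i) (?x i)" for i using sk by simp
    fix i :: nat assume "i < 3"
    then consider "i = 0" | "i = 1" | "i = 2" by linarith
    then show "\<exists>\<xi>::'a \<Rightarrow> complex. clinear \<xi> \<and> (\<forall>y\<in>X. \<xi> y = 0) \<and>
        (\<forall>j<3. \<xi> (?x j) = (if j = i then 1 else 0))"
    proof cases
      case 1
      obtain \<xi> :: "'a \<Rightarrow> complex" where "clinear \<xi>" "\<forall>y\<in>X. \<xi> y = 0" "\<xi> x1 = 1" "\<xi> x2 = 0" "\<xi> x3 = 0"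
        using functional_apart3[OF nX(1) x1(3) x2(3) ne(2) x1(2) x3(2) ne(1) x2(2)] .
      then show ?thesis by (intro exI[of _ \<xi>]) (simp add: 1)
    next
      case 2
      obtain \<xi> :: "'a \<Rightarrow> complex" where "clinear \<xi>" "\<forall>y\<in>X. \<xi> y = 0" "\<xi> x2 = 1" "\<xi> x1 = 0" "\<xi> x3 = 0"
        using functional_apart3[OF nX(2) x2(3) x1(3) ne(1) x2(1) x3(1) ne(2) x1(1)] .
      then show ?thesis by (intro exI[of _ \<xi>]) (simp add: 2)
    next
      case 3
      obtain \<xi> :: "'a \<Rightarrow> complex" where "clinear \<xi>" "\<forall>y\<in>X. \<xi> y = 0" "\<xi> x3 = 1" "\<xi> x1 = 0" "\<xi> x2 = 0"
        using functional_apart3[OF nX(3) x3(2) x1(2) ne(2) x3(1) x2(1) ne(1) x1(1)] .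
      then show ?thesis by (intro exI[of _ \<xi>]) (simp add: 3)
    qed
  qed
  have d: "der 0 1 x1 (\<gamma> a)" "der 1 1 x1 0" "der 2 1 x1 0" "der 0 1 x2 0" "der 1 1 x2 (\<gamma> b)"
    "der 2 1 x2 0" "der 0 1 x3 0" "der 1 1 x3 0" "der 2 1 x3 (\<gamma> c)"
    using der_x[of 0 0] der_x[of 0 1] der_x[of 0 2] der_x[of 1 0] der_x[of 1 1] der_x[of 1 2]
      der_x[of 2 0] der_x[of 2 1] der_x[of 2 2] by simp_all
  \<comment> \<open>The signs come from the braiding: \<open>\<gamma> b\<close> acts on x3 by - e,
    and \<open>\<gamma> a\<close> acts on w by - 1.\<close>
  define w where "w = x2 * x3 + e *\<^sub>C (x3 * x2)"
  define z where "z = x1 * w + w * x1"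
  \<comment> \<open>Up to the factor 2, u is what the derivative of z along x3 leaves once
    \<open>\<gamma> c\<close> has been moved to the right across x1, on which it acts by -
    e.\<close>
  define u where "u = x1 * x2 + (- e) *\<^sub>C (x2 * x1)"
  have "comm a (- 1) (x2 * x3)" "comm a (- 1) (x3 * x2)" "comm b e (x2 * x3)" "comm b e (x3 * x2)"
    "comm c (- e) (x2 * x3)" "comm c (- e) (x3 * x2)"
    using comm_mult[OF x2(1) x3(1)] comm_mult[OF x3(1) x2(1)] comm_mult[OF x2(2) x3(2)]
      comm_mult[OF x3(2) x2(2)] comm_mult[OF x2(3) x3(3)] comm_mult[OF x3(3) x2(3)] e by simp_all
  then have w: "comm a (- 1) w" "comm b e w" "comm c (- e) w"
    unfolding w_def by (intro comm_lin; simp)+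
  have "comm a 1 (x1 * w)" "comm a 1 (w * x1)" "comm b 1 (x1 * w)" "comm b 1 (w * x1)"
    "comm c 1 (x1 * w)" "comm c 1 (w * x1)"
    using comm_mult[OF x1(1) w(1)] comm_mult[OF w(1) x1(1)] comm_mult[OF x1(2) w(2)]
      comm_mult[OF w(2) x1(2)] comm_mult[OF x1(3) w(3)] comm_mult[OF w(3) x1(3)] e by simp_all
  then have z: "comm a 1 z" "comm b 1 z" "comm c 1 z" unfolding z_def by (intro comm_lin; simp)+
  have w0: "der 0 2 w 0"
    unfolding w_def
    by (rule der_cong[OF der_add[OF der_mult[OF d(4,7)] der_scale[OF der_mult[OF d(7,4)]]]]) simp_all
  have w1: "der 1 2 w 0"
    unfolding w_def
    by (rule der_cong[OF der_add[OF der_mult[OF d(5,8)] der_scale[OF der_mult[OF d(8,5)]]]])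
      (use x3(2) in \<open>simp_all add: comm_def\<close>)
  have two: "v + v = 2 *\<^sub>C v" for v :: 'a using scaleC_add_left[of 1 1 v] by simp
  have w2: "der 2 2 w (2 *\<^sub>C (x2 * \<gamma> c))"
    unfolding w_def
    by (rule der_cong[OF der_add[OF der_mult[OF d(6,9)] der_scale[OF der_mult[OF d(9,6)]]]])
      (use x2(3) in \<open>simp_all add: comm_def scaleC_scaleC e two\<close>)
  have comm3: "1 + 2 = (3::nat)" "2 + 1 = (3::nat)" by simp_all
  have z0: "der 0 3 z 0"
    unfolding z_def
    by (rule der_cong[OF der_add[OF der_mult[OF d(1) w0, unfolded comm3] der_mult[OF w0 d(1), unfolded comm3]]])
      (use w(1) in \<open>simp_all add: comm_def\<close>)
  have z1: "der 1 3 z 0"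
    unfolding z_def
    by (rule der_cong[OF der_add[OF der_mult[OF d(2) w1, unfolded comm3] der_mult[OF w1 d(2), unfolded comm3]]])
      simp_all
  have z2: "der 2 3 z (2 *\<^sub>C (u * \<gamma> c))"
    unfolding z_def
    by (rule der_cong[OF der_add[OF der_mult[OF d(3) w2, unfolded comm3] der_mult[OF w2 d(3), unfolded comm3]]])
      (use x1(3) in \<open>simp_all add: u_def comm_def mult_scaleC_left mult_scaleC_right mult.assoc distrib_right
        scaleC_add_right cvec.scale_right_diff_distrib scaleC_scaleC left_diff_distrib\<close>)
  have u0: "der 0 2 u ((- 2 * e) *\<^sub>C (x2 * \<gamma> a))"
    unfolding u_def
    by (rule der_cong[OF der_add[OF der_mult[OF d(1,4)] der_scale[OF der_mult[OF d(4,1)]]]])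
      (use x2(1) in \<open>simp_all add: comm_def two scaleC_scaleC flip: scaleC_add_left\<close>)
  show False
  proof (rule no_descent[of 3 z])
    \<comment> \<open>The first direction must be x3, the only one in which z has a nonzero
      derivative. For the following directions x1 and x2, z is a constant, and only the inserted
      factors u and then x2 are differentiated.\<close>
    fix k assume zk: "z ^ Suc k \<in> wedge A X (Suc k * 3)"
    from der_psum_power[OF z2, of "Suc k"] zk
    have "psum z (2 *\<^sub>C (u * \<gamma> c)) (Suc k) \<in> wedge A X (Suc (Suc (k * 3)))"
      by (intro der_drop[of 2 "Suc (Suc (k * 3))" "z ^ Suc k"])
        (simp_all add: numeral_3_eq_3 del: psum.simps power_Suc wedge.simps)
    then have "psum z u (Suc k) \<in> wedge A X (Suc (Suc (k * 3)))"
      by (rule psum_scale_gamma_cancel[OF _ z(3)]) simp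
    with der_psum[OF z0 u0, of k]
    have "psum z ((- 2 * e) *\<^sub>C (x2 * \<gamma> a)) (Suc k) \<in> wedge A X (Suc (k * 3))"
      by (intro der_drop[of 0 "Suc (k * 3)" "psum z u (Suc k)"])
        (simp_all add: numeral_2_eq_2 del: psum.simps power_Suc wedge.simps)
    then have "psum z x2 (Suc k) \<in> wedge A X (Suc (k * 3))"
      by (rule psum_scale_gamma_cancel[OF _ z(1)]) (use e in auto)
    with der_psum[OF z1 d(5), of k] have "psum z (\<gamma> b) (Suc k) \<in> wedge A X (k * 3)"
      by (intro der_drop[of 1 "k * 3" "psum z x2 (Suc k)"]) (simp_all del: psum.simps power_Suc wedge.simps)
    then show "z ^ k \<in> wedge A X (k * 3)" by (rule psum_gamma_cancel[OF _ z(2)])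
  qed simp
qed

end

section \<open>The alternating group on five letters\<close>

text \<open>A permutation \<open>p\<close> of \<open>{1..5}\<close> is encoded as \<open>[p 1, \<dots>, p 5]\<close>; \<open>perm_lists n\<close> pairs the codes of
  those fixing all \<open>i > n\<close> with their parity.\<close>

definition list_mult :: "nat list \<Rightarrow> nat list \<Rightarrow> nat list" where
  "list_mult l k = map (\<lambda>i. l ! (i - 1)) k"

primrec perm_lists :: "nat \<Rightarrow> (bool \<times> nat list) list" where
  "perm_lists 0 = [(True, [1, 2, 3, 4, 5])]"
| "perm_lists (Suc n) = concat (map (\<lambda>b. map (\<lambda>(e, l). ((Suc n = b) = e, map (Transposition.transpose (Suc n) b) l))
     (perm_lists n)) [1..<Suc (Suc n)])"

definition A5_lists :: "nat list list" where
  "A5_lists = map snd (filter fst (perm_lists 5))"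

text \<open>The cases of the final argument for one code l. For an involution, conjugation by t must
  permute l, b and c = l b cyclically, which already forces three distinct involutions. Otherwise u
  is the cube of l, so the fifth power of u covers orders 3 and 5 at once, and the last condition
  says that t conjugates l to its inverse.\<close>

definition A5_check :: "nat list \<Rightarrow> bool" where
  "A5_check l \<longleftrightarrow> (let m = list_mult; e = [1, 2, 3, 4, 5]; s = m l l in
     if s = e then
       l = e \<or> list_ex (\<lambda>b. let c = m l b in c = m b l \<and>
         list_ex (\<lambda>t. m t l = m b t \<and> m t b = m c t \<and> m t c = m l t) A5_lists) A5_lists
     else
       (let u = m s l in m u (m u (m u (m u u))) = e) \<and>
       list_ex (\<lambda>t. m (m l t) l = t) A5_lists)"

lemma A5_check_all: "list_all A5_check A5_lists"
  by code_simp

text \<open>A permutation of {1..n+1} is a transposition of n + 1 with some b following a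
  permutation of {1..n}, and the parity flips unless b = n + 1, where the transposition is the
  identity.\<close>

lemma set_perm_lists:
  assumes "n \<le> 5"
  shows "set (perm_lists n) = (\<lambda>p. (evenperm p, map p [1, 2, 3, 4, 5])) ` {p. p permutes {1..n}}"
  using assms
proof (induction n)
  case 0
  have "{p. p permutes {1..0::nat}} = {id}" by (auto simp: permutes_empty)
  then show ?case by (simp add: evenperm_id)
next
  case (Suc n)
  have ins: "{1..Suc n} = insert (Suc n) {1..n}" by auto
  have step: "(evenperm (Transposition.transpose (Suc n) b \<circ> p), map (Transposition.transpose (Suc n) b \<circ> p) xs) =
      ((Suc n = b) = evenperm p, map (Transposition.transpose (Suc n) b) (map p xs))"
    if "p permutes {1..n}" for b p xs
  proof -
    have "permutation p" using that by (auto simp: permutation_permutes)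
    then show ?thesis by (simp add: evenperm_comp permutation_swap_id evenperm_swap)
  qed
  have gen: "(\<Union>b\<in>B. \<Union>p\<in>Q. {F (T b \<circ> p)}) = F ` (\<lambda>(b, p). T b \<circ> p) ` {(b, p). b \<in> B \<and> p \<in> Q}"
    for F :: "(nat \<Rightarrow> nat) \<Rightarrow> bool \<times> nat list" and T :: "nat \<Rightarrow> nat \<Rightarrow> nat" and B Q
    by force
  let ?F = "\<lambda>p. (evenperm p, map p [1, 2, 3, 4, 5])"
  have "set (perm_lists (Suc n)) = (\<Union>b\<in>{1..Suc n}. \<Union>p\<in>{p. p permutes {1..n}}.
      {((Suc n = b) = evenperm p, map (Transposition.transpose (Suc n) b) (map p [1, 2, 3, 4, 5]))})"
  proof -
    have IH: "set (perm_lists n) = ?F ` {p. p permutes {1..n}}" using Suc by simp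
    have "set [1..<Suc (Suc n)] = {1..Suc n}" by auto
    then show ?thesis unfolding perm_lists.simps set_concat set_map image_image IH
      by (auto simp del: map_map list.map)
  qed
  also have "\<dots> = (\<Union>b\<in>{1..Suc n}. \<Union>p\<in>{p. p permutes {1..n}}.
      {?F (Transposition.transpose (Suc n) b \<circ> p)})"
    by (intro SUP_cong refl) (simp only: step mem_Collect_eq)
  also have "\<dots> = ?F ` {p. p permutes {1..Suc n}}"
    unfolding ins permutes_insert by (rule gen[where F = ?F and T = "Transposition.transpose (Suc n)"])
  finally show ?case .
qed

definition alt5_list :: "alt5 \<Rightarrow> nat list" where
  "alt5_list g = map (Rep_alt5 g) [1, 2, 3, 4, 5]"

lemma Rep_alt5_permutes: "Rep_alt5 g permutes {1..5}" "evenperm (Rep_alt5 g)"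
  using Rep_alt5[of g] by (simp_all add: alt_group_carrier)

lemma range_alt5_list: "range alt5_list = set A5_lists"
proof -
  have "set A5_lists = {map p [1, 2, 3, 4, 5] | p. p permutes {1..5} \<and> evenperm p}"
  proof -
    have "snd ` {x \<in> (\<lambda>p. (evenperm p, F p)) ` S. fst x} = {F p | p. p \<in> S \<and> evenperm p}"
      for F :: "(nat \<Rightarrow> nat) \<Rightarrow> nat list" and S by force
    then show ?thesis
      unfolding A5_lists_def set_map set_filter set_perm_lists[OF order_refl] by (simp only: mem_Collect_eq)
  qed
  also have "\<dots> = {map p [1, 2, 3, 4, 5] | p. p \<in> carrier (alt_group 5)}"
    by (simp add: alt_group_carrier)
  also have "\<dots> = range alt5_list"
    unfolding alt5_list_def type_definition.Rep_range[OF type_definition_alt5, symmetric] by blast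
  finally show ?thesis ..
qed

lemma inj_alt5_list: "alt5_list g = alt5_list h \<Longrightarrow> g = h"
proof -
  assume eq: "alt5_list g = alt5_list h"
  have "Rep_alt5 g i = Rep_alt5 h i" for i
  proof (cases "i \<in> {1..5}")
    case True
    then have "i \<in> set [1, 2, 3, 4, 5]" by auto
    then show ?thesis using eq unfolding alt5_list_def map_eq_conv by blast
  next
    case False
    then show ?thesis by (metis Rep_alt5_permutes(1) permutes_not_in)
  qed
  then show "g = h" by (metis Rep_alt5_inject ext)
qed

lemma alt5_list_zero: "alt5_list 0 = [1, 2, 3, 4, 5]"
  by (simp add: alt5_list_def zero_alt5.rep_eq alt_group_one)

lemma alt5_list_add: "alt5_list (g + h) = list_mult (alt5_list g) (alt5_list h)"
proof -
  have "map (Rep_alt5 g) [1, 2, 3, 4, 5] ! (i - 1) = Rep_alt5 g i" if "i \<in> {1..5}" for i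
  proof -
    have "i = 1 \<or> i = 2 \<or> i = 3 \<or> i = 4 \<or> i = 5" using that by auto
    then show ?thesis by (elim disjE) (simp_all add: eval_nat_numeral)
  qed
  moreover have "Rep_alt5 h i \<in> {1..5}" if "i \<in> {1..5}" for i
    using that unfolding permutes_in_image[OF Rep_alt5_permutes(1)] .
  ultimately have "map (Rep_alt5 g) [1, 2, 3, 4, 5] ! (Rep_alt5 h i - 1) = Rep_alt5 g (Rep_alt5 h i)"
    if "i \<in> {1..5}" for i using that by blast
  then show ?thesis
    unfolding alt5_list_def list_mult_def map_map plus_alt5.rep_eq alt_group_mult map_eq_conv o_def
    by (auto simp del: list.map)
qed

text \<open>The computed check, read back through the injective encoding. Additively, t + g = b + t
  means that t conjugates g to b, and g + t + g = t that it conjugates g to its inverse.\<close>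

lemma alt5_cases:
  fixes g :: alt5
  obtains (zero) "g = 0"
    | (involution) b t where "g + g = 0" "g + b = b + g" "t + g = b + t" "t + b = (g + b) + t"
        "t + (g + b) = g + t"
    | (odd) t where "(g + g + g) + ((g + g + g) + ((g + g + g) + ((g + g + g) + (g + g + g)))) = 0"
        "g + t + g = t"
proof -
  note L = alt5_list_add[symmetric] alt5_list_zero[symmetric]
  have eq: "alt5_list g = alt5_list h \<longleftrightarrow> g = h" for g h using inj_alt5_list by blast
  have ex: "list_ex P A5_lists \<longleftrightarrow> (\<exists>h. P (alt5_list h))" for P
    by (simp add: list_ex_iff range_alt5_list[symmetric])
  have "A5_check (alt5_list g)"
    using A5_check_all range_alt5_list by (auto simp: list_all_iff)
  then have "if g + g = 0 then g = 0 \<or> (\<exists>b. g + b = b + g \<and> (\<exists>t. t + g = b + t \<and> t + b = (g + b) + t \<and>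
      t + (g + b) = g + t)) else (g + g + g) + ((g + g + g) + ((g + g + g) + ((g + g + g) + (g + g + g)))) = 0 \<and>
      (\<exists>t. g + t + g = t)"
    unfolding A5_check_def Let_def ex L eq .
  then show thesis using that by (auto split: if_splits)
qed

section \<open>Excluding skew-primitive elements over the alternating group\<close>

locale pointed_alt5 = pointed_bialgebra A X \<gamma>
  for A :: "'a::complex_algebra_1 coalg" and X and \<gamma> :: "alt5 \<Rightarrow> 'a"
begin

lemma eigen_skew_exists:
  assumes "skew g x" "x \<notin> X" "n > 0" "\<gamma> g ^ n = 1"
  obtains q y where "q ^ n = 1" "skew g y" "y \<notin> X" "comm g q y"
proof -
  have "\<gamma> g * y * \<gamma> (- g) \<in> {x. skew g x}" if "y \<in> {x. skew g x}" for y
    using skew_conj[of g y g] that by simp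
  from eigenvector_exists[OF assms(3,4) subspace_skew this, of x] assms(1,2) that show thesis by blast
qed

lemma group_algebra: "X = UNIV"
proof (rule ccontr)
  assume "X \<noteq> UNIV"
  then obtain g x where x: "skew g x" "x \<notin> X" by (rule skew_exists)
  show False
  proof (cases g rule: alt5_cases)
    case zero
    then show False using no_central_skew[OF x] by (simp add: comm_def gamma_zero)
  next
    case (odd t)
    \<comment> \<open>The exponent 15 treats orders 3 and 5 together; as it is odd, q \<noteq> 1
      will imply q^2 \<noteq> 1.\<close>
    have "\<gamma> g ^ 3 = \<gamma> (g + g + g)" by (simp add: gamma_add power3_eq_cube)
    then have "(\<gamma> g ^ 3) ^ 5 = 1"
      using odd(1) by (simp add: eval_nat_numeral gamma_zero flip: gamma_add)
    then have "\<gamma> g ^ 15 = 1" by (simp flip: power_mult)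
    from eigen_skew_exists[OF x _ this]
    obtain q y where y: "q ^ 15 = 1" "skew g y" "y \<notin> X" "comm g q y" by auto
    show False
    proof (cases "q = 1")
      case True
      then show False using no_central_skew[OF y(2,3)] y(4) by simp
    next
      case False
      have "q \<noteq> 0" using y(1) by auto
      have q2: "q ^ 2 \<noteq> 1"
      proof
        assume "q ^ 2 = 1"
        have "q ^ 15 = (q ^ 2) ^ 7 * q" by (simp add: eval_nat_numeral mult.assoc)
        also have "\<dots> = q" unfolding \<open>q ^ 2 = 1\<close> by simp
        finally show False using y(1) False by metis
      qed
      have t: "t + g = - g + t" using odd(2) by (metis add.assoc add_0 left_minus)
      then have tg: "t + g + - t = - g" by (simp add: add.assoc)
      \<comment> \<open>The conjugate of y lies over - g with the same self-braiding q, so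
        \<open>\<gamma> g\<close> acts on it by the inverse of q, as
        \<open>no_opposite_skew_pair\<close> requires.\<close>
      have "comm (- g) q (\<gamma> t * y * \<gamma> (- t))" by (rule comm_conj[OF y(4) t])
      then have "comm g (inverse q) (\<gamma> t * y * \<gamma> (- t))"
        using comm_inverse[of "- g" q] \<open>q \<noteq> 0\<close> by simp
      then show False
        using no_opposite_skew_pair[OF y(2-4), of "\<gamma> t * y * \<gamma> (- t)"] skew_conj[OF y(2), of t] y(3)
          \<open>q \<noteq> 0\<close> q2 unfolding tg by (simp add: conj_in_X)
    qed
  next
    case (involution b t)
    have "\<gamma> g ^ 2 = 1" by (simp add: power2_eq_square involution(1) gamma_zero flip: gamma_add)
    from eigen_skew_exists[OF x _ this]
    obtain q y where y: "q ^ 2 = 1" "skew g y" "y \<notin> X" "comm g q y" by auto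
    show False
    proof (cases "q = 1")
      case True
      then show False using no_central_skew[OF y(2,3)] y(4) by simp
    next
      case False
      then have q: "q = - 1" using y(1) by (simp add: power2_eq_1_iff)
      have "b + b + t = b + t + g" using involution(3) by (metis add.assoc)
      also have "\<dots> = t" using involution(1,3) by (metis add.assoc add.right_neutral)
      finally have "b + b = 0" by (metis add_0 add_right_cancel)
      then have b2: "\<gamma> b ^ 2 = 1" by (simp add: power2_eq_square gamma_zero flip: gamma_add)
      have bg: "b + g + - b = g" using involution(2) by (metis add.assoc add.right_inverse add.right_neutral)
      \<comment> \<open>Since b commutes with g, conjugation by \<open>\<gamma> b\<close> preserves
        both conditions, so it has an eigenvector x1 inside \<open>?W\<close>, with eigenvalue
        e.\<close>
      let ?W = "{x. skew g x} \<inter> {x. comm g (- 1) x}"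
      have W: "cvec.subspace ?W" by (rule cvec.subspace_inter[OF subspace_skew subspace_comm])
      have W': "\<gamma> b * x * \<gamma> (- b) \<in> ?W" if "x \<in> ?W" for x
        using skew_conj[of g x b] comm_conj[of g "- 1" x b g] that bg involution(2) by simp
      have yW: "y \<in> ?W" using y(2,4) q by simp
      obtain e x1 where "e ^ 2 = 1" "x1 \<in> ?W" "x1 \<notin> X" "comm b e x1"
        using eigenvector_exists[OF pos2 b2 W W' yW y(3)] by blast
      then have x1: "e ^ 2 = 1" "skew g x1" "comm g (- 1) x1" "x1 \<notin> X" "comm b e x1" by simp_all
      define c where "c = g + b"
      define x2 where "x2 = \<gamma> t * x1 * \<gamma> (- t)"
      define x3 where "x3 = \<gamma> t * x2 * \<gamma> (- t)"
      \<comment> \<open>Conjugation by t rotates g, b, c, hence rotates the eigenvalues - 1, e, - e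
        of x1 into those of x2 and x3.\<close>
      have ts: "t + g = b + t" "t + b = c + t" "t + c = g + t" using involution by (simp_all add: c_def)
      then have conj: "t + g + - t = b" "t + b + - t = c" by (simp_all add: add.assoc)
      have c1: "comm c (- e) x1" using comm_add[OF x1(3,5)] by (simp add: c_def)
      note comm2 = comm_conj[OF x1(3) ts(1), folded x2_def] comm_conj[OF x1(5) ts(2), folded x2_def]
        comm_conj[OF c1 ts(3), folded x2_def]
      note comm3 = comm_conj[OF comm2(1) ts(2), folded x3_def] comm_conj[OF comm2(2) ts(3), folded x3_def]
        comm_conj[OF comm2(3) ts(1), folded x3_def]
      have sk2: "skew b x2" using skew_conj[OF x1(2), of t] unfolding conj x2_def .
      have sk3: "skew c x3" using skew_conj[OF sk2, of t] unfolding conj x3_def .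
      have nX: "x2 \<notin> X" "x3 \<notin> X" using x1(4) by (simp_all only: x2_def x3_def conj_in_X not_False_eq_True)
      show False
        by (rule no_skew_triangle[OF x1(2) sk2 sk3 x1(4) nX x1(3,5) c1 comm2(3,1,2) comm3(2,3,1)])
          (use x1(1) in \<open>simp add: power2_eq_square\<close>)
    qed
  qed
qed

end

section \<open>Hopf algebras with coradical a twist of the group algebra\<close>

definition untwisted :: "'a::complex_algebra_1 coalg \<Rightarrow> ('a, 'a) tensor \<Rightarrow> ('a, 'a) tensor \<Rightarrow> 'a coalg" where
  "untwisted A J K = \<lparr>comult = (\<lambda>h. K * comult A h * J), counit = counit A\<rparr>"

lemma ring_inv_eq:
  assumes "x * y = 1" "y * x = 1" shows "ring_inv x = y"
  unfolding ring_inv_def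
proof (rule the_equality)
  fix z assume z: "x * z = 1 \<and> z * x = 1"
  have "z = y * (x * z)" by (simp add: assms flip: mult.assoc)
  then show "z = y" using z by simp
qed (simp add: assms)

lemma tmap_in_tensor_sub:
  assumes "clinear f" "clinear g" shows "tmap f g t \<in> tensor_sub (range f) (range g)"
  by (induction t rule: tensor_induct)
    (simp_all add: tmap_tens assms tens_in_tensor_sub clinear_add[OF clinear_tmap[OF assms]]
      cvec.subspace_add[OF subspace_tensor_sub])

lemma independent_image:
  assumes f: "clinear f" "inj f" and B: "cvec.independent B"
  shows "cvec.independent (f ` B)"
  using cvec_pair.linear_independent_injective_image[OF f(1) B] f(2) by (simp add: inj_on_subset)

lemma independent_single: "cvec.independent (range (\<lambda>g :: 'g. Poly_Mapping.single g (1::complex)))"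
proof
  let ?s = "\<lambda>g :: 'g. Poly_Mapping.single g (1::complex)"
  assume "cvec.dependent (range ?s)"
  then obtain g where "?s g \<in> cvec.span (range ?s - {?s g})" unfolding cvec.dependent_def by blast
  moreover have "clinear (\<lambda>p. Poly_Mapping.lookup p g :: complex)"
    by (simp add: clinear_iff lookup_add)
  ultimately have "Poly_Mapping.lookup (?s g) g = 0"
    by (rule cvec_pair.linear_eq_0_on_span[rotated 2]) (auto simp: lookup_single when_def)
  then show False by simp
qed

lemma span_single: "cvec.span (range (\<lambda>g. Poly_Mapping.single g (1::complex))) = UNIV"
proof -
  have "p \<in> cvec.span (range (\<lambda>g. Poly_Mapping.single g (1::complex)))" for p :: "'a \<Rightarrow>\<^sub>0 complex"
  proof -
    have "(\<Sum>k\<in>Poly_Mapping.keys p. Poly_Mapping.lookup p k *\<^sub>C Poly_Mapping.single k (1::complex))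
        \<in> cvec.span (range (\<lambda>g. Poly_Mapping.single g (1::complex)))"
      by (intro cvec.span_sum cvec.span_scale cvec.span_base) simp
    then show ?thesis by (simp add: scaleC_single scaleC_complex_def poly_mapping_sum_single)
  qed
  then show ?thesis by blast
qed

theorem theorem4p1:
  fixes P :: "(nat \<Rightarrow> nat) set"
    and \<beta> :: "((nat \<Rightarrow> nat) \<Rightarrow> complex) \<Rightarrow> ((nat \<Rightarrow> nat) \<Rightarrow> complex) \<Rightarrow> complex"
    and J :: "(CA5, CA5) tensor"
    and H :: "'h::complex_algebra_1 coalg"
  assumes "subgroup P (alt_group 5)"
    and "(alt_group 5)\<lparr>carrier := P\<rparr> \<cong> integer_mod_group 2 \<times>\<times> integer_mod_group 2"
    and "normalized_2cocycle (dual_group P) \<beta>"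
    and "\<not> is_2coboundary (dual_group P) \<beta>"
    and "J = nikshych_twist P \<beta>"
    and "hopf_algebra H"
    and "finite_dimensional TYPE('h)"
    and "hopf_subalgebra H (coradical H)"
    and "hopf_isomorphic_to_sub (twisted group_coalg J) H (coradical H)"
  shows "hopf_isomorphic (twisted group_coalg J) H"
proof -
  let ?B = "group_coalg :: CA5 coalg"
  define X where "X = coradical H"
  obtain f where f: "hopf_iso_onto (twisted ?B J) H X f"
    using assms(9) by (auto simp: hopf_isomorphic_to_sub_def X_def)
  have twist: "is_twist ?B J" unfolding assms(5) by (rule is_twist_nikshych_twist[OF assms(1-3)])
  then obtain K where K: "J * K = 1" "K * J = 1" by (auto simp: is_twist_def)
  have fl: "clinear f" "f 1 = 1" "\<And>a b. f (a * b) = f a * f b" "\<And>a. counit H (f a) = counit ?B a"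
    "range f = X" "inj f"
    and fD: "\<And>a. comult H (f a) = tmap f f (J * comult ?B a * K)"
    using f by (auto simp: hopf_iso_onto_def twisted_def ring_inv_eq[OF K] bij_betw_def)
  have H: "bialgebra H" using assms(6) by (simp add: hopf_algebra_def)
  interpret fd_bialgebra H X
    using H assms(7,8) by unfold_locales (auto simp: hopf_subalgebra_def X_def)
  have twist': "(1 \<boxtimes> J) * tmap id (comult ?B) J = tassoc ((J \<boxtimes> 1) * tmap (comult ?B) id J)"
    "slice_left (counit ?B) J = 1" "slice_right (counit ?B) J = 1"
    using twist by (simp_all add: is_twist_def slice_left_def slice_right_def)
  define H' where "H' = untwisted H (tmap f f J) (tmap f f K)"
  note untwist = bialgebra_untwist[OF H clinear_group_coalg twist' K fl(1-3) fD fl(4),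
      folded untwisted_def, folded H'_def]
  define \<gamma> :: "alt5 \<Rightarrow> 'h" where "\<gamma> g = f (Poly_Mapping.single g 1)" for g
  have single_inj: "inj (\<lambda>g :: alt5. Poly_Mapping.single g (1::complex))"
    by (rule injI) (metis lookup_single_eq lookup_single_not_eq zero_neq_one)
  have range_\<gamma>: "range \<gamma> = f ` range (\<lambda>g. Poly_Mapping.single g 1)"
    by (auto simp: \<gamma>_def)
  obtain N where N: "wedge H X N = UNIV"
    using wedge_coradical_exhaustive[OF assms(7)] X unfolding X_def by blast
  interpret U: pointed_alt5 H' X \<gamma>
  proof unfold_locales
    show "bialgebra H'" by (rule untwist(1))
    show "finite_dimensional TYPE('h)" by (rule assms(7))
    show "1 \<in> X" by (rule one_X)
    show "x * y \<in> X" if "x \<in> X" "y \<in> X" for x y by (rule mult_X[OF that])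
    show "subcoalgebra H' X"
      unfolding subcoalgebra_def
    proof
      show "cvec.subspace X" by (rule subspace_X)
      show "comult H' ` X \<subseteq> tensor_sub X X"
        unfolding fl(5)[symmetric] using tmap_in_tensor_sub[OF fl(1,1)] by (auto simp: untwist(2))
    qed
    show "\<gamma> 0 = 1" by (simp add: \<gamma>_def fl(2))
    show "\<gamma> (g + h) = \<gamma> g * \<gamma> h" for g h by (simp add: \<gamma>_def fl(3)[symmetric] mult_single)
    show "comult H' (\<gamma> g) = \<gamma> g \<boxtimes> \<gamma> g" for g
      by (simp add: \<gamma>_def untwist(2) group_coalg_single tmap_tens fl(1))
    show "X = cvec.span (range \<gamma>)"
      unfolding range_\<gamma> cvec_pair.linear_span_image[OF fl(1)] span_single fl(5) ..
    show "inj \<gamma>" using inj_compose[OF fl(6) single_inj] by (simp add: \<gamma>_def[abs_def] comp_def)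
    show "cvec.independent (range \<gamma>)"
      unfolding range_\<gamma> by (rule independent_image[OF fl(1,6) independent_single])
    \<comment> \<open>As f maps onto X, the transported twist and its inverse have both legs in X;
      exhaustiveness, known for H because X is its coradical, therefore passes to the untwisted
      form.\<close>
    have "tmap f f J \<in> tensor_sub X X" "tmap f f K \<in> tensor_sub X X"
      using tmap_in_tensor_sub[OF fl(1,1)] by (simp_all add: fl(5))
    then have "wedge H X N \<subseteq> wedge H' X N"
      by (rule wedge_twist) (simp add: H'_def untwisted_def)
    then show "\<exists>n. wedge H' X n = UNIV" using N by blast
  qed
  have "X = UNIV" by (rule U.group_algebra)
  \<comment> \<open>Once X is everything, f itself is the required isomorphism.\<close>
  with f show ?thesis unfolding hopf_isomorphic_def hopf_isomorphic_to_sub_def by blast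
qed

end
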